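(* Let $\Psi:\mathcal W_0\oplus\mathcal G_0\to\mathbb R$ be the pullback of the isoperimetric quotient to the labeled similarity slice, $\Psi(\ell,\sigma):=\mathcal I(\Phi(\ell,\sigma))$. Then the Hessian of $\Psi$ at the origin is positive definite on the ten-dimensional space $\mathcal W_0\oplus\mathcal G_0$, i.e. $D^2\Psi(0)[h,h]>0$ for every nonzero $h\in\mathcal W_0\oplus\mathcal G_0$.
   Context: For a convex body $P\subset\mathbb R^3$, $\mathcal I(P):=\operatorname{area}(\partial P)/\operatorname{vol}(P)^{2/3}$. Fixed tetrahedral frame: $\mathbf n_1=2^{-2/3}(1,1,1)$, $\mathbf n_2=2^{-2/3}(1,-1,-1)$, $\mathbf n_3=2^{-2/3}(-1,1,-1)$, $\mathbf n_4=2^{-2/3}(-1,-1,1)$, and $\mathbf n_{ij}^{\times}:=\mathbf n_i\times\mathbf n_j$ (cross product). For weights $\beta=(\beta_{ij})_{1\le i<j\le 4}$ with all $\beta_{ij}>0$ and $M\in\mathrm{SL}(3,\mathbb R)$, define the zonotope (Minkowski sum of six segments) $$Z(\beta,M):=\sum_{1\le i<j\le 4}\left[-\tfrac12\beta_{ij}M\mathbf n_{ij}^{\times},\ \tfrac12\beta_{ij}M\mathbf n_{ij}^{\times}\right].$$ Let $\mathcal W_0=\{\ell=(\ell_{ij})_{1\le i<j\le4}\in\mathbb R^6:\sum_{i<j}\ell_{ij}=0\}$ and $\mathcal G_0=\{\sigma\in\operatorname{Sym}_3(\mathbb R):\operatorname{tr}\sigma=0\}$, where $\operatorname{Sym}_3(\mathbb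 R)$ is the space of real symmetric $3\times3$ matrices. For $(\ell,\sigma)\in\mathcal W_0\oplus\mathcal G_0$ put $$\Phi(\ell,\sigma):=Z(\mathrm e^{\ell},\mathrm e^{-\sigma/2}),$$ where $\mathrm e^\ell$ is the coordinatewise exponential, $(\mathrm e^\ell)_{ij}=\mathrm e^{\ell_{ij}}$, and $\mathrm e^{-\sigma/2}$ is the matrix exponential. The body $\Phi(0,0)=Z(\mathbf 1,I)$ is an Archimedean truncated octahedron, where $\mathbf 1$ denotes the weight vector with all entries $1$. *)

theory Defs
  imports "HOL-Analysis.Analysis"
begin

subsection \<open>Area of a boundary, isoperimetric quotient\<close>

text \<open>
  Area is two-dimensional Hausdorff measure, with the factor \<open>\<pi>/4\<close> that makes it agree with
  Lebesgue measure on planes. Covers are by bounded sets because \<^const>\<open>diameter\<close> is a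
  real-valued supremum and carries no information on unbounded sets.
\<close>

definition hausdorff2_premeasure :: "real \<Rightarrow> 'a::metric_space set \<Rightarrow> ennreal" where
  "hausdorff2_premeasure \<delta> S =
     (INF U \<in> {U :: nat \<Rightarrow> 'a set. S \<subseteq> (\<Union>i. U i) \<and> (\<forall>i. bounded (U i) \<and> diameter (U i) \<le> \<delta>)}.
        \<Sum>i. ennreal (pi / 4 * (diameter (U i))\<^sup>2))"

definition hausdorff2 :: "'a::metric_space set \<Rightarrow> ennreal" where
  "hausdorff2 S = (SUP \<delta>\<in>{0<..}. hausdorff2_premeasure \<delta> S)"

definition boundary_area :: "(real^3) set \<Rightarrow> real" where
  "boundary_area P = enn2real (hausdorff2 (frontier P))"

definition isoperimetric_quotient :: "(real^3) set \<Rightarrow> real" where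
  "isoperimetric_quotient P = boundary_area P / measure lebesgue P powr (2/3)"

subsection \<open>The zonotopes\<close>

typedef edge = "{(i::nat, j::nat). 1 \<le> i \<and> i < j \<and> j \<le> 4}"
  by (rule exI[of _ "(1, 2)"]) simp

instance edge :: finite
proof
  have "{(i::nat, j::nat). 1 \<le> i \<and> i < j \<and> j \<le> 4} \<subseteq> {..4} \<times> {..4}" by auto
  then have "finite {(i::nat, j::nat). 1 \<le> i \<and> i < j \<and> j \<le> 4}"
    by (rule finite_subset) simp
  then have "finite (range Rep_edge)"
    by (simp add: type_definition.Rep_range[OF type_definition_edge])
  then show "finite (UNIV :: edge set)"
    by (rule finite_imageD) (simp add: inj_def Rep_edge_inject)
qed

text \<open>The value of \<open>tetra_normal\<close> matters only at the arguments \<open>1, 2, 3, 4\<close>.\<close>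

definition tetra_normal :: "nat \<Rightarrow> real^3" where
  "tetra_normal i = (2 powr (-2/3)) *\<^sub>R
     (if i = 1 then vector [1, 1, 1]
      else if i = 2 then vector [1, -1, -1]
      else if i = 3 then vector [-1, 1, -1]
      else vector [-1, -1, 1])"

definition edge_cross :: "edge \<Rightarrow> real^3" where
  "edge_cross e = (case Rep_edge e of (i, j) \<Rightarrow> cross3 (tetra_normal i) (tetra_normal j))"

text \<open>The sum below is the Minkowski sum of sets.\<close>

definition zonotope :: "real^edge \<Rightarrow> real^3^3 \<Rightarrow> (real^3) set" where
  "zonotope \<beta> M =
     (\<Sum>e\<in>UNIV. closed_segment ((- (1/2) * \<beta> $ e) *\<^sub>R (M *v edge_cross e))
                                 ((1/2 * \<beta> $ e) *\<^sub>R (M *v edge_cross e)))"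

subsection \<open>The labeled similarity slice\<close>

text \<open>
  The power operation and the unit of the type \<open>real^3^3\<close> are componentwise, so the matrix
  exponential is built from \<open>**\<close> and \<^term>\<open>mat 1\<close>.
\<close>

primrec matrix_pow :: "real^'n^'n \<Rightarrow> nat \<Rightarrow> real^'n^'n" where
  "matrix_pow A 0 = mat 1"
| "matrix_pow A (Suc k) = A ** matrix_pow A k"

definition matrix_expo :: "real^'n^'n \<Rightarrow> real^'n^'n" where
  "matrix_expo A = (\<Sum>k. (1 / fact k) *\<^sub>R matrix_pow A k)"

definition W0 :: "(real^edge) set" where
  "W0 = {l. (\<Sum>e\<in>UNIV. l $ e) = 0}"

definition G0 :: "(real^3^3) set" where
  "G0 = {\<sigma>. transpose \<sigma> = \<sigma> \<and> trace \<sigma> = 0}"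

definition Phi :: "(real^edge) \<times> (real^3^3) \<Rightarrow> (real^3) set" where
  "Phi = (\<lambda>(l, \<sigma>). zonotope (\<chi> e. exp (l $ e)) (matrix_expo ((- (1/2)) *\<^sub>R \<sigma>)))"

definition Psi :: "(real^edge) \<times> (real^3^3) \<Rightarrow> real" where
  "Psi h = isoperimetric_quotient (Phi h)"

subsection \<open>Hessian of a function on a linear subspace\<close>

text \<open>
  \<open>H\<close> is the second Frechet derivative at \<open>x \<in> V\<close> of the restriction of \<open>f\<close> to the subspace \<open>V\<close>.
  All derivatives are taken within \<open>V\<close>, so values of \<open>f\<close> outside \<open>V\<close> are irrelevant. The linear
  maps involved are defined on the ambient space; their values on \<open>V\<close>, in particular
  \<open>H h k\<close> for \<open>h, k \<in> V\<close>, are uniquely determined.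
\<close>

definition has_hessian_on ::
  "('a::real_normed_vector \<Rightarrow> real) \<Rightarrow> ('a \<Rightarrow>\<^sub>L 'a \<Rightarrow>\<^sub>L real) \<Rightarrow> 'a \<Rightarrow> 'a set \<Rightarrow> bool" where
  "has_hessian_on f H x V \<longleftrightarrow>
     (\<exists>f' :: 'a \<Rightarrow> 'a \<Rightarrow>\<^sub>L real.
        (\<forall>\<^sub>F y in nhds x. y \<in> V \<longrightarrow> (f has_derivative blinfun_apply (f' y)) (at y within V)) \<and>
        (f' has_derivative blinfun_apply H) (at x within V))"

end

theory Submission
  imports Defs
begin

text \<open>
  Extruding a convex body along a vector adds measure linearly in the length of the vector, for
  every translation-invariant measure. Hence the measure of a sum of segments is affine in each of
  the lengths, and by homogeneity of degree \<open>n\<close> it is the sum of the measures of the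
  parallelepipeds spanned by \<open>n\<close> of the segments. For Lebesgue measure this gives the volume of a
  zonotope as a sum of determinants. Two-dimensional Hausdorff measure, a Borel measure by
  Caratheodory's criterion, is a positive multiple of \<open>|u \<times> v|\<close> on parallelograms, and
  every facet is a planar zonotope lying in one of the two supporting planes orthogonal to the
  vectors \<open>u \<times> v\<close> of its pairs of generators; so the boundary area is, up to a
  constant, the sum of \<open>|u \<times> v|\<close> over all ordered pairs of generators.

  Both quantities are thus explicit near the origin of the slice. Their first derivatives vanish
  there by symmetry on the slice (those of the area are not even needed, as the volume is
  stationary), and the second-order terms split into six binary quadratic forms: the sum of the
  weights of two opposite edges is coupled with a diagonal entry of \<open>\<sigma>\<close>, their difference with
  an off-diagonal one. All six are positive definite.
\<close>

subsection \<open>Hausdorff measure is a Borel measure\<close>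

text \<open>The volume form is a sum of squares in the weights alone, since
  \<open>slice_matrix h\<close> keeps determinant 1 on the slice, and it enters the Hessian with a
  minus sign: the area has to outweigh it. The area sees \<open>\<sigma>\<close> through the
  cofactor matrix of exp(-\<sigma>/2), which is exp(\<sigma>/2) for trace zero.

  The splitting is forced by symmetry. Signed permutations of the coordinates preserve the six lines
  spanned by the generators, so they act on the slice and leave \<open>Psi\<close> invariant. Sign
  changes fix the weight sums of opposite edges and the diagonal of \<open>\<sigma>\<close>, while
  each weight difference has the same character as one off-diagonal entry, and these three
  characters are distinct. Permutations act on the sums and on the diagonal as on triples of total
  zero, an irreducible representation. Hence only two different binary forms occur, each three
  times. Symmetry predicts the blocks; polynomial identities verify them. The only irrationality is
  sqrt 3, the length of the hexagon normals (1,1,1) and their sign variants.\<close>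

definition hcover :: "real \<Rightarrow> 'a::metric_space set \<Rightarrow> (nat \<Rightarrow> 'a set) \<Rightarrow> bool" where
  "hcover \<delta> S U \<longleftrightarrow> S \<subseteq> (\<Union>i. U i) \<and> (\<forall>i. bounded (U i) \<and> diameter (U i) \<le> \<delta>)"

definition disc_area :: "'a::metric_space set \<Rightarrow> ennreal" where
  "disc_area U = ennreal (pi / 4 * (diameter U)\<^sup>2)"

lemma disc_area_empty [simp]: "disc_area {} = 0"
  by (simp add: disc_area_def)

lemma premeasure_altdef:
  "hausdorff2_premeasure \<delta> S = (INF U\<in>{U. hcover \<delta> S U}. \<Sum>i. disc_area (U i))"
  unfolding hausdorff2_premeasure_def hcover_def disc_area_def ..

lemma premeasure_le: "hcover \<delta> S U \<Longrightarrow> hausdorff2_premeasure \<delta> S \<le> (\<Sum>i. disc_area (U i))"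
  unfolding premeasure_altdef by (rule INF_lower) simp

lemma premeasure_geI:
  "(\<And>U. hcover \<delta> S U \<Longrightarrow> x \<le> (\<Sum>i. disc_area (U i))) \<Longrightarrow> x \<le> hausdorff2_premeasure \<delta> S"
  unfolding premeasure_altdef by (rule INF_greatest) simp

lemma premeasure_cover:
  assumes "hausdorff2_premeasure \<delta> S < x"
  obtains U where "hcover \<delta> S U" "(\<Sum>i. disc_area (U i)) < x"
  using assms unfolding premeasure_altdef INF_less_iff by auto

lemma premeasure_antimono: "\<delta> \<le> \<delta>' \<Longrightarrow> hausdorff2_premeasure \<delta>' S \<le> hausdorff2_premeasure \<delta> S"
  by (rule premeasure_geI, rule premeasure_le) (auto simp: hcover_def intro: order_trans)

lemma premeasure_mono: "S \<subseteq> T \<Longrightarrow> hausdorff2_premeasure \<delta> S \<le> hausdorff2_premeasure \<delta> T"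
  by (rule premeasure_geI, rule premeasure_le) (auto simp: hcover_def)

lemma hausdorff2_mono: "S \<subseteq> T \<Longrightarrow> hausdorff2 S \<le> hausdorff2 T"
  unfolding hausdorff2_def by (rule SUP_mono) (auto intro: premeasure_mono)

lemma premeasure_le_hausdorff2: "\<delta> > 0 \<Longrightarrow> hausdorff2_premeasure \<delta> S \<le> hausdorff2 S"
  unfolding hausdorff2_def by (rule SUP_upper) simp

lemma hausdorff2_leI:
  assumes "\<And>\<delta>. \<delta> > 0 \<Longrightarrow> hausdorff2_premeasure \<delta> S \<le> x"
  shows "hausdorff2 S \<le> x"
  unfolding hausdorff2_def by (rule SUP_least) (use assms in auto)

lemma hausdorff2_empty [simp]: "hausdorff2 {} = 0"
proof -
  have "hausdorff2 ({}::'a set) \<le> 0"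
  proof (rule hausdorff2_leI)
    fix \<delta> :: real assume "\<delta> > 0"
    have "hausdorff2_premeasure \<delta> ({}::'a set) \<le> (\<Sum>i::nat. disc_area ({}::'a set))"
      by (rule premeasure_le) (use \<open>\<delta> > 0\<close> in \<open>auto simp: hcover_def\<close>)
    then show "hausdorff2_premeasure \<delta> ({}::'a set) \<le> 0" by simp
  qed
  then show ?thesis by simp
qed

lemma premeasure_countably_subadditive:
  "hausdorff2_premeasure \<delta> (\<Union>n::nat. S n) \<le> (\<Sum>n. hausdorff2_premeasure \<delta> (S n))"
proof (rule ennreal_le_epsilon)
  fix e :: real assume e: "0 < e" and fin: "(\<Sum>n. hausdorff2_premeasure \<delta> (S n)) < top"
  define eps where "eps n = e * (1/2)^Suc n" for n
  have eps_pos: "eps n > 0" for n using e by (simp add: eps_def)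
  have "\<exists>U. hcover \<delta> (S n) U \<and> (\<Sum>i. disc_area (U i)) \<le> hausdorff2_premeasure \<delta> (S n) + ennreal (eps n)" for n
  proof -
    have "hausdorff2_premeasure \<delta> (S n) < top"
      using fin by (metis ennreal_suminf_lessD)
    then have "hausdorff2_premeasure \<delta> (S n) < hausdorff2_premeasure \<delta> (S n) + ennreal (eps n)"
      using eps_pos[of n] by (metis add.right_neutral ennreal_add_left_cancel_less ennreal_less_zero_iff infinity_ennreal_def top.not_eq_extremum)
    then show ?thesis by (metis premeasure_cover order.strict_implies_order)
  qed
  then obtain U where U: "\<And>n. hcover \<delta> (S n) (U n)"
    "\<And>n. (\<Sum>i. disc_area (U n i)) \<le> hausdorff2_premeasure \<delta> (S n) + ennreal (eps n)"
    by metis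
  define V where "V k = case_prod U (prod_decode k)" for k
  have "hcover \<delta> (\<Union>n. S n) V"
    unfolding hcover_def
  proof (intro conjI allI subsetI)
    fix x assume "x \<in> (\<Union>n. S n)"
    then obtain n i where "x \<in> U n i" using U(1) unfolding hcover_def by blast
    then have "x \<in> V (prod_encode (n, i))" by (simp add: V_def)
    then show "x \<in> (\<Union>i. V i)" by blast
  next
    fix k show "bounded (V k)" "diameter (V k) \<le> \<delta>"
      using U(1) by (auto simp: V_def hcover_def split: prod.split)
  qed
  then have "hausdorff2_premeasure \<delta> (\<Union>n. S n) \<le> (\<Sum>k. disc_area (V k))"
    by (rule premeasure_le)
  also have "\<dots> = (\<Sum>n. \<Sum>i. disc_area (U n i))"
    using suminf_ennreal_2dimen[of "\<lambda>n. \<Sum>i. disc_area (U n i)" "\<lambda>(n,i). disc_area (U n i)"]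
    by (simp add: V_def split_def)
  also have "\<dots> \<le> (\<Sum>n. hausdorff2_premeasure \<delta> (S n) + ennreal (eps n))"
    by (intro suminf_le U(2)) auto
  also have "\<dots> = (\<Sum>n. hausdorff2_premeasure \<delta> (S n)) + (\<Sum>n. ennreal (eps n))"
    by (rule suminf_add[symmetric]) auto
  also have "(\<Sum>n. ennreal (eps n)) = ennreal e"
  proof -
    have "eps sums (e * 1)" unfolding eps_def by (rule sums_mult) (rule power_half_series)
    then show ?thesis using eps_pos by (simp add: suminf_ennreal2 less_imp_le sums_iff)
  qed
  finally show "hausdorff2_premeasure \<delta> (\<Union>n. S n) \<le> (\<Sum>n. hausdorff2_premeasure \<delta> (S n)) + ennreal e" .
qed

lemma hausdorff2_countably_subadditive: "hausdorff2 (\<Union>n::nat. S n) \<le> (\<Sum>n. hausdorff2 (S n))"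
proof (rule hausdorff2_leI)
  fix \<delta> :: real assume "\<delta> > 0"
  have "hausdorff2_premeasure \<delta> (\<Union>n. S n) \<le> (\<Sum>n. hausdorff2_premeasure \<delta> (S n))"
    by (rule premeasure_countably_subadditive)
  also have "\<dots> \<le> (\<Sum>n. hausdorff2 (S n))"
    by (intro suminf_le premeasure_le_hausdorff2 \<open>\<delta> > 0\<close>) auto
  finally show "hausdorff2_premeasure \<delta> (\<Union>n. S n) \<le> (\<Sum>n. hausdorff2 (S n))" .
qed

section \<open>Additivity on separated sets and Caratheodory's criterion\<close>

lemma hausdorff2_Un_le: "hausdorff2 (A \<union> B) \<le> hausdorff2 A + hausdorff2 B"
proof -
  let ?S = "\<lambda>n::nat. if n = 0 then A else if n = 1 then B else {}"
  have "A \<union> B = (\<Union>n. ?S n)" by (force split: if_splits)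
  then have "hausdorff2 (A \<union> B) \<le> (\<Sum>n. hausdorff2 (?S n))"
    using hausdorff2_countably_subadditive[of ?S] by simp
  also have "\<dots> = (\<Sum>n\<in>{0,1}. hausdorff2 (?S n))"
    by (rule suminf_finite) auto
  finally show ?thesis by simp
qed

text \<open>A cover by sets of diameter below \<open>d\<close> has no member meeting both
  \<open>A\<close> and \<open>B\<close>, so it splits into covers of each at no extra cost. This is
  the metric property that makes closed sets measurable.\<close>

lemma hausdorff2_Un_separated:
  assumes d: "d > 0" and sep: "\<And>x y. x \<in> A \<Longrightarrow> y \<in> B \<Longrightarrow> d \<le> dist x y"
  shows "hausdorff2 A + hausdorff2 B \<le> hausdorff2 (A \<union> B)"
proof -
  have pre: "hausdorff2_premeasure \<delta> A + hausdorff2_premeasure \<delta> B \<le> hausdorff2_premeasure \<delta> (A \<union> B)"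
    if \<delta>: "0 < \<delta>" "\<delta> < d" for \<delta>
  proof (rule premeasure_geI)
    fix U assume U: "hcover \<delta> (A \<union> B) U"
    define UA where "UA i = (if U i \<inter> A = {} then {} else U i)" for i
    define UB where "UB i = (if U i \<inter> B = {} then {} else U i)" for i
    have "hcover \<delta> A UA" using U \<delta> by (fastforce simp: hcover_def UA_def)
    moreover have "hcover \<delta> B UB" using U \<delta> by (fastforce simp: hcover_def UB_def)
    ultimately have "hausdorff2_premeasure \<delta> A + hausdorff2_premeasure \<delta> B
      \<le> (\<Sum>i. disc_area (UA i)) + (\<Sum>i. disc_area (UB i))"
      by (intro add_mono premeasure_le)
    also have "\<dots> = (\<Sum>i. disc_area (UA i) + disc_area (UB i))"
      by (rule suminf_add) auto
    also have "\<dots> \<le> (\<Sum>i. disc_area (U i))"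
    proof (rule suminf_le)
      fix i show "disc_area (UA i) + disc_area (UB i) \<le> disc_area (U i)"
      proof (cases "U i \<inter> A = {} \<or> U i \<inter> B = {}")
        case True then show ?thesis by (auto simp: UA_def UB_def)
      next
        case False
        then obtain x y where "x \<in> U i" "x \<in> A" "y \<in> U i" "y \<in> B" by blast
        then have "dist x y \<le> diameter (U i)" "d \<le> dist x y"
          using U sep by (auto simp: hcover_def intro!: diameter_bounded_bound)
        moreover have "diameter (U i) \<le> \<delta>" using U by (simp add: hcover_def)
        ultimately show ?thesis using \<delta> by linarith
      qed
    qed auto
    finally show "hausdorff2_premeasure \<delta> A + hausdorff2_premeasure \<delta> B \<le> (\<Sum>i. disc_area (U i))" .
  qed
  \<comment> \<open>The suprema defining the two summands run independently; both scales are
    replaced by a common smaller one below \<open>d\<close>.\<close>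
  have *: "hausdorff2_premeasure \<delta>1 A + hausdorff2_premeasure \<delta>2 B \<le> hausdorff2 (A \<union> B)"
    if "\<delta>1 > 0" "\<delta>2 > 0" for \<delta>1 \<delta>2
  proof -
    define \<delta> where "\<delta> = min (min \<delta>1 \<delta>2) (d/2)"
    have \<delta>: "0 < \<delta>" "\<delta> < d" "\<delta> \<le> \<delta>1" "\<delta> \<le> \<delta>2" using that d by (auto simp: \<delta>_def min_def)
    have "hausdorff2_premeasure \<delta>1 A + hausdorff2_premeasure \<delta>2 B
      \<le> hausdorff2_premeasure \<delta> A + hausdorff2_premeasure \<delta> B"
      by (intro add_mono premeasure_antimono \<delta>)
    also have "\<dots> \<le> hausdorff2_premeasure \<delta> (A \<union> B)" by (rule pre) (use \<delta> in auto)
    also have "\<dots> \<le> hausdorff2 (A \<union> B)" by (rule premeasure_le_hausdorff2) (use \<delta> in auto)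
    finally show ?thesis .
  qed
  have ne: "{0<..} \<noteq> ({} :: real set)" by (metis greaterThan_non_empty)
  have **: "hausdorff2_premeasure \<delta>1 A + hausdorff2 B \<le> hausdorff2 (A \<union> B)" if "\<delta>1 > 0" for \<delta>1
    unfolding hausdorff2_def[of B] ennreal_SUP_add_right[OF ne]
    by (rule SUP_least) (use * that in auto)
  show ?thesis
    unfolding hausdorff2_def[of A] ennreal_SUP_add_left[OF ne, symmetric]
    by (rule SUP_least) (use ** in auto)
qed

lemma hausdorff2_sum_separated:
  fixes R :: "nat \<Rightarrow> 'a::metric_space set"
  assumes "\<And>n. \<exists>d>0. \<forall>x\<in>(\<Union>i<n. R i). \<forall>y\<in>R n. d \<le> dist x y"
  shows "(\<Sum>i<n. hausdorff2 (R i)) \<le> hausdorff2 (\<Union>i<n. R i)"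
proof (induction n)
  case (Suc n)
  obtain d where d: "d > 0" "\<forall>x\<in>(\<Union>i<n. R i). \<forall>y\<in>R n. d \<le> dist x y" using assms by blast
  have "(\<Sum>i<Suc n. hausdorff2 (R i)) \<le> hausdorff2 (\<Union>i<n. R i) + hausdorff2 (R n)"
    using Suc by (simp add: add_right_mono)
  also have "\<dots> \<le> hausdorff2 ((\<Union>i<n. R i) \<union> R n)"
    by (rule hausdorff2_Un_separated[OF d(1)]) (use d(2) in blast)
  also have "(\<Union>i<n. R i) \<union> R n = (\<Union>i<Suc n. R i)" by (auto simp: less_Suc_eq)
  finally show ?case .
qed simp

text \<open>The layers \<open>R k\<close> slice \<open>T\<close> by distance from \<open>C\<close>.
  Neighbouring layers touch, but layers of equal parity keep a positive gap, so the even layers, and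
  likewise the odd ones, have measures adding up to at most that of \<open>T\<close>.\<close>

lemma hausdorff2_series_layers:
  fixes C T :: "'a::metric_space set" and p :: nat
  defines "R \<equiv> \<lambda>k::nat. {x\<in>T. 1 / (real k + 2) \<le> infdist x C \<and> infdist x C < 1 / (real k + 1)}"
  assumes p: "p \<le> 1" 
  shows "(\<Sum>k. hausdorff2 (R (2 * k + p))) \<le> hausdorff2 T"
proof (rule suminf_le_const[OF summableI])
  fix n
  have "(\<Sum>k<n. hausdorff2 (R (2 * k + p))) \<le> hausdorff2 (\<Union>k<n. R (2 * k + p))"
  proof (rule hausdorff2_sum_separated)
    fix n
    \<comment> \<open>The gap between the inner edge of layer \<open>2 * n + p - 2\<close> and the
      outer edge of layer \<open>2 * n + p\<close>. For \<open>n = 0\<close> there is nothing to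
      separate.\<close>
    let ?d = "1 / (2 * real n + p) - 1 / (2 * real n + p + 1)"
    show "\<exists>d>0. \<forall>x\<in>(\<Union>k<n. R (2 * k + p)). \<forall>y\<in>R (2 * n + p). d \<le> dist x y"
    proof (cases "n = 0")
      case True then show ?thesis by (auto intro!: exI[of _ 1])
    next
      case False
      show ?thesis
      proof (intro exI[of _ ?d] conjI ballI)
        show "?d > 0" using False by (simp add: frac_less2)
        fix x y assume "x \<in> (\<Union>k<n. R (2 * k + p))" and y: "y \<in> R (2 * n + p)"
        then obtain k where k: "k < n" "x \<in> R (2 * k + p)" by blast
        have "1 / (2 * real n + p) \<le> 1 / (real (2 * k + p) + 2)"
          using k(1) by (intro divide_left_mono) auto
        also have "\<dots> \<le> infdist x C" using k(2) by (simp add: R_def)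
        finally have 1: "1 / (2 * real n + p) \<le> infdist x C" .
        have 2: "infdist y C < 1 / (2 * real n + p + 1)" using y by (simp add: R_def)
        have "infdist x C \<le> infdist y C + dist x y" by (rule infdist_triangle)
        then show "?d \<le> dist x y" using 1 2 by linarith
      qed
    qed
  qed
  also have "\<dots> \<le> hausdorff2 T" by (rule hausdorff2_mono) (auto simp: R_def)
  finally show "(\<Sum>k<n. hausdorff2 (R (2 * k + p))) \<le> hausdorff2 T" .
qed

lemma ennreal_series_tail:
  fixes f :: "nat \<Rightarrow> ennreal"
  assumes "(\<Sum>k. f k) < top" "e > 0"
  shows "\<exists>N. (\<Sum>k. f (k + N)) \<le> ennreal e"
proof -
  define g where "g k = enn2real (f k)" for k
  have f: "f k = ennreal (g k)" for k
    using assms(1) by (metis ennreal_enn2real ennreal_suminf_lessD g_def)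
  have g0: "g k \<ge> 0" for k by (simp add: g_def)
  have sm: "summable g"
    by (rule summable_suminf_not_top) (use assms(1) g0 in \<open>auto simp: f\<close>)
  obtain N where N: "norm (\<Sum>k. g (k + N)) < e"
    using suminf_exist_split[OF assms(2) sm] by auto
  have "(\<Sum>k. f (k + N)) = ennreal (\<Sum>k. g (k + N))"
    unfolding f by (rule suminf_ennreal2) (use g0 sm in \<open>auto simp: summable_iff_shift\<close>)
  then show ?thesis using N by (auto intro!: exI[of _ N] ennreal_leI)
qed

text \<open>The parts \<open>A n\<close> of \<open>T\<close> at distance at least
  \<open>1 / (n + 1)\<close> from \<open>C\<close> are separated from \<open>T \<inter> C\<close>.
  What \<open>A (2 * N)\<close> misses of \<open>T - C\<close> lies in the tails of two convergent
  series of layers, so its measure is arbitrarily small.\<close>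

lemma hausdorff2_caratheodory_closed:
  fixes C T :: "'a::metric_space set"
  assumes C: "closed C"
  shows "hausdorff2 (T \<inter> C) + hausdorff2 (T - C) \<le> hausdorff2 T"
\<comment> \<open>\<open>infdist\<close> to the empty set is 0 by convention, so distances say
  nothing when \<open>C\<close> is empty.\<close>
proof (cases "hausdorff2 T = top \<or> C = {}")
  case True then show ?thesis by auto
next
  case False
  then have fin: "hausdorff2 T < top" and ne: "C \<noteq> {}" by (auto simp: less_top)
  define A where "A n = {x\<in>T. 1 / (real n + 1) \<le> infdist x C}" for n
  define R where "R k = {x\<in>T. 1 / (real k + 2) \<le> infdist x C \<and> infdist x C < 1 / (real k + 1)}" for k
  have fin': "(\<Sum>k. hausdorff2 (R (2 * k + p))) < top" if "p \<le> 1" for p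
    using hausdorff2_series_layers[OF that, of T C] fin unfolding R_def by (rule le_less_trans)
  have sep: "hausdorff2 (T \<inter> C) + hausdorff2 (A n) \<le> hausdorff2 T" for n
  proof -
    have "hausdorff2 (T \<inter> C) + hausdorff2 (A n) \<le> hausdorff2 ((T \<inter> C) \<union> A n)"
    proof (rule hausdorff2_Un_separated[of "1 / (real n + 1)"])
      fix x y assume "x \<in> T \<inter> C" "y \<in> A n"
      then have "1 / (real n + 1) \<le> infdist y C" "infdist y C \<le> dist y x"
        by (auto simp: A_def intro: infdist_le)
      then show "1 / (real n + 1) \<le> dist x y" by (simp add: dist_commute)
    qed simp
    also have "\<dots> \<le> hausdorff2 T" by (rule hausdorff2_mono) (auto simp: A_def)
    finally show ?thesis .
  qed
  have cov: "T - C \<subseteq> A (2 * N) \<union> (\<Union>k. R (2 * (k + N) + 0)) \<union> (\<Union>k. R (2 * (k + N) + 1))" for N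
  proof
    fix x assume x: "x \<in> T - C"
    show "x \<in> A (2 * N) \<union> (\<Union>k. R (2 * (k + N) + 0)) \<union> (\<Union>k. R (2 * (k + N) + 1))"
    proof (cases "1 / (real (2 * N) + 1) \<le> infdist x C")
      case True then show ?thesis using x by (simp add: A_def)
    next
      case False
      have pos: "infdist x C > 0" using infdist_pos_not_in_closed[OF C ne] x by auto
      obtain m where m: "inverse (real (Suc m)) < infdist x C" using reals_Archimedean[OF pos] by blast
      \<comment> \<open>\<open>j\<close> is the first index with \<open>x\<close> in
        \<open>A j\<close>; as \<open>x\<close> is outside \<open>A (j - 1)\<close>, it sits in the
        layer \<open>R (j - 1)\<close>.\<close>
      define j where "j = (LEAST m. 1 / (real m + 1) \<le> infdist x C)"
      have ex: "1 / (real m + 1) \<le> infdist x C" using m by (simp add: inverse_eq_divide add.commute)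
      have j: "1 / (real j + 1) \<le> infdist x C" unfolding j_def by (rule LeastI, rule ex)
      have "2 * N < j"
      proof (rule ccontr)
        assume "\<not> 2 * N < j"
        then have "1 / (real (2 * N) + 1) \<le> 1 / (real j + 1)" by (intro divide_left_mono) auto
        then show False using j False by linarith
      qed
      then obtain i where i: "j = Suc i" "2 * N \<le> i" by (cases j) auto
      have "\<not> 1 / (real i + 1) \<le> infdist x C" using not_less_Least[of i "\<lambda>m. 1 / (real m + 1) \<le> infdist x C"] i
        by (auto simp: j_def)
      then have xR: "x \<in> R i" using x j i by (simp add: R_def add.commute)
      have "i = 2 * (i div 2 - N + N) + 0 \<or> i = 2 * (i div 2 - N + N) + 1" using i(2) by presburger
      then show ?thesis
      proof
        assume "i = 2 * (i div 2 - N + N) + 0"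
        then have "x \<in> R (2 * (i div 2 - N + N) + 0)" using xR by argo
        then show ?thesis by blast
      next
        assume "i = 2 * (i div 2 - N + N) + 1"
        then have "x \<in> R (2 * (i div 2 - N + N) + 1)" using xR by argo
        then show ?thesis by blast
      qed
    qed
  qed
  show ?thesis
  proof (rule ennreal_le_epsilon)
    fix e :: real assume e: "0 < e"
    obtain N0 where N0: "(\<Sum>k. hausdorff2 (R (2 * (k + N0) + 0))) \<le> ennreal (e/2)"
      using ennreal_series_tail[OF fin'[of 0], of "e/2"] e by auto
    obtain N1 where N1: "(\<Sum>k. hausdorff2 (R (2 * (k + N1) + 1))) \<le> ennreal (e/2)"
      using ennreal_series_tail[OF fin'[of 1], of "e/2"] e by auto
    define N where "N = max N0 N1"
    \<comment> \<open>Tails shrink when the starting index grows, so both series can be cut at the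
      same \<open>N\<close>.\<close>
    have mono: "(\<Sum>k. hausdorff2 (R (2 * (k + N) + p))) \<le> (\<Sum>k. hausdorff2 (R (2 * (k + N') + p)))"
      if "N' \<le> N" for N' p
    proof -
      have "(\<Sum>k. hausdorff2 (R (2 * (k + N') + p))) =
        (\<Sum>k. hausdorff2 (R (2 * (k + (N - N') + N') + p))) + (\<Sum>k<N - N'. hausdorff2 (R (2 * (k + N') + p)))"
        by (rule suminf_offset) simp
      then show ?thesis using that by (simp add: add.assoc)
    qed
    have "hausdorff2 (T - C) \<le> hausdorff2 (A (2 * N)) + (\<Sum>k. hausdorff2 (R (2 * (k + N) + 0)))
         + (\<Sum>k. hausdorff2 (R (2 * (k + N) + 1)))"
      by (intro order_trans[OF hausdorff2_mono[OF cov[of N]]] order_trans[OF hausdorff2_Un_le] add_mono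
          hausdorff2_countably_subadditive order_refl)
    also have "\<dots> \<le> hausdorff2 (A (2 * N)) + ennreal (e/2) + ennreal (e/2)"
      by (intro add_mono order_refl order_trans[OF mono N0] order_trans[OF mono N1]) (auto simp: N_def)
    also have "\<dots> = hausdorff2 (A (2 * N)) + ennreal e"
      using e by (simp add: add.assoc flip: ennreal_plus)
    finally have "hausdorff2 (T \<inter> C) + hausdorff2 (T - C) \<le> (hausdorff2 (T \<inter> C) + hausdorff2 (A (2 * N))) + ennreal e"
      by (simp add: add.assoc add_left_mono)
    also have "\<dots> \<le> hausdorff2 T + ennreal e" by (intro add_right_mono sep)
    finally show "hausdorff2 (T \<inter> C) + hausdorff2 (T - C) \<le> hausdorff2 T + ennreal e" .
  qed
qed

lemma outer_measure_space_hausdorff2: "outer_measure_space (UNIV :: 'a::metric_space set set) hausdorff2"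
  unfolding outer_measure_space_def positive_def increasing_def countably_subadditive_def
  by (auto intro: hausdorff2_mono hausdorff2_countably_subadditive)

text \<open>\<open>measure_of\<close> yields the zero measure unless its last argument is a measure
  on the given sets, so the definition has content only through
  \<open>emeasure_hausdorff2_borel\<close>.\<close>

definition hausdorff2_borel :: "'a::metric_space measure" where
  "hausdorff2_borel = measure_of UNIV (sets borel) hausdorff2"

lemma sets_hausdorff2_borel [simp, measurable_cong]: "sets hausdorff2_borel = sets borel"
  and space_hausdorff2_borel [simp]: "space hausdorff2_borel = UNIV"
  unfolding hausdorff2_borel_def by (simp_all add: sets.sigma_sets_eq[of borel, simplified] space_measure_of_conv)

text \<open>The sets that split every \<open>T\<close> additively form a sigma-algebra on which an
  outer measure is a measure. It contains the closed sets, hence all Borel sets.\<close>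

lemma emeasure_hausdorff2_borel:
  fixes S :: "'a::metric_space set"
  assumes "S \<in> sets borel"
  shows "emeasure hausdorff2_borel S = hausdorff2 S"
proof -
  interpret S: sigma_algebra "UNIV :: 'a set" "UNIV :: 'a set set"
    using sigma_algebra_Pow[of "UNIV :: 'a set"] by simp
  let ?L = "lambda_system (UNIV :: 'a set) UNIV hausdorff2"
  have ms: "measure_space UNIV ?L hausdorff2"
    by (rule S.caratheodory_lemma[OF outer_measure_space_hausdorff2])
  have clo: "C \<in> ?L" if "closed C" for C
    unfolding S.lambda_system_eq
  proof (clarsimp, rule antisym)
    fix T show "hausdorff2 (T \<inter> C) + hausdorff2 (T - C) \<le> hausdorff2 T"
      by (rule hausdorff2_caratheodory_closed[OF that])
    show "hausdorff2 T \<le> hausdorff2 (T \<inter> C) + hausdorff2 (T - C)"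
      using hausdorff2_Un_le[of "T \<inter> C" "T - C"] by (simp add: Int_Diff_Un)
  qed
  have sub: "sets borel \<subseteq> ?L"
    unfolding borel_eq_closed
  proof (simp, rule sigma_algebra.sigma_sets_subset)
    show "sigma_algebra UNIV ?L" using ms by (simp add: measure_space_def)
    show "Collect closed \<subseteq> ?L" using clo by blast
  qed
  have "measure_space UNIV (sets (borel :: 'a measure)) hausdorff2"
    unfolding measure_space_def
  proof (intro conjI)
    show "sigma_algebra UNIV (sets (borel :: 'a measure))"
      using sets.sigma_algebra_axioms[of "borel :: 'a measure"] by simp
    show "positive (sets (borel :: 'a measure)) hausdorff2" by (simp add: positive_def)
    show "countably_additive (sets (borel :: 'a measure)) hausdorff2"
      unfolding countably_additive_def
    proof (intro allI impI)
      fix A :: "nat \<Rightarrow> 'a set"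
      assume A: "range A \<subseteq> sets borel" "disjoint_family A" "\<Union> (range A) \<in> sets borel"
      have "countably_additive ?L hausdorff2" using ms by (simp add: measure_space_def)
      then show "(\<Sum>i. hausdorff2 (A i)) = hausdorff2 (\<Union> (range A))"
        unfolding countably_additive_def using A sub by (meson order_trans subsetD)
    qed
  qed
  then show ?thesis
    unfolding hausdorff2_borel_def using assms
    by (intro emeasure_measure_of_sigma) (auto simp: measure_space_def)
qed

subsection \<open>Lipschitz images, segments and parallelograms\<close>

lemma bounded_pairwise: "(\<And>x y. x \<in> S \<Longrightarrow> y \<in> S \<Longrightarrow> dist x y \<le> d) \<Longrightarrow> bounded S"
  unfolding bounded_def by (cases "S = {}") blast+

lemma diameter_leI:
  assumes "0 \<le> d" "\<And>x y. x \<in> S \<Longrightarrow> y \<in> S \<Longrightarrow> dist x y \<le> d"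
  shows "diameter S \<le> d"
  using assms by (auto simp: diameter_def intro: cSUP_least)

text \<open>Diameters grow by at most the factor \<open>k\<close>, their squares by
  \<open>k\<^sup>2\<close>, and scale \<open>\<delta>\<close> on the image corresponds to scale
  \<open>\<delta> / k\<close> on the source.\<close>

lemma hausdorff2_lipschitz_image_le:
  fixes f :: "'a::metric_space \<Rightarrow> 'b::metric_space"
  assumes k: "k > 0" and lip: "\<And>x y. x \<in> S \<Longrightarrow> y \<in> S \<Longrightarrow> dist (f x) (f y) \<le> k * dist x y"
  shows "hausdorff2 (f ` S) \<le> ennreal (k\<^sup>2) * hausdorff2 S"
proof (rule hausdorff2_leI)
  fix \<delta> :: real assume \<delta>: "\<delta> > 0"
  have "hausdorff2_premeasure \<delta> (f ` S) \<le> ennreal (k\<^sup>2) * (\<Sum>i. disc_area (U i))"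
    if U: "hcover (\<delta> / k) S U" for U
  proof -
    define V where "V i = f ` (U i \<inter> S)" for i
    have V: "dist x y \<le> k * diameter (U i)" if "x \<in> V i" "y \<in> V i" for x y i
    proof -
      from that obtain a b where ab: "a \<in> U i \<inter> S" "b \<in> U i \<inter> S" "x = f a" "y = f b"
        by (auto simp: V_def)
      have "dist a b \<le> diameter (U i)" using U ab by (auto simp: hcover_def intro: diameter_bounded_bound)
      then have "k * dist a b \<le> k * diameter (U i)" using k by simp
      then show ?thesis using lip[of a b] ab by auto
    qed
    have bV: "bounded (V i)" for i by (rule bounded_pairwise) (rule V)
    have dV: "diameter (V i) \<le> k * diameter (U i)" for i
      by (rule diameter_leI)
        (use V k U in \<open>auto simp: hcover_def intro!: mult_nonneg_nonneg diameter_ge_0\<close>)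
    have dV': "diameter (V i) \<le> \<delta>" for i
    proof -
      have "diameter (U i) \<le> \<delta> / k" using U by (simp add: hcover_def)
      then have "k * diameter (U i) \<le> \<delta>" using k by (simp add: field_simps)
      then show ?thesis using dV[of i] by linarith
    qed
    have "hcover \<delta> (f ` S) V"
      using U bV dV' unfolding hcover_def V_def by blast
    then have "hausdorff2_premeasure \<delta> (f ` S) \<le> (\<Sum>i. disc_area (V i))" by (rule premeasure_le)
    also have "\<dots> \<le> (\<Sum>i. ennreal (k\<^sup>2) * disc_area (U i))"
    proof (rule suminf_le)
      fix i
      have "(diameter (V i))\<^sup>2 \<le> (k * diameter (U i))\<^sup>2"
        by (intro power_mono dV diameter_ge_0 bV)
      then have "pi / 4 * (diameter (V i))\<^sup>2 \<le> k\<^sup>2 * (pi / 4 * (diameter (U i))\<^sup>2)"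
        by (simp add: power_mult_distrib mult.left_commute)
      then show "disc_area (V i) \<le> ennreal (k\<^sup>2) * disc_area (U i)"
        unfolding disc_area_def by (simp add: ennreal_mult[symmetric])
    qed auto
    finally show ?thesis by simp
  qed
  note cover = this
  \<comment> \<open>With the factor moved to the left, the infimum over covers can be taken on the
    right; being finite and positive, the factor moves back afterwards.\<close>
  have "ennreal ((1/k)\<^sup>2) * hausdorff2_premeasure \<delta> (f ` S) \<le> hausdorff2_premeasure (\<delta>/k) S"
  proof (rule premeasure_geI)
    fix U assume "hcover (\<delta> / k) S U"
    then have "ennreal ((1/k)\<^sup>2) * hausdorff2_premeasure \<delta> (f ` S)
        \<le> ennreal ((1/k)\<^sup>2) * (ennreal (k\<^sup>2) * (\<Sum>i. disc_area (U i)))"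
      by (intro mult_left_mono cover) auto
    also have "\<dots> = (\<Sum>i. disc_area (U i))"
      using k by (simp add: mult.assoc[symmetric] ennreal_mult[symmetric] power_one_over)
    finally show "ennreal ((1/k)\<^sup>2) * hausdorff2_premeasure \<delta> (f ` S) \<le> (\<Sum>i. disc_area (U i))" .
  qed
  then have "ennreal (k\<^sup>2) * (ennreal ((1/k)\<^sup>2) * hausdorff2_premeasure \<delta> (f ` S))
      \<le> ennreal (k\<^sup>2) * hausdorff2_premeasure (\<delta>/k) S"
    by (rule mult_left_mono) simp
  then have "hausdorff2_premeasure \<delta> (f ` S) \<le> ennreal (k\<^sup>2) * hausdorff2_premeasure (\<delta>/k) S"
    using k by (simp add: mult.assoc[symmetric] ennreal_mult[symmetric] power_one_over)
  also have "\<dots> \<le> ennreal (k\<^sup>2) * hausdorff2 S"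
    using k \<delta> by (intro mult_left_mono premeasure_le_hausdorff2) auto
  finally show "hausdorff2_premeasure \<delta> (f ` S) \<le> ennreal (k\<^sup>2) * hausdorff2 S" .
qed

text \<open>The Lipschitz bound is applied to \<open>f\<close> and to its inverse, which has
  constant \<open>1 / k\<close>.\<close>

lemma hausdorff2_similarity_image:
  fixes f :: "'a::metric_space \<Rightarrow> 'b::metric_space"
  assumes k: "k > 0" and sim: "\<And>x y. x \<in> S \<Longrightarrow> y \<in> S \<Longrightarrow> dist (f x) (f y) = k * dist x y"
  shows "hausdorff2 (f ` S) = ennreal (k\<^sup>2) * hausdorff2 S"
proof (rule antisym)
  show "hausdorff2 (f ` S) \<le> ennreal (k\<^sup>2) * hausdorff2 S"
    by (rule hausdorff2_lipschitz_image_le) (use k sim in auto)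
  have inj: "inj_on f S"
  proof (rule inj_onI)
    fix x y assume "x \<in> S" "y \<in> S" "f x = f y"
    then show "x = y" using sim[of x y] k by simp
  qed
  have "hausdorff2 (inv_into S f ` (f ` S)) \<le> ennreal ((1/k)\<^sup>2) * hausdorff2 (f ` S)"
    by (rule hausdorff2_lipschitz_image_le) (use k sim inj in auto)
  also have "inv_into S f ` (f ` S) = S" using inj by simp
  finally have "ennreal (k\<^sup>2) * hausdorff2 S \<le> ennreal (k\<^sup>2) * (ennreal ((1/k)\<^sup>2) * hausdorff2 (f ` S))"
    by (rule mult_left_mono) simp
  also have "\<dots> = hausdorff2 (f ` S)"
    using k by (simp add: mult.assoc[symmetric] ennreal_mult[symmetric] power_one_over)
  finally show "ennreal (k\<^sup>2) * hausdorff2 S \<le> hausdorff2 (f ` S)" .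
qed

lemma hausdorff2_isometry_image:
  fixes f :: "'a::metric_space \<Rightarrow> 'b::metric_space"
  assumes "\<And>x y. x \<in> S \<Longrightarrow> y \<in> S \<Longrightarrow> dist (f x) (f y) = dist x y"
  shows "hausdorff2 (f ` S) = hausdorff2 S"
  using hausdorff2_similarity_image[of 1 S f] assms by simp

section \<open>Grid covers: segments are null, the unit square has finite positive measure\<close>

lemma premeasure_finite_cover:
  assumes cov: "S \<subseteq> (\<Union>i<m. U i)" and d: "0 \<le> d" "d \<le> \<delta>"
    and diam: "\<And>i x y. i < m \<Longrightarrow> x \<in> U i \<Longrightarrow> y \<in> U i \<Longrightarrow> dist x y \<le> d"
  shows "hausdorff2_premeasure \<delta> S \<le> ennreal (real m * (pi / 4 * d\<^sup>2))"
proof -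
  \<comment> \<open>Covers are infinite sequences; the empty set, of diameter 0, pads the finite
    family for free.\<close>
  define V where "V i = (if i < m then U i else {})" for i
  have V: "dist x y \<le> d" if "x \<in> V i" "y \<in> V i" for i x y
    using that diam by (auto simp: V_def split: if_splits)
  have bV: "bounded (V i)" for i by (rule bounded_pairwise) (rule V)
  have dV: "diameter (V i) \<le> d" for i
    by (rule diameter_leI) (use V d in auto)
  have "hcover \<delta> S V"
    unfolding hcover_def using cov bV d(2) order_trans[OF dV] by (auto simp: V_def)
  then have "hausdorff2_premeasure \<delta> S \<le> (\<Sum>i. disc_area (V i))" by (rule premeasure_le)
  also have "\<dots> = (\<Sum>i<m. disc_area (V i))"
    by (rule suminf_finite) (auto simp: V_def)
  also have "\<dots> \<le> (\<Sum>i<m. ennreal (pi / 4 * d\<^sup>2))"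
    unfolding disc_area_def using dV bV
    by (intro sum_mono ennreal_leI mult_left_mono power_mono diameter_ge_0) auto
  also have "\<dots> = ennreal (real m * (pi / 4 * d\<^sup>2))"
    by (simp add: ennreal_of_nat_eq_real_of_nat ennreal_mult[symmetric])
  finally show ?thesis .
qed

lemma unit_interval_grid:
  assumes "n > 0" "0 \<le> x" "x \<le> 1"
  obtains i where "i < n" "real i / n \<le> x" "x \<le> (real i + 1) / n"
\<comment> \<open>The floor of \<open>x * n\<close> is out of range exactly at \<open>x = 1\<close>,
  which is assigned to the last cell.\<close>
proof (cases "x = 1")
  case True
  show thesis by (rule that[of "n - 1"]) (use True assms in \<open>auto simp: field_simps of_nat_diff\<close>)
next
  case False
  define i where "i = nat \<lfloor>x * n\<rfloor>"
  have *: "real i \<le> x * n" "x * n < real i + 1" using assms unfolding i_def by (auto simp: of_nat_nat)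
  have "x * n < n" using assms False by simp
  then have "i < n" using * by linarith
  then show thesis using * assms by (intro that[of i]) (auto simp: field_simps)
qed

text \<open>\<open>n\<close> intervals of length \<open>1 / n\<close> cost
  \<open>pi / (4 * n)\<close> in total.\<close>

lemma hausdorff2_unit_interval: "hausdorff2 {0..1::real} = 0"
proof -
  have "hausdorff2 {0..1::real} \<le> 0"
  proof (rule hausdorff2_leI, rule ennreal_le_epsilon)
    fix \<delta> e :: real assume "\<delta> > 0" "e > 0"
    then obtain n :: nat where n: "n > 0" "1 / real n < min \<delta> e"
      by (metis min_less_iff_conj nat_approx_posE of_nat_0_less_iff zero_less_Suc)
    have "hausdorff2_premeasure \<delta> {0..1::real} \<le> ennreal (real n * (pi / 4 * (1 / real n)\<^sup>2))"
    proof (rule premeasure_finite_cover[where U = "\<lambda>i. {real i / n .. (real i + 1) / n}"])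
      show "{0..1} \<subseteq> (\<Union>i<n. {real i / real n..(real i + 1) / real n})"
        using n(1) by (auto elim!: unit_interval_grid[OF n(1)])
    qed (use n in \<open>auto simp: dist_real_def abs_le_iff diff_divide_distrib add_divide_distrib\<close>)
    also have "real n * (pi / 4 * (1 / real n)\<^sup>2) = pi / 4 * (1 / real n)"
      using n(1) by (simp add: power2_eq_square)
    also have "ennreal \<dots> \<le> ennreal (1 * e)"
      using n pi_less_4 by (intro ennreal_leI mult_mono) auto
    finally show "hausdorff2_premeasure \<delta> {0..1::real} \<le> 0 + ennreal e" by simp
  qed
  then show ?thesis by simp
qed

lemma hausdorff2_segment: "hausdorff2 (closed_segment a (b::'a::real_normed_vector)) = 0"
proof -
  \<comment> \<open>Adding 1 keeps the constant positive when the segment is a point.\<close>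
  let ?k = "norm (b - a) + 1"
  have "hausdorff2 ((\<lambda>u. (1 - u) *\<^sub>R a + u *\<^sub>R b) ` {0..1::real}) \<le> ennreal (?k\<^sup>2) * hausdorff2 {0..1::real}"
  proof (rule hausdorff2_lipschitz_image_le)
    fix x y :: real
    have "((1 - x) *\<^sub>R a + x *\<^sub>R b) - ((1 - y) *\<^sub>R a + y *\<^sub>R b) = (x - y) *\<^sub>R (b - a)"
      by (simp add: algebra_simps)
    then have "dist ((1 - x) *\<^sub>R a + x *\<^sub>R b) ((1 - y) *\<^sub>R a + y *\<^sub>R b) = norm (b - a) * dist x y"
      by (simp add: dist_norm)
    then show "dist ((1 - x) *\<^sub>R a + x *\<^sub>R b) ((1 - y) *\<^sub>R a + y *\<^sub>R b) \<le> ?k * dist x y"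
      by (simp add: algebra_simps)
  qed (simp add: add_nonneg_pos)
  then show ?thesis by (simp add: hausdorff2_unit_interval closed_segment_image_interval)
qed

text \<open>\<open>n\<^sup>2\<close> cells of diameter at most \<open>2 / n\<close> cost
  \<open>pi\<close>, whatever \<open>n\<close> is.\<close>

lemma hausdorff2_unit_square: "hausdorff2 ({0..1} \<times> {0..1} :: (real \<times> real) set) < top"
proof -
  have "hausdorff2 ({0..1} \<times> {0..1} :: (real \<times> real) set) \<le> ennreal pi"
  proof (rule hausdorff2_leI)
    fix \<delta> :: real assume "\<delta> > 0"
    then obtain n :: nat where n: "n > 0" "1 / real n < \<delta> / 2"
      by (metis half_gt_zero nat_approx_posE of_nat_0_less_iff zero_less_Suc)
    let ?I = "\<lambda>i. {real i / n .. (real i + 1) / n}"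
    have "hausdorff2_premeasure \<delta> ({0..1} \<times> {0..1} :: (real \<times> real) set)
       \<le> ennreal (real (n * n) * (pi / 4 * (2 / real n)\<^sup>2))"
    proof (rule premeasure_finite_cover[where U = "\<lambda>k. ?I (k div n) \<times> ?I (k mod n)"])
      show "{0..1} \<times> {0..1} \<subseteq> (\<Union>k<n * n. ?I (k div n) \<times> ?I (k mod n))"
      proof clarify
        fix x y :: real assume "x \<in> {0..1}" "y \<in> {0..1}"
        then obtain i j where ij: "i < n" "x \<in> ?I i" "j < n" "y \<in> ?I j"
          by (metis unit_interval_grid[OF n(1)] atLeastAtMost_iff)
        let ?k = "i * n + j"
        have "?k < Suc i * n" using ij by simp
        also have "\<dots> \<le> n * n" using ij by (intro mult_le_mono1) simp
        finally have "?k < n * n" .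
        moreover have "?k div n = i" "?k mod n = j" using ij by auto
        ultimately show "(x, y) \<in> (\<Union>k<n * n. ?I (k div n) \<times> ?I (k mod n))"
          using ij by (intro UN_I[of ?k]) auto
      qed
      fix k and p q :: "real \<times> real" assume "p \<in> ?I (k div n) \<times> ?I (k mod n)" "q \<in> ?I (k div n) \<times> ?I (k mod n)"
      then have "dist (fst p) (fst q) \<le> 1 / n" "dist (snd p) (snd q) \<le> 1 / n"
        by (auto simp: dist_real_def abs_le_iff add_divide_distrib mem_Times_iff)
      moreover have "dist p q \<le> dist (fst p) (fst q) + dist (snd p) (snd q)"
        unfolding dist_prod_def by (rule sqrt_sum_squares_le_sum) auto
      ultimately show "dist p q \<le> 2 / real n" by simp
    qed (use n in auto)
    also have "real (n * n) * (pi / 4 * (2 / real n)\<^sup>2) = pi"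
      using n(1) by (simp add: power2_eq_square)
    finally show "hausdorff2_premeasure \<delta> ({0..1} \<times> {0..1} :: (real \<times> real) set) \<le> ennreal pi" .
  qed
  then show ?thesis using ennreal_less_top le_less_trans by blast
qed

definition parallelogram :: "'a::real_normed_vector \<Rightarrow> 'a \<Rightarrow> 'a set" where
  "parallelogram u v = (\<lambda>(a, b). a *\<^sub>R u + b *\<^sub>R v) ` ({0..1} \<times> {0..1})"

lemma hausdorff2_parallelogram_finite: "hausdorff2 (parallelogram u v) < top"
proof -
  let ?k = "norm u + norm v + 1"
  have k: "?k > 0" by (simp add: add_nonneg_pos)
  have "hausdorff2 (parallelogram u v) \<le> ennreal (?k\<^sup>2) * hausdorff2 ({0..1} \<times> {0..1} :: (real \<times> real) set)"
    unfolding parallelogram_def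
  proof (rule hausdorff2_lipschitz_image_le[OF k])
    fix p q :: "real \<times> real"
    obtain a b a' b' where pq: "p = (a, b)" "q = (a', b')" by (cases p, cases q) auto
    have "dist (a *\<^sub>R u + b *\<^sub>R v) (a' *\<^sub>R u + b' *\<^sub>R v) = norm ((a - a') *\<^sub>R u + (b - b') *\<^sub>R v)"
      by (simp add: dist_norm algebra_simps)
    also have "\<dots> \<le> \<bar>a - a'\<bar> * norm u + \<bar>b - b'\<bar> * norm v"
      by (metis norm_scaleR norm_triangle_ineq)
    also have "\<dots> \<le> dist p q * norm u + dist p q * norm v"
      using dist_fst_le[of p q] dist_snd_le[of p q]
      by (intro add_mono mult_right_mono) (auto simp: pq dist_real_def)
    also have "\<dots> \<le> ?k * dist p q" by (simp add: algebra_simps)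
    finally show "dist (case p of (a, b) \<Rightarrow> a *\<^sub>R u + b *\<^sub>R v) (case q of (a, b) \<Rightarrow> a *\<^sub>R u + b *\<^sub>R v) \<le> ?k * dist p q"
      by (simp add: pq)
  qed
  also have "\<dots> < top"
    using hausdorff2_unit_square by (simp add: ennreal_mult_less_top)
  finally show ?thesis .
qed

text \<open>A cover of the square is thickened to a cover of the unit cube by boxes, whose total
  volume is therefore at least 1. Each box has \<open>16 / pi\<close> times the disc area of the set
  it comes from, whence the bound \<open>pi / 16\<close>.\<close>

lemma hausdorff2_unit_square_pos:
  "hausdorff2 (parallelogram (axis 1 1) (axis 2 1 :: real^3)) > 0"
proof -
  let ?S = "parallelogram (axis 1 1) (axis 2 1 :: real^3)"
  have "ennreal (pi / 16) \<le> hausdorff2_premeasure 1 ?S"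
  proof (rule premeasure_geI)
    fix U assume U: "hcover 1 ?S U"
    define p where "p i = (SOME x. x \<in> U i)" for i
    define d where "d i = diameter (U i)" for i
    have d0: "d i \<ge> 0" for i using U by (auto simp: d_def hcover_def intro: diameter_ge_0)
    \<comment> \<open>Half-width \<open>d i\<close> around a point of \<open>U i\<close> is enough
      to contain the shadow of \<open>U i\<close> on the first two coordinates. The third side has
      length 1, so the volume is \<open>4 * (d i)\<^sup>2\<close>.\<close>
    define B where "B i = cbox (vector [p i $ 1 - d i, p i $ 2 - d i, 0]) (vector [p i $ 1 + d i, p i $ 2 + d i, 1] :: real^3)" for i
    have B: "emeasure lborel (B i) = ennreal (4 * (d i)\<^sup>2)" for i
    proof -
      have ne: "B i \<noteq> {}" using d0[of i] by (auto simp: B_def interval_ne_empty_cart forall_3)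
      have "measure lborel (B i) = (\<Prod>j\<in>UNIV. (vector [p i $ 1 + d i, p i $ 2 + d i, 1] :: real^3) $ j
          - (vector [p i $ 1 - d i, p i $ 2 - d i, 0] :: real^3) $ j)"
        unfolding B_def by (rule content_cbox_cart) (use ne in \<open>simp add: B_def\<close>)
      also have "\<dots> = 4 * (d i)\<^sup>2" unfolding UNIV_3
        by (simp add: power2_eq_square)
      finally show ?thesis
        by (metis B_def emeasure_eq_ennreal_measure emeasure_lborel_cbox_finite infinity_ennreal_def less_irrefl)
    qed
    have "cbox 0 1 \<subseteq> (\<Union>i. B i)"
    proof
      fix x :: "real^3" assume x: "x \<in> cbox 0 1"
      define y where "y = x $ 1 *\<^sub>R axis 1 1 + x $ 2 *\<^sub>R (axis 2 1 :: real^3)"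
      have y: "y $ 1 = x $ 1" "y $ 2 = x $ 2" by (simp_all add: y_def axis_def)
      have "y \<in> ?S" using x unfolding parallelogram_def y_def
        by (intro image_eqI[of _ _ "(x $ 1, x $ 2)"]) (auto simp: mem_box_cart)
      then obtain i where i: "y \<in> U i" using U by (auto simp: hcover_def)
      then have "p i \<in> U i" by (metis p_def someI)
      then have "dist (p i) y \<le> d i" using i U by (auto simp: d_def hcover_def intro: diameter_bounded_bound)
      then have *: "\<bar>p i $ j - y $ j\<bar> \<le> d i" for j
        using component_le_norm_cart[of "p i - y" j] by (simp add: dist_norm)
      have "x \<in> B i" using *[of 1] *[of 2] x y by (auto simp: B_def mem_box_cart forall_3 abs_le_iff)
      then show "x \<in> (\<Union>i. B i)" by blast
    qed
    then have "emeasure lborel (cbox 0 (1 :: real^3)) \<le> emeasure lborel (\<Union>i. B i)"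
      by (rule emeasure_mono) (auto simp: B_def)
    also have "\<dots> \<le> (\<Sum>i. emeasure lborel (B i))"
      by (rule emeasure_subadditive_countably) (auto simp: B_def)
    also have "(\<Sum>i. emeasure lborel (B i)) = (\<Sum>i. ennreal (16 / pi) * disc_area (U i))"
      unfolding B disc_area_def d_def by (intro suminf_cong) (simp add: ennreal_mult[symmetric])
    also have "\<dots> = ennreal (16 / pi) * (\<Sum>i. disc_area (U i))" by simp
    also have "emeasure lborel (cbox 0 (1 :: real^3)) = 1"
    proof -
      have "\<forall>b\<in>Basis. (0::real^3) \<bullet> b \<le> 1 \<bullet> b" "(\<Prod>b\<in>Basis. (1 - 0 :: real^3) \<bullet> b) = 1"
        by (auto simp: Basis_vec_def inner_axis intro!: prod.neutral)
      then show ?thesis by (subst emeasure_lborel_cbox) auto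
    qed
    finally have "ennreal (pi / 16) * 1 \<le> ennreal (pi / 16) * (ennreal (16 / pi) * (\<Sum>i. disc_area (U i)))"
      by (rule mult_left_mono) simp
    then show "ennreal (pi / 16) \<le> (\<Sum>i. disc_area (U i))"
      by (simp add: mult.assoc[symmetric] ennreal_mult[symmetric])
  qed
  also have "\<dots> \<le> hausdorff2 ?S" by (rule premeasure_le_hausdorff2) simp
  finally show ?thesis by (rule less_le_trans[rotated]) simp
qed

subsection \<open>Zonotopes and translation-invariant measures\<close>

text \<open>The hypothesis on increments makes \<open>f - f 0\<close> additive on the half-line. A
  monotone additive function is linear: its value at \<open>n * t\<close> is squeezed between those
  at neighbouring integers, and the error after division by \<open>n\<close> tends to 0.\<close>

lemma additive_increments_linear:
  fixes f :: "real \<Rightarrow> real"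
  assumes mono: "\<And>s t. 0 \<le> s \<Longrightarrow> s \<le> t \<Longrightarrow> f s \<le> f t"
    and incr: "\<And>s t. 0 \<le> s \<Longrightarrow> 0 \<le> t \<Longrightarrow> f (t + s) - f t = f s - f 0"
    and t: "0 \<le> t"
  shows "f t = (1 - t) * f 0 + t * f 1"
proof -
  define g where "g t = f t - f 0" for t
  have g_add: "g (s + t) = g s + g t" if "0 \<le> s" "0 \<le> t" for s t
    using incr[of t s] that by (simp add: g_def)
  have g_mono: "g s \<le> g t" if "0 \<le> s" "s \<le> t" for s t
    using mono[OF that] by (simp add: g_def)
  have g_mult: "g (real n * s) = real n * g s" if "0 \<le> s" for n s
  proof (induction n)
    case 0 then show ?case by (simp add: g_def)
  next
    case (Suc n)
    have "g (real (Suc n) * s) = g (real n * s + s)" by (simp add: algebra_simps)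
    also have "\<dots> = g (real n * s) + g s" using that by (intro g_add) auto
    finally show ?case using Suc by (simp add: algebra_simps)
  qed
  have g1: "g 1 \<ge> 0" using g_mono[of 0 1] by (simp add: g_def)
  have "\<bar>g t - t * g 1\<bar> \<le> g 1 * inverse (real (Suc m))" for m
  proof -
    let ?n = "Suc m"
    define k where "k = nat \<lfloor>real ?n * t\<rfloor>"
    have k: "real k \<le> real ?n * t" "real ?n * t \<le> real (Suc k)"
    proof -
      have "0 \<le> real ?n * t" using t by simp
      then have "real k = of_int \<lfloor>real ?n * t\<rfloor>" by (simp add: k_def)
      then show "real k \<le> real ?n * t" "real ?n * t \<le> real (Suc k)"
        using of_int_floor_le[of "real ?n * t"] real_of_int_floor_add_one_ge[of "real ?n * t"]
        by (simp_all add: add.commute del: of_int_floor_le)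
    qed
    have "real k * g 1 \<le> real ?n * g t" "real ?n * g t \<le> real (Suc k) * g 1"
      using g_mono[of "real k" "real ?n * t"] g_mono[of "real ?n * t" "real (Suc k)"] k t
        g_mult[of 1 k] g_mult[of 1 "Suc k"] g_mult[of t ?n] by auto
    moreover have "real k * g 1 \<le> real ?n * t * g 1" "real ?n * t * g 1 \<le> real (Suc k) * g 1"
      using k g1 by (auto intro!: mult_right_mono simp del: of_nat_Suc)
    ultimately have "\<bar>real ?n * g t - real ?n * t * g 1\<bar> \<le> g 1"
      by (simp add: abs_le_iff algebra_simps)
    also have "real ?n * g t - real ?n * t * g 1 = real ?n * (g t - t * g 1)"
      by (simp add: algebra_simps)
    finally have "\<bar>g t - t * g 1\<bar> * real ?n \<le> g 1"
      by (simp only: abs_mult abs_of_nat mult.commute)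
    then show ?thesis by (simp only: divide_inverse[symmetric] pos_le_divide_eq of_nat_0_less_iff zero_less_Suc)
  qed
  moreover have "(\<lambda>m. g 1 * inverse (real (Suc m))) \<longlonglongrightarrow> g 1 * 0"
    by (intro tendsto_mult tendsto_const LIMSEQ_inverse_real_of_nat)
  ultimately have "\<bar>g t - t * g 1\<bar> \<le> g 1 * 0"
    by (intro LIMSEQ_le_const) auto
  then show ?thesis by (simp add: g_def algebra_simps)
qed

subsection \<open>Multi-affine functions\<close>

text \<open>Arguments are nonnegative because the coordinates will be lengths of generators.
  Interpolation between the values at 0 and 1 is the form in which extrusion supplies
  affinity.\<close>

definition affine_in :: "'i set \<Rightarrow> (('i \<Rightarrow> real) \<Rightarrow> real) \<Rightarrow> bool" where
  "affine_in I f \<longleftrightarrow> (\<forall>i\<in>I. \<forall>t s. (\<forall>j. 0 \<le> t j) \<longrightarrow> 0 \<le> s \<longrightarrow>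
     f (t(i := s)) = (1 - s) * f (t(i := 0)) + s * f (t(i := 1)))"

lemma affine_inD:
  assumes "affine_in I f" "i \<in> I" "\<And>j. 0 \<le> t j" "0 \<le> s"
  shows "f (t(i := s)) = (1 - s) * f (t(i := 0)) + s * f (t(i := 1))"
  using assms unfolding affine_in_def by blast

lemma affine_in_expansion:
  assumes "finite I" "affine_in I f"
  shows "\<exists>c. \<forall>t. (\<forall>i. 0 \<le> t i) \<longrightarrow> (\<forall>i. i \<notin> I \<longrightarrow> t i = 0) \<longrightarrow> f t = (\<Sum>S\<in>Pow I. c S * (\<Prod>i\<in>S. t i))"
  using assms
proof (induction I arbitrary: f rule: finite_induct)
  case empty
  have "f t = (\<Sum>S\<in>Pow {}. f (\<lambda>_. 0) * (\<Prod>i\<in>S. t i))" if "\<forall>i. i \<notin> {} \<longrightarrow> t i = 0" for t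
  proof -
    have t: "t = (\<lambda>_. 0)" using that by (intro ext) blast
    show ?thesis by (subst t) simp
  qed
  then show ?case by (intro exI[of _ "\<lambda>_. f (\<lambda>_. 0)"] allI impI)
next
  case (insert j I)
  have aff: "affine_in I (\<lambda>t. f (t(j := a)))" if "a \<ge> 0" for a
    unfolding affine_in_def
  proof (intro ballI allI impI)
    fix i t s assume i: "i \<in> I" and t: "\<forall>j. 0 \<le> (t :: 'a \<Rightarrow> real) j" and s: "(0::real) \<le> s"
    have "i \<noteq> j" using i insert by auto
    then have twist: "(t(i := s, j := a)) = ((t(j := a))(i := s))" for s by (rule fun_upd_twist)
    show "f (t(i := s, j := a)) = (1 - s) * f (t(i := 0, j := a)) + s * f (t(i := 1, j := a))"
      unfolding twist by (rule affine_inD[OF insert.prems]) (use i t s that in auto)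
  qed
  obtain c0 where c0: "\<And>t. (\<forall>i. 0 \<le> t i) \<Longrightarrow> (\<forall>i. i \<notin> I \<longrightarrow> t i = 0) \<Longrightarrow>
      f (t(j := 0)) = (\<Sum>S\<in>Pow I. c0 S * (\<Prod>i\<in>S. t i))"
    using insert.IH[OF aff[OF order_refl]] by blast
  obtain c1 where c1: "\<And>t. (\<forall>i. 0 \<le> t i) \<Longrightarrow> (\<forall>i. i \<notin> I \<longrightarrow> t i = 0) \<Longrightarrow>
      f (t(j := 1)) = (\<Sum>S\<in>Pow I. c1 S * (\<Prod>i\<in>S. t i))"
    using insert.IH[OF aff[OF zero_le_one]] by blast
  \<comment> \<open>Interpolation in coordinate \<open>j\<close> is a constant term plus
    \<open>t j\<close> times a difference; a set containing \<open>j\<close> thus gets the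
    difference of the coefficients found for \<open>j\<close> at 1 and at 0.\<close>
  define c where "c S = (if j \<in> S then c1 (S - {j}) - c0 (S - {j}) else c0 S)" for S
  show ?case
  proof (intro exI[of _ c] allI impI)
    fix t :: "'a \<Rightarrow> real"
    assume t0: "\<forall>i. 0 \<le> t i" and toff: "\<forall>i. i \<notin> insert j I \<longrightarrow> t i = 0"
    let ?t = "t(j := 0)"
    have h: "\<forall>i. 0 \<le> ?t i" "\<forall>i. i \<notin> I \<longrightarrow> ?t i = 0" using t0 toff by auto
    have prod: "(\<Prod>i\<in>S. ?t i) = (\<Prod>i\<in>S. t i)" if "S \<in> Pow I" for S
      using that insert.hyps by (intro prod.cong) auto
    have sum_prod: "(\<Sum>S\<in>Pow I. d S * (\<Prod>i\<in>S. ?t i)) = (\<Sum>S\<in>Pow I. d S * (\<Prod>i\<in>S. t i))" for d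
      by (intro sum.cong refl) (simp only: prod)
    have "f t = f (?t(j := t j))" by simp
    also have "\<dots> = (1 - t j) * f (?t(j := 0)) + t j * f (?t(j := 1))"
      by (rule affine_inD[OF insert.prems]) (use h(1) t0 in auto)
    also have "\<dots> = (\<Sum>S\<in>Pow I. c0 S * (\<Prod>i\<in>S. t i)) + (\<Sum>S\<in>Pow I. (c1 S - c0 S) * (t j * (\<Prod>i\<in>S. t i)))"
      unfolding c0[OF h] c1[OF h] sum_prod
      by (simp add: sum_distrib_left sum.distrib[symmetric] algebra_simps flip: sum_subtractf)
    also have "\<dots> = (\<Sum>S\<in>Pow I. c S * (\<Prod>i\<in>S. t i)) + (\<Sum>S\<in>Pow I. c (insert j S) * (\<Prod>i\<in>insert j S. t i))"
    proof (intro arg_cong2[where f = "(+)"] sum.cong refl)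
      fix S assume S: "S \<in> Pow I"
      then have "j \<notin> S" "finite S" using insert.hyps by (auto intro: finite_subset)
      then show "c0 S * (\<Prod>i\<in>S. t i) = c S * (\<Prod>i\<in>S. t i)"
        and "(c1 S - c0 S) * (t j * (\<Prod>i\<in>S. t i)) = c (insert j S) * (\<Prod>i\<in>insert j S. t i)"
        by (simp_all add: c_def)
    qed
    also have "(\<Sum>S\<in>Pow I. c (insert j S) * (\<Prod>i\<in>insert j S. t i)) = (\<Sum>S\<in>insert j ` Pow I. c S * (\<Prod>i\<in>S. t i))"
      by (subst sum.reindex) (use insert.hyps in \<open>auto simp: inj_on_def\<close>)
    also have "(\<Sum>S\<in>Pow I. c S * (\<Prod>i\<in>S. t i)) + \<dots> = (\<Sum>S\<in>Pow (insert j I). c S * (\<Prod>i\<in>S. t i))"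
      unfolding Pow_insert by (rule sum.union_disjoint[symmetric]) (use insert.hyps in auto)
    finally show "f t = (\<Sum>S\<in>Pow (insert j I). c S * (\<Prod>i\<in>S. t i))" .
  qed
qed

definition ones :: "'i set \<Rightarrow> 'i \<Rightarrow> real" where
  "ones S i = (if i \<in> S then 1 else 0)"

text \<open>Comparing the values at the indicator function of \<open>S\<close> and at its double shows that all
  coefficients of degree other than \<open>n\<close> vanish.\<close>

lemma homogeneous_affine_in_expansion:
  assumes I: "finite I" and aff: "affine_in I f"
    and hom: "\<And>t. (\<And>i. 0 \<le> t i) \<Longrightarrow> (\<And>i. i \<notin> I \<Longrightarrow> t i = 0) \<Longrightarrow> f (\<lambda>i. 2 * t i) = 2 ^ n * f t"
    and t: "\<And>i. 0 \<le> t i" "\<And>i. i \<notin> I \<Longrightarrow> t i = 0"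
  shows "f t = (\<Sum>S | S \<subseteq> I \<and> card S = n. f (ones S) * (\<Prod>i\<in>S. t i))"
proof -
  obtain c where c: "\<And>t. (\<forall>i. 0 \<le> t i) \<Longrightarrow> (\<forall>i. i \<notin> I \<longrightarrow> t i = 0) \<Longrightarrow> f t = (\<Sum>S\<in>Pow I. c S * (\<Prod>i\<in>S. t i))"
    using affine_in_expansion[OF I aff] by blast
  have fin: "finite S" if "S \<subseteq> I" for S using that I by (rule finite_subset)
  have prod_scaled: "(\<Prod>i\<in>T. 2 * ones S i) = 2 ^ card T" if "T \<subseteq> S" for S T :: "'a set"
  proof -
    have "(\<Prod>i\<in>T. 2 * ones S i) = (\<Prod>i\<in>T. 2 :: real)" by (rule prod.cong) (use that in \<open>auto simp: ones_def\<close>)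
    then show ?thesis by simp
  qed
  have prod1: "(\<Prod>i\<in>T. a * ones S i) = 0" if "\<not> T \<subseteq> S" "T \<subseteq> I" for S T a
    using that fin[of T] by (auto simp: ones_def prod_zero_iff)
  have prod2: "(\<Prod>i\<in>T. ones S i) = (if T \<subseteq> S then 1 else 0)" if "T \<subseteq> I" for S T
    using that fin[of T] by (auto simp: ones_def prod_zero_iff intro!: prod.neutral)
  have restrict: "(\<Sum>T\<in>Pow I. c T * g T) = (\<Sum>T\<in>Pow S. c T * g T)"
    if "S \<subseteq> I" "\<And>T. T \<subseteq> I \<Longrightarrow> \<not> T \<subseteq> S \<Longrightarrow> g T = 0" for S g
    using that I by (intro sum.mono_neutral_right) auto
  have f1: "f (ones S) = (\<Sum>T\<in>Pow S. c T)" if "S \<subseteq> I" for S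
  proof -
    have "f (ones S) = (\<Sum>T\<in>Pow I. c T * (\<Prod>i\<in>T. ones S i))"
      using that by (intro c) (auto simp: ones_def)
    also have "\<dots> = (\<Sum>T\<in>Pow S. c T * (\<Prod>i\<in>T. ones S i))"
      using that prod2 by (intro restrict) auto
    also have "\<dots> = (\<Sum>T\<in>Pow S. c T)" using that prod2 by (intro sum.cong) auto
    finally show ?thesis .
  qed
  have f2: "2 ^ n * f (ones S) = (\<Sum>T\<in>Pow S. c T * 2 ^ card T)" if "S \<subseteq> I" for S
  proof -
    have "2 ^ n * f (ones S) = f (\<lambda>i. 2 * ones S i)"
      using that by (intro hom[symmetric]) (auto simp: ones_def)
    also have "\<dots> = (\<Sum>T\<in>Pow I. c T * (\<Prod>i\<in>T. 2 * ones S i))"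
      using that by (intro c) (auto simp: ones_def)
    also have "\<dots> = (\<Sum>T\<in>Pow S. c T * (\<Prod>i\<in>T. 2 * ones S i))"
      using that prod1 by (intro restrict) auto
    also have "\<dots> = (\<Sum>T\<in>Pow S. c T * 2 ^ card T)" using that prod_scaled by (intro sum.cong) auto
    finally show ?thesis .
  qed
  \<comment> \<open>Induction over subsets: every proper subset has coefficient 0 or size
    \<open>n\<close>, so subtracting \<open>2 ^ n\<close> times the value at \<open>ones S\<close>
    from the value at its double leaves \<open>c S * (2 ^ card S - 2 ^ n) = 0\<close>.\<close>
  have c0: "c S = 0" if "S \<subseteq> I" "card S \<noteq> n" for S
    using fin[OF that(1)] that
  proof (induction S rule: finite_psubset_induct)
    case (psubset S)
    have dec: "(\<Sum>T\<in>Pow S. g T) = g S + (\<Sum>T\<in>Pow S - {S}. g T)" for g :: "'a set \<Rightarrow> real"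
      by (rule sum.remove) (use psubset.hyps in auto)
    have "(\<Sum>T\<in>Pow S - {S}. c T * 2 ^ card T) = (\<Sum>T\<in>Pow S - {S}. 2 ^ n * c T)"
    proof (rule sum.cong)
      fix T assume "T \<in> Pow S - {S}"
      then have "T \<subset> S" "T \<subseteq> I" using psubset.prems by auto
      then show "c T * 2 ^ card T = 2 ^ n * c T"
        using psubset.IH[of T] by (cases "card T = n") auto
    qed simp
    then have "(\<Sum>T\<in>Pow S - {S}. c T * 2 ^ card T) = 2 ^ n * (\<Sum>T\<in>Pow S - {S}. c T)"
      by (simp add: sum_distrib_left)
    moreover have "f (ones S) = c S + (\<Sum>T\<in>Pow S - {S}. c T)"
      using f1[OF psubset.prems(1)] by (simp only: dec)
    moreover have "2 ^ n * f (ones S) = c S * 2 ^ card S + (\<Sum>T\<in>Pow S - {S}. c T * 2 ^ card T)"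
      using f2[OF psubset.prems(1)] by (simp only: dec)
    moreover have "c' * (a - b) = 0" if "Y = b * X" "f' = c' + X" "b * f' = c' * a + Y"
      for a b c' f' X Y :: real using that by algebra
    ultimately have "c S * (2 ^ card S - 2 ^ n) = 0" by blast
    moreover have "(2::real) ^ card S \<noteq> 2 ^ n" using psubset.prems(2) by simp
    ultimately show ?case by simp
  qed
  \<comment> \<open>Proper subsets of an \<open>n\<close>-element set have coefficient 0, so the
    value at \<open>ones S\<close> is the single coefficient of \<open>S\<close>.\<close>
  have cn: "f (ones S) = c S" if "S \<subseteq> I" "card S = n" for S
  proof -
    have "(\<Sum>T\<in>Pow S. c T) = (\<Sum>T\<in>{S}. c T)"
    proof (rule sum.mono_neutral_right)
      show "\<forall>T\<in>Pow S - {S}. c T = 0"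
      proof
        fix T assume "T \<in> Pow S - {S}"
        then have "T \<subset> S" "T \<subseteq> I" using that by auto
        then have "card T < n" using fin[OF that(1)] that(2) by (auto intro: psubset_card_mono)
        then show "c T = 0" using c0[of T] \<open>T \<subseteq> I\<close> by auto
      qed
    qed (use fin[OF that(1)] in auto)
    then show ?thesis using f1[OF that(1)] by simp
  qed
  have "f t = (\<Sum>S\<in>Pow I. c S * (\<Prod>i\<in>S. t i))" using t by (intro c) auto
  also have "\<dots> = (\<Sum>S | S \<subseteq> I \<and> card S = n. c S * (\<Prod>i\<in>S. t i))"
    using I c0 by (intro sum.mono_neutral_right) auto
  also have "\<dots> = (\<Sum>S | S \<subseteq> I \<and> card S = n. f (ones S) * (\<Prod>i\<in>S. t i))"
    using cn by (intro sum.cong) auto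
  finally show ?thesis .
qed

subsection \<open>Translation-invariant measures of zonotopes\<close>

text \<open>For \<open>t \<ge> 0\<close> this is the Minkowski sum of \<open>K\<close> with a
  segment; for negative \<open>t\<close> it is empty.\<close>

definition extrude :: "'a::real_vector set \<Rightarrow> 'a \<Rightarrow> real \<Rightarrow> 'a set" where
  "extrude K w t = (\<lambda>(y, s). y + s *\<^sub>R w) ` (K \<times> {0..t})"

lemma extrude_iff: "x \<in> extrude K w t \<longleftrightarrow> (\<exists>y\<in>K. \<exists>s. 0 \<le> s \<and> s \<le> t \<and> x = y + s *\<^sub>R w)"
  by (auto simp: extrude_def) blast

lemma compact_extrude: "compact K \<Longrightarrow> compact (extrude K (w::'a::euclidean_space) t)"
  unfolding extrude_def
  by (intro compact_continuous_image compact_Times) (auto simp: split_def intro!: continuous_intros)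

lemma extrude_zero: "extrude K w 0 = K"
  by (auto simp: extrude_def split_def image_iff)

lemma extrude_mono: "s \<le> t \<Longrightarrow> extrude K w s \<subseteq> extrude K w t"
  by (fastforce simp: extrude_iff)

text \<open>Lengthening an extrusion adds a translate of what was added at the start, so measure
  increments do not depend on \<open>t\<close>. Convexity prevents a ray in direction
  \<open>w\<close> from leaving \<open>K\<close> and entering it again.\<close>

lemma extrude_Diff_translate:
  assumes K: "convex K" and t: "0 \<le> t" and s: "0 \<le> s"
  shows "extrude K w (t + s) - extrude K w t = (+) (t *\<^sub>R w) ` (extrude K w s - K)"
proof (intro set_eqI iffI)
  fix x assume "x \<in> extrude K w (t + s) - extrude K w t"
  then obtain y q where yq: "y \<in> K" "0 \<le> q" "q \<le> t + s" "x = y + q *\<^sub>R w" "x \<notin> extrude K w t"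
    by (auto simp: extrude_iff)
  have "q > t"
  proof (rule ccontr)
    assume "\<not> q > t"
    then have "x \<in> extrude K w t" unfolding extrude_iff using yq by (intro bexI[of _ y] exI[of _ q]) auto
    then show False using yq by simp
  qed
  have "x = t *\<^sub>R w + (y + (q - t) *\<^sub>R w)" using yq by (simp add: algebra_simps)
  moreover have "y + (q - t) *\<^sub>R w \<in> extrude K w s"
    unfolding extrude_iff using yq \<open>q > t\<close> by (intro bexI[of _ y] exI[of _ "q - t"]) auto
  moreover have "y + (q - t) *\<^sub>R w \<notin> K"
  proof
    assume "y + (q - t) *\<^sub>R w \<in> K"
    then have "x \<in> extrude K w t" unfolding extrude_iff yq(4) using t
      by (intro bexI[of _ "y + (q - t) *\<^sub>R w"] exI[of _ t]) (auto simp: algebra_simps)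
    then show False using yq by simp
  qed
  ultimately show "x \<in> (+) (t *\<^sub>R w) ` (extrude K w s - K)" by blast
next
  fix x assume "x \<in> (+) (t *\<^sub>R w) ` (extrude K w s - K)"
  then obtain y r where yr: "y \<in> K" "0 \<le> r" "r \<le> s" "x = t *\<^sub>R w + (y + r *\<^sub>R w)" "y + r *\<^sub>R w \<notin> K"
    by (auto simp: extrude_iff)
  have "x \<in> extrude K w (t + s)" unfolding extrude_iff yr(4) using yr t
    by (intro bexI[of _ y] exI[of _ "t + r"]) (auto simp: algebra_simps)
  moreover have "x \<notin> extrude K w t"
  proof
    assume "x \<in> extrude K w t"
    then obtain z q where zq: "z \<in> K" "0 \<le> q" "q \<le> t" "x = z + q *\<^sub>R w" by (auto simp: extrude_iff)
    define p where "p = y + r *\<^sub>R w"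
    have z: "z = p + (t - q) *\<^sub>R w" using zq(4) yr(4) by (simp add: algebra_simps p_def)
    have "p \<in> K"
    proof (cases "r + (t - q) = 0")
      case True then have "r = 0" using zq yr by linarith
      then show ?thesis using yr by (simp add: p_def)
    next
      case False
      \<comment> \<open>\<open>p\<close> lies between \<open>y\<close> and \<open>z\<close> on a
        line in direction \<open>w\<close>, and \<open>?l\<close> is its position there.\<close>
      let ?l = "r / (r + (t - q))"
      have pos: "r + (t - q) > 0" using False zq yr by linarith
      have "(1 - ?l) *\<^sub>R y + ?l *\<^sub>R z \<in> K"
        using zq yr pos by (intro convexD_alt[OF K]) (auto simp: field_simps)
      moreover have "(1 - ?l) *\<^sub>R y + ?l *\<^sub>R z = y + (?l * (r + (t - q))) *\<^sub>R w"
      proof -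
        have "z = y + (r + (t - q)) *\<^sub>R w" by (simp add: z p_def algebra_simps)
        then show ?thesis by (simp add: scaleR_add_right scaleR_left_diff_distrib del: scaleR_left.add)
      qed
      moreover have "?l * (r + (t - q)) = r" using pos by simp
      ultimately show ?thesis by (simp add: p_def)
    qed
    then show False using yr by (simp add: p_def)
  qed
  ultimately show "x \<in> extrude K w (t + s) - extrude K w t" by blast
qed

section \<open>Zonotopes with variable generator lengths\<close>

definition parallel_sum :: "'i set \<Rightarrow> ('i \<Rightarrow> 'a::real_vector) \<Rightarrow> ('i \<Rightarrow> real) \<Rightarrow> 'a set" where
  "parallel_sum I v t = {(\<Sum>i\<in>I. x i *\<^sub>R v i) | x. \<forall>i\<in>I. 0 \<le> x i \<and> x i \<le> t i}"

lemma parallel_sum_empty [simp]: "parallel_sum {} v t = {0}"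
  by (auto simp: parallel_sum_def)

lemma parallel_sum_insert:
  assumes "finite I" "j \<notin> I"
  shows "parallel_sum (insert j I) v t = extrude (parallel_sum I v t) (v j) (t j)"
proof (intro set_eqI iffI)
  fix z assume "z \<in> parallel_sum (insert j I) v t"
  then obtain x where "z = (\<Sum>i\<in>insert j I. x i *\<^sub>R v i)" "\<forall>i\<in>insert j I. 0 \<le> x i \<and> x i \<le> t i"
    by (auto simp: parallel_sum_def)
  then show "z \<in> extrude (parallel_sum I v t) (v j) (t j)"
    using assms unfolding extrude_iff parallel_sum_def
    by (intro bexI[of _ "\<Sum>i\<in>I. x i *\<^sub>R v i"] exI[of _ "x j"]) (auto simp: add.commute)
next
  fix z assume "z \<in> extrude (parallel_sum I v t) (v j) (t j)"
  then obtain x s where x: "\<forall>i\<in>I. 0 \<le> x i \<and> x i \<le> t i" "0 \<le> s" "s \<le> t j"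
    "z = (\<Sum>i\<in>I. x i *\<^sub>R v i) + s *\<^sub>R v j"
    by (auto simp: extrude_iff parallel_sum_def)
  have "(\<Sum>i\<in>I. (x(j := s)) i *\<^sub>R v i) = (\<Sum>i\<in>I. x i *\<^sub>R v i)"
    using assms by (intro sum.cong) auto
  then have "z = (\<Sum>i\<in>insert j I. (x(j := s)) i *\<^sub>R v i)"
    using assms x by (simp add: add.commute)
  moreover have "\<forall>i\<in>insert j I. 0 \<le> (x(j := s)) i \<and> (x(j := s)) i \<le> t i" using x by auto
  ultimately show "z \<in> parallel_sum (insert j I) v t" unfolding parallel_sum_def by blast
qed

lemma convex_parallel_sum: "convex (parallel_sum I v t)"
  unfolding convex_def
proof clarify
  fix y z and a b :: real
  assume "y \<in> parallel_sum I v t" "z \<in> parallel_sum I v t" and ab: "0 \<le> a" "0 \<le> b" "a + b = 1"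
  then obtain x x' where x: "y = (\<Sum>i\<in>I. x i *\<^sub>R v i)" "\<forall>i\<in>I. 0 \<le> x i \<and> x i \<le> t i"
    "z = (\<Sum>i\<in>I. x' i *\<^sub>R v i)" "\<forall>i\<in>I. 0 \<le> x' i \<and> x' i \<le> t i"
    by (auto simp: parallel_sum_def)
  have "a *\<^sub>R y + b *\<^sub>R z = (\<Sum>i\<in>I. (a * x i + b * x' i) *\<^sub>R v i)"
    by (simp add: x scaleR_sum_right sum.distrib[symmetric] algebra_simps)
  moreover have "0 \<le> a * x i + b * x' i \<and> a * x i + b * x' i \<le> t i" if "i \<in> I" for i
    using x that ab convex_bound_le[of "x i" "t i" "x' i" a b] by auto
  ultimately show "a *\<^sub>R y + b *\<^sub>R z \<in> parallel_sum I v t"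
    unfolding parallel_sum_def by (intro CollectI exI[of _ "\<lambda>i. a * x i + b * x' i"]) auto
qed

lemma compact_parallel_sum:
  fixes v :: "'i \<Rightarrow> 'a::euclidean_space"
  shows "finite I \<Longrightarrow> compact (parallel_sum I v t)"
  by (induction I rule: finite_induct) (auto simp: parallel_sum_insert intro: compact_extrude)

lemma parallel_sum_cong:
  "I = I' \<Longrightarrow> (\<And>i. i \<in> I \<Longrightarrow> t i = t' i) \<Longrightarrow> parallel_sum I v t = parallel_sum I' v t'"
  by (auto simp: parallel_sum_def)

lemma parallel_sum_restrict:
  assumes "finite I" "S \<subseteq> I" "\<And>i. i \<in> I - S \<Longrightarrow> t i = 0"
  shows "parallel_sum I v t = parallel_sum S v t"
proof -
  have fS: "finite S" using assms finite_subset by blast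
  have "(\<And>i. i \<in> J \<Longrightarrow> t i = 0) \<Longrightarrow> J \<inter> S = {} \<Longrightarrow> parallel_sum (S \<union> J) v t = parallel_sum S v t"
    if "finite J" for J using that
  proof (induction J rule: finite_induct)
    case (insert j J)
    have "parallel_sum (insert j (S \<union> J)) v t = extrude (parallel_sum (S \<union> J) v t) (v j) (t j)"
      using insert fS by (intro parallel_sum_insert) auto
    then show ?case using insert by (simp add: extrude_zero)
  qed simp
  moreover have "(I - S) \<inter> S = {}" "S \<union> (I - S) = I" "finite (I - S)" using assms by auto
  ultimately show ?thesis using assms(3) by metis
qed

lemma parallel_sum_scale:
  assumes "k > 0"
  shows "parallel_sum I v (\<lambda>i. k * t i) = (*\<^sub>R) k ` parallel_sum I v t"
proof (intro set_eqI iffI)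
  fix z assume "z \<in> parallel_sum I v (\<lambda>i. k * t i)"
  then obtain x where x: "z = (\<Sum>i\<in>I. x i *\<^sub>R v i)" "\<forall>i\<in>I. 0 \<le> x i \<and> x i \<le> k * t i"
    by (auto simp: parallel_sum_def)
  have "z = k *\<^sub>R (\<Sum>i\<in>I. (x i / k) *\<^sub>R v i)" using assms by (simp add: x scaleR_sum_right)
  moreover have "(\<Sum>i\<in>I. (x i / k) *\<^sub>R v i) \<in> parallel_sum I v t"
    unfolding parallel_sum_def using x(2) assms
    by (intro CollectI exI[of _ "\<lambda>i. x i / k"]) (auto simp: field_simps)
  ultimately show "z \<in> (*\<^sub>R) k ` parallel_sum I v t" by blast
next
  fix z assume "z \<in> (*\<^sub>R) k ` parallel_sum I v t"
  then obtain x where x: "z = k *\<^sub>R (\<Sum>i\<in>I. x i *\<^sub>R v i)" "\<forall>i\<in>I. 0 \<le> x i \<and> x i \<le> t i"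
    by (auto simp: parallel_sum_def)
  then show "z \<in> parallel_sum I v (\<lambda>i. k * t i)"
    unfolding parallel_sum_def using assms
    by (intro CollectI exI[of _ "\<lambda>i. k * x i"]) (auto simp: scaleR_sum_right)
qed

text \<open>Lebesgue measure and two-dimensional Hausdorff measure are the two instances. Invariance
  is asked for on compact sets, which covers zonotopes and their extrusions.\<close>

locale translation_invariant_measure =
  fixes M :: "'a::euclidean_space measure"
  assumes sets_M: "sets M = sets borel"
    and translate: "\<And>a K. compact K \<Longrightarrow> emeasure M ((+) a ` K) = emeasure M K"
begin

lemma compact_sets: "compact K \<Longrightarrow> K \<in> sets M"
  by (simp add: sets_M borel_compact)

text \<open>The set added between \<open>t\<close> and \<open>t + s\<close> is a translate of the
  one added between 0 and \<open>s\<close>, so \<open>additive_increments_linear\<close> applies.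
  Finiteness is a hypothesis because Hausdorff area becomes infinite when a two-dimensional planar
  \<open>K\<close> is extruded out of its plane.\<close>

lemma measure_extrude:
  assumes K: "compact K" "convex K" and fin: "\<And>t. emeasure M (extrude K w t) < top" and t: "0 \<le> t"
  shows "measure M (extrude K w t) = (1 - t) * measure M K + t * measure M (extrude K w 1)"
proof -
  let ?f = "\<lambda>t. measure M (extrude K w t)"
  have cpt: "compact (extrude K w t)" for t by (rule compact_extrude[OF K(1)])
  have set: "extrude K w t \<in> sets M" for t using cpt by (rule compact_sets)
  have fm: "extrude K w t \<in> fmeasurable M" for t using set fin by (intro fmeasurableI) auto
  have KfM: "K \<in> fmeasurable M" using fm[of 0] by (simp add: extrude_zero)
  have "?f t = (1 - t) * ?f 0 + t * ?f 1"
  proof (rule additive_increments_linear[OF _ _ t])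
    fix s t :: real assume "0 \<le> s" "s \<le> t"
    then show "?f s \<le> ?f t" by (intro measure_mono_fmeasurable extrude_mono set fm)
  next
    fix s t :: real assume s: "0 \<le> s" and t: "0 \<le> t"
    have tr: "measure M ((+) (t *\<^sub>R w) ` C) = measure M C" if "compact C" for C
      using translate[OF that] by (simp add: measure_def)
    have inj: "inj ((+) (t *\<^sub>R w))" by simp
    have KS: "K \<subseteq> extrude K w s" using extrude_mono[of 0 s K w] s by (simp add: extrude_zero)
    have "extrude K w (t + s) - extrude K w t = (+) (t *\<^sub>R w) ` extrude K w s - (+) (t *\<^sub>R w) ` K"
      using extrude_Diff_translate[OF K(2) t s, of w] by (simp add: image_set_diff[OF inj])
    then have "measure M (extrude K w (t + s) - extrude K w t)
      = measure M ((+) (t *\<^sub>R w) ` extrude K w s - (+) (t *\<^sub>R w) ` K)" by simp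
    moreover have "measure M (extrude K w (t + s) - extrude K w t) = ?f (t + s) - ?f t"
      using fm s by (intro measurable_measure_Diff extrude_mono set) auto
    moreover have "measure M ((+) (t *\<^sub>R w) ` extrude K w s - (+) (t *\<^sub>R w) ` K)
       = measure M ((+) (t *\<^sub>R w) ` extrude K w s) - measure M ((+) (t *\<^sub>R w) ` K)"
    proof (rule measurable_measure_Diff)
      have ct: "compact ((+) (t *\<^sub>R w) ` extrude K w s)" "compact ((+) (t *\<^sub>R w) ` K)"
        using cpt K by (auto intro: compact_translation)
      show "(+) (t *\<^sub>R w) ` extrude K w s \<in> fmeasurable M"
        using fin ct translate[OF cpt] by (intro fmeasurableI compact_sets) auto
      show "(+) (t *\<^sub>R w) ` K \<in> sets M" by (rule compact_sets[OF ct(2)])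
      show "(+) (t *\<^sub>R w) ` K \<subseteq> (+) (t *\<^sub>R w) ` extrude K w s" using KS by blast
    qed
    ultimately show "?f (t + s) - ?f t = ?f s - ?f 0"
      using tr[OF cpt] tr[OF K(1)] by (simp add: extrude_zero)
  qed
  then show ?thesis by (simp add: extrude_zero)
qed

text \<open>The coefficients are values at 0-1 vectors of lengths, and length 0 switches a generator
  off. The degree \<open>n\<close> is 3 for volume and 2 for area.\<close>

theorem measure_parallel_sum:
  assumes I: "finite I"
    and fin: "\<And>t. emeasure M (parallel_sum I v t) < top"
    and hom: "\<And>t. measure M ((*\<^sub>R) 2 ` parallel_sum I v t) = 2 ^ n * measure M (parallel_sum I v t)"
    and t: "\<And>i. i \<in> I \<Longrightarrow> 0 \<le> t i"
  shows "measure M (parallel_sum I v t)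
     = (\<Sum>S | S \<subseteq> I \<and> card S = n. measure M (parallel_sum S v (\<lambda>_. 1)) * (\<Prod>i\<in>S. t i))"
proof -
  define f where "f t = measure M (parallel_sum I v t)" for t
  have aff: "affine_in I f"
    unfolding affine_in_def
  proof (intro ballI allI impI)
    fix i t s assume i: "i \<in> I" and t: "\<forall>j. 0 \<le> (t :: 'b \<Rightarrow> real) j" and s: "(0::real) \<le> s"
    define J where "J = I - {i}"
    have J: "finite J" "i \<notin> J" "I = insert i J" using i I by (auto simp: J_def)
    let ?K = "parallel_sum J v t"
    have E: "parallel_sum I v (t(i := r)) = extrude ?K (v i) r" for r
    proof -
      have "parallel_sum I v (t(i := r)) = extrude (parallel_sum J v (t(i := r))) (v i) r"
        using J by (simp add: parallel_sum_insert)
      also have "parallel_sum J v (t(i := r)) = ?K"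
        using J by (intro parallel_sum_cong) auto
      finally show ?thesis .
    qed
    have "measure M (extrude ?K (v i) s) = (1 - s) * measure M ?K + s * measure M (extrude ?K (v i) 1)"
    proof (rule measure_extrude[OF compact_parallel_sum[OF J(1)] convex_parallel_sum _ s])
      show "emeasure M (extrude ?K (v i) r) < top" for r using fin[of "t(i := r)"] by (simp only: E)
    qed
    then show "f (t(i := s)) = (1 - s) * f (t(i := 0)) + s * f (t(i := 1))"
      by (simp add: f_def E extrude_zero)
  qed
  \<comment> \<open>The expansion concerns vectors vanishing off \<open>I\<close>, where
    \<open>t\<close> is arbitrary.\<close>
  define u where "u i = (if i \<in> I then t i else 0)" for i
  have "f u = (\<Sum>S | S \<subseteq> I \<and> card S = n. f (ones S) * (\<Prod>i\<in>S. u i))"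
  proof (rule homogeneous_affine_in_expansion[OF I aff])
    fix t :: "'b \<Rightarrow> real"
    show "f (\<lambda>i. 2 * t i) = 2 ^ n * f t"
      using hom[of t] by (simp add: f_def parallel_sum_scale)
  qed (auto simp: u_def t)
  moreover have "f u = measure M (parallel_sum I v t)"
    unfolding f_def by (intro arg_cong[where f = "measure M"] parallel_sum_cong) (auto simp: u_def)
  moreover have summand: "f (ones S) * (\<Prod>i\<in>S. u i) = measure M (parallel_sum S v (\<lambda>_. 1)) * (\<Prod>i\<in>S. t i)"
    if "S \<subseteq> I" for S
  proof -
    have "parallel_sum I v (ones S) = parallel_sum S v (ones S)"
      using that I by (intro parallel_sum_restrict) (auto simp: ones_def)
    also have "\<dots> = parallel_sum S v (\<lambda>_. 1)" by (rule parallel_sum_cong) (auto simp: ones_def)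
    moreover have "(\<Prod>i\<in>S. u i) = (\<Prod>i\<in>S. t i)" using that by (intro prod.cong) (auto simp: u_def)
    ultimately show ?thesis by (simp add: f_def)
  qed
  moreover have "(\<Sum>S | S \<subseteq> I \<and> card S = n. f (ones S) * (\<Prod>i\<in>S. u i))
    = (\<Sum>S | S \<subseteq> I \<and> card S = n. measure M (parallel_sum S v (\<lambda>_. 1)) * (\<Prod>i\<in>S. t i))"
    by (rule sum.cong) (use summand in auto)
  ultimately show ?thesis by simp
qed

end

subsection \<open>Sums over small subsets as ordered sums\<close>

text \<open>Every two-element set comes from two ordered pairs, and a \<open>g\<close> that vanishes
  on the diagonal allows the sum to run over all of them. Unrestricted sums are easier to evaluate
  and to differentiate termwise.\<close>

lemma sum_card2_subsets:
  fixes G :: "'i set \<Rightarrow> real"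
  assumes I: "finite I" and g: "\<And>i j. i \<in> I \<Longrightarrow> j \<in> I \<Longrightarrow> i \<noteq> j \<Longrightarrow> G {i, j} = g i j"
    and g0: "\<And>i. g i i = 0"
  shows "(\<Sum>S | S \<subseteq> I \<and> card S = 2. G S) = (\<Sum>i\<in>I. \<Sum>j\<in>I. g i j) / 2"
proof -
  let ?T = "{(i, j). i \<in> I \<and> j \<in> I \<and> i \<noteq> j}"
  let ?P = "{S. S \<subseteq> I \<and> card S = 2}"
  let ?h = "\<lambda>(i, j). {i, j}"
  have finT: "finite ?T" by (rule finite_subset[of _ "I \<times> I"]) (use I in auto)
  have finP: "finite ?P" using I by simp
  have "(\<Sum>i\<in>I. \<Sum>j\<in>I. g i j) = (\<Sum>(i, j)\<in>I \<times> I. g i j)"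
    by (simp add: sum.cartesian_product)
  also have "\<dots> = (\<Sum>(i, j)\<in>?T. g i j)"
    by (rule sum.mono_neutral_right) (use I g0 in auto)
  also have "\<dots> = (\<Sum>x\<in>?T. G (?h x))"
    by (rule sum.cong) (auto simp: g)
  also have "\<dots> = (\<Sum>S\<in>?P. \<Sum>x | x \<in> ?T \<and> ?h x = S. G (?h x))"
    by (rule sum.group[symmetric]) (use finT finP in auto)
  also have "\<dots> = (\<Sum>S\<in>?P. 2 * G S)"
  proof (rule sum.cong[OF refl])
    fix S assume S: "S \<in> ?P"
    then obtain a b where ab: "S = {a, b}" "a \<noteq> b" by (auto simp: card_2_iff)
    have "{x. x \<in> ?T \<and> ?h x = S} = {(a, b), (b, a)}" using S ab by (auto simp: doubleton_eq_iff)
    then show "(\<Sum>x | x \<in> ?T \<and> ?h x = S. G (?h x)) = 2 * G S"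
      using ab by (simp add: insert_commute)
  qed
  finally show ?thesis by (simp add: sum_distrib_left[symmetric])
qed

lemma sum_card3_subsets:
  fixes G :: "'i set \<Rightarrow> real"
  assumes I: "finite I"
    and g: "\<And>i j k. i \<in> I \<Longrightarrow> j \<in> I \<Longrightarrow> k \<in> I \<Longrightarrow> i \<noteq> j \<Longrightarrow> i \<noteq> k \<Longrightarrow> j \<noteq> k \<Longrightarrow> G {i, j, k} = g i j k"
    and g0: "\<And>i j. g i i j = 0" "\<And>i j. g i j i = 0" "\<And>i j. g i j j = 0"
  shows "(\<Sum>S | S \<subseteq> I \<and> card S = 3. G S) = (\<Sum>i\<in>I. \<Sum>j\<in>I. \<Sum>k\<in>I. g i j k) / 6"
proof -
  let ?T = "{(i, j, k). i \<in> I \<and> j \<in> I \<and> k \<in> I \<and> i \<noteq> j \<and> i \<noteq> k \<and> j \<noteq> k}"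
  let ?P = "{S. S \<subseteq> I \<and> card S = 3}"
  let ?h = "\<lambda>(i, j, k). {i, j, k}"
  have finT: "finite ?T" by (rule finite_subset[of _ "I \<times> I \<times> I"]) (use I in auto)
  have finP: "finite ?P" using I by simp
  have "(\<Sum>i\<in>I. \<Sum>j\<in>I. \<Sum>k\<in>I. g i j k) = (\<Sum>(i, j, k)\<in>I \<times> I \<times> I. g i j k)"
    by (simp add: sum.cartesian_product)
  also have "\<dots> = (\<Sum>(i, j, k)\<in>?T. g i j k)"
    by (rule sum.mono_neutral_right) (use I g0 in auto)
  also have "\<dots> = (\<Sum>x\<in>?T. G (?h x))"
    by (rule sum.cong) (auto simp: g)
  also have "\<dots> = (\<Sum>S\<in>?P. \<Sum>x | x \<in> ?T \<and> ?h x = S. G (?h x))"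
    by (rule sum.group[symmetric]) (use finT finP in auto)
  also have "\<dots> = (\<Sum>S\<in>?P. 6 * G S)"
  proof (rule sum.cong[OF refl])
    fix S assume S: "S \<in> ?P"
    then obtain a b c where abc: "S = {a, b, c}" "a \<noteq> b" "a \<noteq> c" "b \<noteq> c" by (auto simp: card_3_iff)
    have "{x. x \<in> ?T \<and> ?h x = S} = {(a, b, c), (a, c, b), (b, a, c), (b, c, a), (c, a, b), (c, b, a)}"
    proof (intro equalityI subsetI)
      fix x assume "x \<in> {x. x \<in> ?T \<and> ?h x = S}"
      then obtain i j k where x: "x = (i, j, k)" "i \<noteq> j" "i \<noteq> k" "j \<noteq> k" "{i, j, k} = {a, b, c}"
        using abc by auto
      then have "i \<in> {a, b, c}" "j \<in> {a, b, c}" "k \<in> {a, b, c}" by auto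
      then show "x \<in> {(a, b, c), (a, c, b), (b, a, c), (b, c, a), (c, a, b), (c, b, a)}"
        using x by auto
    next
      fix x assume "x \<in> {(a, b, c), (a, c, b), (b, a, c), (b, c, a), (c, a, b), (c, b, a)}"
      then show "x \<in> {x. x \<in> ?T \<and> ?h x = S}" using abc S by auto
    qed
    then have "(\<Sum>x | x \<in> ?T \<and> ?h x = S. G (?h x))
       = (\<Sum>x\<in>{(a, b, c), (a, c, b), (b, a, c), (b, c, a), (c, a, b), (c, b, a)}. G (?h x))" by simp
    also have "\<dots> = 6 * G S"
      using abc by (simp add: insert_commute)
    finally show "(\<Sum>x | x \<in> ?T \<and> ?h x = S. G (?h x)) = 6 * G S" .
  qed
  finally show ?thesis by (simp add: sum_distrib_left[symmetric])
qed

subsection \<open>Volume of zonotopes\<close>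

interpretation lborel_tim: translation_invariant_measure "lborel :: (real^3) measure"
proof
  fix a :: "real^3" and K :: "(real^3) set" assume "compact K"
  then have K: "K \<in> sets borel" by (rule borel_compact)
  have "emeasure lborel K = emeasure (distr lborel borel ((+) (- a))) K"
    by (simp add: lborel_distr_plus)
  also have "\<dots> = emeasure lborel ((+) (- a) -` K)"
    using K by (subst emeasure_distr) auto
  also have "(+) (- a) -` K = (+) a ` K"
  proof (intro set_eqI iffI)
    fix x assume "x \<in> (+) (- a) -` K"
    then show "x \<in> (+) a ` K" by (intro image_eqI[of _ _ "- a + x"]) auto
  qed auto
  finally show "emeasure lborel ((+) a ` K) = emeasure lborel K" by simp
qed simp

definition triple_product :: "real^3 \<Rightarrow> real^3 \<Rightarrow> real^3 \<Rightarrow> real" where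
  "triple_product u v w = u \<bullet> cross3 v w"

lemma triple_product_degenerate:
  "triple_product u u v = 0" "triple_product u v u = 0" "triple_product u v v = 0"
  by (simp_all add: triple_product_def dot_cross_self)

text \<open>The parallelepiped is the image of the unit cube under the linear map with columns
  \<open>v i\<close>, \<open>v j\<close>, \<open>v k\<close>.\<close>

lemma measure_parallelepiped:
  assumes "i \<noteq> j" "i \<noteq> k" "j \<noteq> k"
  shows "measure lborel (parallel_sum {i, j, k} v (\<lambda>_. 1)) = \<bar>triple_product (v i) (v j) (v k)\<bar>"
proof -
  define f where "f x = x $ 1 *\<^sub>R v i + x $ 2 *\<^sub>R v j + x $ 3 *\<^sub>R v k" for x :: "real^3"
  have lin: "linear f" unfolding f_def by (intro linearI) (auto simp: algebra_simps)
  have "parallel_sum {i, j, k} v (\<lambda>_. 1) = f ` cbox 0 1"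
  proof (intro set_eqI iffI)
    fix z assume "z \<in> parallel_sum {i, j, k} v (\<lambda>_. 1)"
    then obtain x where "z = (\<Sum>l\<in>{i, j, k}. x l *\<^sub>R v l)" "\<forall>l\<in>{i, j, k}. 0 \<le> x l \<and> x l \<le> 1"
      by (auto simp: parallel_sum_def)
    then have "z = f (vector [x i, x j, x k])" "vector [x i, x j, x k] \<in> cbox (0::real^3) 1"
      using assms by (auto simp: f_def mem_box_cart forall_3)
    then show "z \<in> f ` cbox 0 1" by blast
  next
    fix z assume "z \<in> f ` cbox 0 1"
    then obtain y where y: "z = f y" "y \<in> cbox 0 1" by blast
    let ?x = "\<lambda>l. if l = i then y $ 1 else if l = j then y $ 2 else y $ 3"
    have "z = (\<Sum>l\<in>{i, j, k}. ?x l *\<^sub>R v l)" using assms y by (auto simp: f_def)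
    moreover have "\<forall>l\<in>{i, j, k}. 0 \<le> ?x l \<and> ?x l \<le> 1"
      using y by (auto simp: mem_box_cart)
    ultimately show "z \<in> parallel_sum {i, j, k} v (\<lambda>_. 1)"
      unfolding parallel_sum_def by (intro CollectI exI[of _ ?x] conjI)
  qed
  moreover have "measure lebesgue (f ` cbox 0 1) = \<bar>det (matrix f)\<bar> * measure lebesgue (cbox 0 (1::real^3))"
    by (rule measure_linear_image[OF lin]) simp
  moreover have "measure lebesgue (cbox 0 (1::real^3)) = 1"
  proof -
    have "cbox 0 (1::real^3) \<noteq> {}" by (simp add: interval_ne_empty_cart)
    then show ?thesis by (simp add: content_cbox_cart measure_completion)
  qed
  moreover have "compact (parallel_sum {i, j, k} v (\<lambda>_. 1))" by (rule compact_parallel_sum) simp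
  then have "measure lebesgue (parallel_sum {i, j, k} v (\<lambda>_. 1)) = measure lborel (parallel_sum {i, j, k} v (\<lambda>_. 1))"
    by (intro measure_completion) (simp add: borel_compact)
  moreover have "det (matrix f) = triple_product (v i) (v j) (v k)"
    by (simp add: det_3 matrix_def f_def axis_def triple_product_def cross3_def inner_vec_def sum_3 algebra_simps)
  ultimately show ?thesis by simp
qed

theorem volume_parallel_sum:
  fixes v :: "'i::finite \<Rightarrow> real^3"
  assumes t: "\<And>i. 0 \<le> t i"
  shows "measure lborel (parallel_sum UNIV v t)
    = (\<Sum>i\<in>UNIV. \<Sum>j\<in>UNIV. \<Sum>k\<in>UNIV. t i * t j * t k * \<bar>triple_product (v i) (v j) (v k)\<bar>) / 6"
proof -
  have "measure lborel (parallel_sum UNIV v t)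
     = (\<Sum>S | S \<subseteq> UNIV \<and> card S = 3. measure lborel (parallel_sum S v (\<lambda>_. 1)) * (\<Prod>i\<in>S. t i))"
  proof (rule lborel_tim.measure_parallel_sum)
    fix t
    have c: "compact (parallel_sum UNIV v t)" by (rule compact_parallel_sum) simp
    show "emeasure lborel (parallel_sum UNIV v t) < top"
      using emeasure_bounded_finite[OF compact_imp_bounded[OF c]] by simp
    have c2: "compact ((*\<^sub>R) 2 ` parallel_sum UNIV v t)"
      using c by (rule compact_scaling)
    have "measure lebesgue ((*\<^sub>R) 2 ` parallel_sum UNIV v t) = 2 ^ 3 * measure lebesgue (parallel_sum UNIV v t)"
      using measure_lebesgue_affine[of 2 0 "parallel_sum UNIV v t"] by simp
    then show "measure lborel ((*\<^sub>R) 2 ` parallel_sum UNIV v t) = 2 ^ 3 * measure lborel (parallel_sum UNIV v t)"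
      using c c2 by (simp add: measure_completion borel_compact)
  qed (use t in auto)
  also have "\<dots> = (\<Sum>i\<in>UNIV. \<Sum>j\<in>UNIV. \<Sum>k\<in>UNIV. t i * t j * t k * \<bar>triple_product (v i) (v j) (v k)\<bar>) / 6"
    by (rule sum_card3_subsets) (auto simp: triple_product_degenerate measure_parallelepiped mult_ac)
  finally show ?thesis .
qed

subsection \<open>Area of planar zonotopes\<close>

abbreviation (input) area_measure :: "(real^3) measure" where
  "area_measure \<equiv> hausdorff2_borel"

lemma emeasure_area_compact: "compact K \<Longrightarrow> emeasure area_measure K = hausdorff2 K"
  by (rule emeasure_hausdorff2_borel) (rule borel_compact)

lemma hausdorff2_translate: "hausdorff2 ((+) a ` S) = hausdorff2 (S :: 'a::real_normed_vector set)"
  by (rule hausdorff2_isometry_image) (simp add: dist_norm)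

interpretation area_tim: translation_invariant_measure area_measure
proof
  fix a :: "real^3" and K :: "(real^3) set" assume "compact K"
  then show "emeasure area_measure ((+) a ` K) = emeasure area_measure K"
    by (simp add: emeasure_area_compact compact_translation hausdorff2_translate)
qed simp

lemma compact_parallelogram: "compact (parallelogram u (v :: real^3))"
  unfolding parallelogram_def
  by (intro compact_continuous_image compact_Times) (auto simp: split_def intro!: continuous_intros)

lemma parallelogram_iff:
  "x \<in> parallelogram u v \<longleftrightarrow> (\<exists>a b. 0 \<le> a \<and> a \<le> 1 \<and> 0 \<le> b \<and> b \<le> 1 \<and> x = a *\<^sub>R u + b *\<^sub>R v)"
proof
  assume "x \<in> parallelogram u v"
  then obtain a b where "a \<in> {0..1}" "b \<in> {0..1}" "x = a *\<^sub>R u + b *\<^sub>R v"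
    by (auto simp: parallelogram_def)
  then show "\<exists>a b. 0 \<le> a \<and> a \<le> 1 \<and> 0 \<le> b \<and> b \<le> 1 \<and> x = a *\<^sub>R u + b *\<^sub>R v"
    by (intro exI[of _ a] exI[of _ b]) simp
next
  assume "\<exists>a b. 0 \<le> a \<and> a \<le> 1 \<and> 0 \<le> b \<and> b \<le> 1 \<and> x = a *\<^sub>R u + b *\<^sub>R v"
  then obtain a b where "(a, b) \<in> {0..1} \<times> {0..1}" "x = a *\<^sub>R u + b *\<^sub>R v" by auto
  then show "x \<in> parallelogram u v"
    unfolding parallelogram_def by (intro image_eqI[of _ _ "(a, b)"]) simp_all
qed

lemma emeasure_parallelogram_finite: "emeasure area_measure (parallelogram u v) < top"
  by (simp add: emeasure_area_compact compact_parallelogram hausdorff2_parallelogram_finite)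

section \<open>Area of parallelograms, up to a common factor\<close>

definition parea :: "real^3 \<Rightarrow> real^3 \<Rightarrow> real" where
  "parea u v = measure area_measure (parallelogram u v)"

lemma parea_commute: "parea u v = parea v u"
proof -
  have "parallelogram u v = parallelogram v u"
    by (auto simp: parallelogram_iff) (metis add.commute)+
  then show ?thesis by (simp add: parea_def)
qed

lemma extrude_segment:
  assumes "0 \<le> t"
  shows "extrude (closed_segment 0 v) u t = parallelogram (t *\<^sub>R u) v"
proof (intro set_eqI iffI)
  fix x assume "x \<in> extrude (closed_segment 0 v) u t"
  then obtain b s where b: "0 \<le> b" "b \<le> 1" "0 \<le> s" "s \<le> t" "x = b *\<^sub>R v + s *\<^sub>R u"
    by (auto simp: extrude_iff in_segment)
  have "s = (if t = 0 then 0 else s / t) * t" using b by auto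
  then have "x = (if t = 0 then 0 else s / t) *\<^sub>R (t *\<^sub>R u) + b *\<^sub>R v" using b by (simp add: add.commute)
  moreover have "0 \<le> (if t = 0 then 0 else s / t)" "(if t = 0 then 0 else s / t) \<le> 1" using b by auto
  ultimately show "x \<in> parallelogram (t *\<^sub>R u) v" using b unfolding parallelogram_iff by blast
next
  fix x assume "x \<in> parallelogram (t *\<^sub>R u) v"
  then obtain a b where ab: "0 \<le> a" "a \<le> 1" "0 \<le> b" "b \<le> 1" "x = a *\<^sub>R t *\<^sub>R u + b *\<^sub>R v"
    by (auto simp: parallelogram_iff)
  have "b *\<^sub>R v \<in> closed_segment 0 v" using ab by (auto simp: in_segment)
  moreover have "0 \<le> a * t" "a * t \<le> t" using ab assms by (auto intro: mult_left_le_one_le)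
  moreover have "x = b *\<^sub>R v + (a * t) *\<^sub>R u" using ab by simp
  ultimately show "x \<in> extrude (closed_segment 0 v) u t" unfolding extrude_iff by blast
qed

text \<open>A parallelogram is an extruded segment, and segments are null, so the affine function of
  the length has no constant term.\<close>

lemma parea_scale:
  assumes "0 \<le> t"
  shows "parea (t *\<^sub>R u) v = t * parea u v"
proof -
  let ?K = "closed_segment 0 v"
  have "measure area_measure ?K = 0"
    by (simp add: measure_def emeasure_area_compact hausdorff2_segment)
  moreover have "emeasure area_measure (extrude ?K u t) < top" for t
  proof (cases "0 \<le> t")
    case True then show ?thesis by (simp add: extrude_segment emeasure_parallelogram_finite)
  next
    case False
    then have "extrude ?K u t = {}" by (auto simp: extrude_iff)
    then show ?thesis by simp
  qed
  ultimately have "measure area_measure (extrude ?K u t) = t * measure area_measure (extrude ?K u 1)"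
    using area_tim.measure_extrude[of ?K u t] assms by simp
  then show ?thesis using assms by (simp add: parea_def extrude_segment)
qed

text \<open>Both segments have the same projection along \<open>u\<close>, so that extruding either of them along
  \<open>u\<close> far enough covers a long extrusion of the other; compare the growth rates.\<close>

lemma parea_shear_le: "parea u (v + s *\<^sub>R u) \<le> parea u v"
proof (rule field_le_epsilon)
  fix e :: real assume e: "0 < e"
  define K where "K = closed_segment 0 v"
  define K' where "K' = closed_segment 0 (v + s *\<^sub>R u)"
  have incl: "extrude K' u t \<subseteq> (+) (- \<bar>s\<bar> *\<^sub>R u) ` extrude K u (2 * \<bar>s\<bar> + t)" if "0 \<le> t" for t
  proof
    fix x assume "x \<in> extrude K' u t"
    then obtain b r where b: "0 \<le> b" "b \<le> 1" "0 \<le> r" "r \<le> t" "x = b *\<^sub>R (v + s *\<^sub>R u) + r *\<^sub>R u"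
      by (auto simp: extrude_iff in_segment K'_def)
    have "\<bar>b * s\<bar> \<le> \<bar>s\<bar>" using b by (simp add: abs_mult mult_left_le_one_le)
    then have "0 \<le> \<bar>s\<bar> + b * s + r" "\<bar>s\<bar> + b * s + r \<le> 2 * \<bar>s\<bar> + t" using b by auto
    moreover have "b *\<^sub>R v \<in> K" using b by (auto simp: in_segment K_def)
    ultimately have "b *\<^sub>R v + (\<bar>s\<bar> + b * s + r) *\<^sub>R u \<in> extrude K u (2 * \<bar>s\<bar> + t)"
      unfolding extrude_iff by blast
    moreover have "x = - \<bar>s\<bar> *\<^sub>R u + (b *\<^sub>R v + (\<bar>s\<bar> + b * s + r) *\<^sub>R u)"
      by (simp add: b algebra_simps)
    ultimately show "x \<in> (+) (- \<bar>s\<bar> *\<^sub>R u) ` extrude K u (2 * \<bar>s\<bar> + t)" by blast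
  qed
  have main: "t * parea u (v + s *\<^sub>R u) \<le> (2 * \<bar>s\<bar> + t) * parea u v" if "0 \<le> t" for t
  proof -
    have c: "compact (extrude K u r)" for r by (simp add: K_def compact_extrude)
    have fin: "emeasure area_measure (extrude K u (2 * \<bar>s\<bar> + t)) < top"
      unfolding K_def using that by (simp add: extrude_segment emeasure_parallelogram_finite)
    have "t * parea u (v + s *\<^sub>R u) = measure area_measure (extrude K' u t)"
      unfolding K'_def using that by (simp add: extrude_segment parea_scale[symmetric]) (simp add: parea_def)
    also have "\<dots> \<le> measure area_measure ((+) (- \<bar>s\<bar> *\<^sub>R u) ` extrude K u (2 * \<bar>s\<bar> + t))"
    proof (rule measure_mono_fmeasurable[OF incl[OF that]])
      show "extrude K' u t \<in> sets area_measure"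
        by (simp add: K'_def compact_extrude borel_compact)
      show "(+) (- \<bar>s\<bar> *\<^sub>R u) ` extrude K u (2 * \<bar>s\<bar> + t) \<in> fmeasurable area_measure"
        by (intro fmeasurableI area_tim.compact_sets compact_translation c)
          (simp only: area_tim.translate[OF c] fin infinity_ennreal_def)
    qed
    also have "\<dots> = measure area_measure (extrude K u (2 * \<bar>s\<bar> + t))"
      using area_tim.translate[OF c, of "- \<bar>s\<bar> *\<^sub>R u" "2 * \<bar>s\<bar> + t"] by (simp add: measure_def)
    also have "\<dots> = (2 * \<bar>s\<bar> + t) * parea u v"
      unfolding K_def using that by (simp add: extrude_segment parea_scale[symmetric]) (simp add: parea_def)
    finally show ?thesis .
  qed
  \<comment> \<open>Divided by \<open>t\<close>, the estimate \<open>main\<close> leaves an excess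
    \<open>2 * \<bar>s\<bar> * parea u v / t\<close>; \<open>T\<close> is the length for which it
    equals \<open>e\<close>.\<close>
  define T where "T = 2 * \<bar>s\<bar> * parea u v / e"
  have Te: "2 * \<bar>s\<bar> * parea u v = T * e" using e by (simp add: T_def)
  have p0: "0 \<le> parea u v" by (simp add: parea_def)
  show "parea u (v + s *\<^sub>R u) \<le> parea u v + e"
  proof (cases "T = 0")
    case True
    then have "2 * \<bar>s\<bar> * parea u v = 0" using Te by simp
    moreover have "(2 * \<bar>s\<bar> + 1) * parea u v = 2 * \<bar>s\<bar> * parea u v + parea u v"
      by (simp add: algebra_simps)
    ultimately show ?thesis using main[of 1] e by linarith
  next
    case False
    then have t: "T > 0" using p0 e by (simp add: less_le T_def)
    have "T * parea u (v + s *\<^sub>R u) \<le> 2 * \<bar>s\<bar> * parea u v + T * parea u v"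
      using main[of T] t by (simp add: algebra_simps)
    also have "2 * \<bar>s\<bar> * parea u v = T * e" by (rule Te)
    finally have "T * parea u (v + s *\<^sub>R u) \<le> T * (parea u v + e)"
      by (simp only: distrib_left add.commute)
    then show ?thesis using t by (simp only: mult_le_cancel_left_pos)
  qed
qed

lemma parea_shear: "parea u (v + s *\<^sub>R u) = parea u v"
  using parea_shear_le[of u v s] parea_shear_le[of u "v + s *\<^sub>R u" "- s"] by simp

text \<open>The isodiametric inequality would give \<open>area_unit = 1\<close>, but a positive multiple of the area is
  good enough for the sign of a Hessian.\<close>

definition area_unit :: real where
  "area_unit = parea (axis 1 1) (axis 2 1)"

lemma area_unit_pos: "area_unit > 0"
  unfolding area_unit_def parea_def measure_def
  using hausdorff2_unit_square_pos emeasure_parallelogram_finite[of "axis 1 1" "axis 2 1"]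
  by (simp add: emeasure_area_compact compact_parallelogram enn2real_positive_iff)

lemma parea_orthonormal:
  assumes "norm u = 1" "norm w = 1" "u \<bullet> w = 0"
  shows "parea u w = area_unit"
proof -
  let ?S = "parallelogram (axis 1 1) (axis 2 1 :: real^3)"
  define f where "f x = x $ 1 *\<^sub>R u + x $ 2 *\<^sub>R w" for x :: "real^3"
  have "f (a *\<^sub>R axis 1 1 + b *\<^sub>R axis 2 1) = a *\<^sub>R u + b *\<^sub>R w" for a b
    by (simp add: f_def axis_def)
  then have "parallelogram u w = f ` ?S"
    unfolding parallelogram_def image_image by (intro image_cong) auto
  moreover have "hausdorff2 (f ` ?S) = hausdorff2 ?S"
  proof (rule hausdorff2_isometry_image)
    fix x y assume "x \<in> ?S" "y \<in> ?S"
    then have 3: "x $ 3 = 0" "y $ 3 = 0" by (auto simp: parallelogram_def axis_def)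
    have "f x - f y = (x $ 1 - y $ 1) *\<^sub>R u + (x $ 2 - y $ 2) *\<^sub>R w"
      by (simp add: f_def algebra_simps)
    then have "(norm (f x - f y))\<^sup>2 = (x $ 1 - y $ 1)\<^sup>2 * (u \<bullet> u) + (x $ 2 - y $ 2)\<^sup>2 * (w \<bullet> w)"
      using assms(3) unfolding power2_norm_eq_inner
      by (simp add: inner_add_left inner_add_right inner_commute power2_eq_square del: dot_square_norm)
    also have "\<dots> = (norm (x - y))\<^sup>2"
    proof -
      have "u \<bullet> u = 1" "w \<bullet> w = 1" using assms(1,2) by (simp_all add: dot_square_norm)
      moreover have "(norm (x - y))\<^sup>2 = (x $ 1 - y $ 1)\<^sup>2 + (x $ 2 - y $ 2)\<^sup>2"
        unfolding power2_norm_eq_inner using 3 by (simp add: inner_vec_def sum_3 power2_eq_square)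
      ultimately show ?thesis by simp
    qed
    finally show "dist (f x) (f y) = dist x y" by (simp add: dist_norm power2_eq_iff_nonneg)
  qed
  ultimately have "hausdorff2 (parallelogram u w) = hausdorff2 ?S" by simp
  then show ?thesis
    by (simp add: area_unit_def parea_def measure_def emeasure_area_compact compact_parallelogram)
qed

text \<open>Shearing makes the second side orthogonal to the first, scaling makes both unit vectors,
  and isometry invariance leaves the single constant \<open>area_unit\<close>. The norm of the cross
  product changes in the same way.\<close>

theorem parea_eq: "parea u v = area_unit * norm (cross3 u v)"
proof (cases "u = 0")
  case True
  then show ?thesis using parea_scale[of 0 u v] by simp
next
  case False
  define s where "s = (u \<bullet> v) / (u \<bullet> u)"
  define w where "w = v - s *\<^sub>R u"
  have v: "v = w + s *\<^sub>R u" by (simp add: w_def)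
  have orth: "u \<bullet> w = 0" using False by (simp add: w_def s_def inner_diff_right)
  have cr: "cross3 u v = cross3 u w" by (simp add: v cross_add_right cross_mult_right)
  have pa: "parea u v = parea u w" unfolding v by (rule parea_shear)
  show ?thesis
  proof (cases "w = 0")
    case True
    have "parea u 0 = 0" using parea_scale[of 0 0 u] parea_commute[of u 0] by simp
    then show ?thesis using True pa cr by simp
  next
    case wne: False
    have "parea u w = norm u * parea (u /\<^sub>R norm u) w"
      using parea_scale[of "norm u" "u /\<^sub>R norm u" w] False by simp
    also have "parea (u /\<^sub>R norm u) w = norm w * parea (u /\<^sub>R norm u) (w /\<^sub>R norm w)"
      using parea_scale[of "norm w" "w /\<^sub>R norm w" "u /\<^sub>R norm u"] wne by (simp add: parea_commute)
    also have "parea (u /\<^sub>R norm u) (w /\<^sub>R norm w) = area_unit"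
      by (rule parea_orthonormal) (use False wne orth in auto)
    also have "norm u * (norm w * area_unit) = area_unit * norm (cross3 u w)"
    proof -
      have "(norm (cross3 u w))\<^sup>2 = (norm u * norm w)\<^sup>2" using norm_cross_dot[of u w] orth by simp
      then show ?thesis by (simp add: power2_eq_iff_nonneg)
    qed
    finally show ?thesis by (simp add: pa cr)
  qed
qed

section \<open>Zonotopes in a plane\<close>

lemma planar_coordinates:
  assumes "cross3 u w \<noteq> 0" "x \<bullet> cross3 u w = 0"
  shows "\<exists>a b. x = a *\<^sub>R u + b *\<^sub>R w"
proof -
  define n where "n = cross3 u w"
  \<comment> \<open>Cramer's rule for the basis \<open>u\<close>, \<open>w\<close>,
    \<open>n\<close>.\<close>
  have "(n \<bullet> n) *\<^sub>R x = (cross3 x w \<bullet> n) *\<^sub>R u + (cross3 u x \<bullet> n) *\<^sub>R w + (x \<bullet> n) *\<^sub>R n"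
    unfolding n_def vec_eq_iff forall_3
    by (simp add: cross3_def inner_vec_def sum_3) (intro conjI; algebra)
  then have "(n \<bullet> n) *\<^sub>R x = (cross3 x w \<bullet> n) *\<^sub>R u + (cross3 u x \<bullet> n) *\<^sub>R w"
    using assms(2) by (simp add: n_def)
  moreover have "x = (1 / (n \<bullet> n)) *\<^sub>R ((n \<bullet> n) *\<^sub>R x)" using assms(1) by (simp add: n_def)
  ultimately have "x = (1 / (n \<bullet> n)) *\<^sub>R ((cross3 x w \<bullet> n) *\<^sub>R u + (cross3 u x \<bullet> n) *\<^sub>R w)"
    by simp
  then have "x = ((1 / (n \<bullet> n)) * (cross3 x w \<bullet> n)) *\<^sub>R u + ((1 / (n \<bullet> n)) * (cross3 u x \<bullet> n)) *\<^sub>R w"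
    by (simp only: scaleR_add_right scaleR_scaleR)
  then show ?thesis by blast
qed

text \<open>The coordinates of its points with respect to \<open>u\<close> and \<open>w\<close> are
  bounded by \<open>R\<close>, so one large translated parallelogram contains the set.\<close>

lemma planar_parallel_sum_finite:
  fixes v :: "'i \<Rightarrow> real^3"
  assumes I: "finite I" and plane: "\<And>i. i \<in> I \<Longrightarrow> v i \<bullet> cross3 u w = 0" and n: "cross3 u w \<noteq> 0"
  shows "emeasure area_measure (parallel_sum I v t) < top"
proof -
  have "\<forall>i\<in>I. \<exists>a b. v i = a *\<^sub>R u + b *\<^sub>R w" using planar_coordinates[OF n] plane by blast
  then obtain a b where ab: "\<And>i. i \<in> I \<Longrightarrow> v i = a i *\<^sub>R u + b i *\<^sub>R w" by metis
  define R where "R = (\<Sum>i\<in>I. \<bar>t i\<bar> * (\<bar>a i\<bar> + \<bar>b i\<bar>)) + 1"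
  have R: "R > 0" unfolding R_def by (intro add_nonneg_pos sum_nonneg) auto
  let ?P = "parallelogram ((2 * R) *\<^sub>R u) ((2 * R) *\<^sub>R w)"
  have bound: "\<bar>\<Sum>i\<in>I. x i * c i\<bar> \<le> R" if x: "\<forall>i\<in>I. 0 \<le> x i \<and> x i \<le> t i" and c: "\<And>i. \<bar>c i\<bar> \<le> \<bar>a i\<bar> + \<bar>b i\<bar>" for x c
  proof -
    have "\<bar>\<Sum>i\<in>I. x i * c i\<bar> \<le> (\<Sum>i\<in>I. \<bar>x i * c i\<bar>)" by (rule sum_abs)
    also have "\<dots> \<le> (\<Sum>i\<in>I. \<bar>t i\<bar> * (\<bar>a i\<bar> + \<bar>b i\<bar>))"
      unfolding abs_mult using x c by (intro sum_mono mult_mono) auto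
    finally show ?thesis by (simp add: R_def)
  qed
  have "parallel_sum I v t \<subseteq> (+) (- R *\<^sub>R u - R *\<^sub>R w) ` ?P"
  proof
    fix z assume "z \<in> parallel_sum I v t"
    then obtain x where x: "z = (\<Sum>i\<in>I. x i *\<^sub>R v i)" "\<forall>i\<in>I. 0 \<le> x i \<and> x i \<le> t i"
      by (auto simp: parallel_sum_def)
    define A where "A = (\<Sum>i\<in>I. x i * a i)"
    define B where "B = (\<Sum>i\<in>I. x i * b i)"
    have AB: "\<bar>A\<bar> \<le> R" "\<bar>B\<bar> \<le> R" unfolding A_def B_def by (intro bound x; simp)+
    have "z = A *\<^sub>R u + B *\<^sub>R w"
      by (simp add: x(1) A_def B_def ab scaleR_add_right sum.distrib scaleR_sum_left cong: sum.cong)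
    then have "z = (- R *\<^sub>R u - R *\<^sub>R w) + (((A + R) / (2 * R)) *\<^sub>R ((2 * R) *\<^sub>R u) + ((B + R) / (2 * R)) *\<^sub>R ((2 * R) *\<^sub>R w))"
    proof -
      have "(A + R) / (2 * R) * (2 * R) = A + R" "(B + R) / (2 * R) * (2 * R) = B + R" using R by simp_all
      moreover have "z = (- R *\<^sub>R u - R *\<^sub>R w) + ((A + R) *\<^sub>R u + (B + R) *\<^sub>R w)"
        by (simp add: \<open>z = A *\<^sub>R u + B *\<^sub>R w\<close> algebra_simps)
      ultimately show ?thesis by (simp only: scaleR_scaleR)
    qed
    moreover have "((A + R) / (2 * R)) *\<^sub>R ((2 * R) *\<^sub>R u) + ((B + R) / (2 * R)) *\<^sub>R ((2 * R) *\<^sub>R w) \<in> ?P"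
    proof -
      have "0 \<le> (A + R) / (2 * R)" "(A + R) / (2 * R) \<le> 1" "0 \<le> (B + R) / (2 * R)" "(B + R) / (2 * R) \<le> 1"
        using AB R by (auto simp: abs_le_iff)
      then show ?thesis unfolding parallelogram_iff by blast
    qed
    ultimately show "z \<in> (+) (- R *\<^sub>R u - R *\<^sub>R w) ` ?P" by blast
  qed
  then have "hausdorff2 (parallel_sum I v t) \<le> hausdorff2 ((+) (- R *\<^sub>R u - R *\<^sub>R w) ` ?P)"
    by (rule hausdorff2_mono)
  also have "\<dots> < top" by (simp only: hausdorff2_translate hausdorff2_parallelogram_finite)
  finally show ?thesis using compact_parallel_sum[OF I, of v t] by (simp add: emeasure_area_compact)
qed

theorem area_planar_parallel_sum:
  fixes v :: "'i \<Rightarrow> real^3"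
  assumes I: "finite I" and plane: "\<And>i. i \<in> I \<Longrightarrow> v i \<bullet> cross3 u w = 0" and n: "cross3 u w \<noteq> 0"
    and t: "\<And>i. i \<in> I \<Longrightarrow> 0 \<le> t i"
  shows "measure area_measure (parallel_sum I v t)
    = area_unit * (\<Sum>i\<in>I. \<Sum>j\<in>I. t i * t j * norm (cross3 (v i) (v j))) / 2"
proof -
  have "measure area_measure (parallel_sum I v t)
     = (\<Sum>S | S \<subseteq> I \<and> card S = 2. measure area_measure (parallel_sum S v (\<lambda>_. 1)) * (\<Prod>i\<in>S. t i))"
  proof (rule area_tim.measure_parallel_sum[OF I])
    fix t
    show "emeasure area_measure (parallel_sum I v t) < top"
      by (rule planar_parallel_sum_finite[OF I plane n])
    have c: "compact (parallel_sum I v t)" using I by (rule compact_parallel_sum)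
    then have "compact ((*\<^sub>R) 2 ` parallel_sum I v t)" by (rule compact_scaling)
    moreover have "hausdorff2 ((*\<^sub>R) 2 ` parallel_sum I v t) = ennreal (2\<^sup>2) * hausdorff2 (parallel_sum I v t)"
      by (rule hausdorff2_similarity_image) (auto simp: dist_norm simp flip: scaleR_diff_right)
    ultimately show "measure area_measure ((*\<^sub>R) 2 ` parallel_sum I v t) = 2\<^sup>2 * measure area_measure (parallel_sum I v t)"
      using c by (simp add: measure_def emeasure_area_compact enn2real_mult)
  qed (use t in auto)
  also have "\<dots> = (\<Sum>i\<in>I. \<Sum>j\<in>I. area_unit * (t i * t j * norm (cross3 (v i) (v j)))) / 2"
  proof (rule sum_card2_subsets[OF I])
    fix i j assume "i \<in> I" "j \<in> I" "i \<noteq> j"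
    have "parallel_sum {i, j} v (\<lambda>_. 1) = parallelogram (v i) (v j)"
    proof -
      have "parallel_sum {i, j} v (\<lambda>_. 1) = extrude (extrude {0} (v j) 1) (v i) 1"
        using \<open>i \<noteq> j\<close> by (simp add: parallel_sum_insert)
      also have "extrude {0} (v j) 1 = closed_segment 0 (v j)"
        by (auto simp: extrude_iff in_segment)
      finally show ?thesis by (simp add: extrude_segment)
    qed
    then show "measure area_measure (parallel_sum {i, j} v (\<lambda>_. 1)) * (\<Prod>i\<in>{i, j}. t i)
        = area_unit * (t i * t j * norm (cross3 (v i) (v j)))"
      using \<open>i \<noteq> j\<close> parea_eq[of "v i" "v j"] by (simp add: parea_def)
  qed simp
  finally show ?thesis by (simp add: sum_distrib_left)
qed

subsection \<open>The boundary of a zonotope\<close>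

definition centred_zonotope :: "('i::finite \<Rightarrow> real^3) \<Rightarrow> (real^3) set" where
  "centred_zonotope v = {(\<Sum>i\<in>UNIV. x i *\<^sub>R v i) | x. \<forall>i. \<bar>x i\<bar> \<le> 1 / 2}"

text \<open>The support function of the zonotope: each generator contributes at most half its
  absolute inner product with \<open>a\<close>.\<close>

definition zsupport :: "('i::finite \<Rightarrow> real^3) \<Rightarrow> real^3 \<Rightarrow> real" where
  "zsupport v a = (\<Sum>i\<in>UNIV. \<bar>a \<bullet> v i\<bar>) / 2"

definition zface :: "('i::finite \<Rightarrow> real^3) \<Rightarrow> real^3 \<Rightarrow> (real^3) set" where
  "zface v a = {z \<in> centred_zonotope v. a \<bullet> z = zsupport v a}"

text \<open>The generators along which the face in direction \<open>a\<close> extends; the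
  coefficients of all others are pinned there.\<close>

definition orth_gens :: "('i::finite \<Rightarrow> real^3) \<Rightarrow> real^3 \<Rightarrow> 'i set" where
  "orth_gens v a = {i. a \<bullet> v i = 0}"

lemma centred_zonotope_translate:
  "centred_zonotope v = (+) (- (\<Sum>i\<in>UNIV. (1/2) *\<^sub>R v i)) ` parallel_sum UNIV v (\<lambda>_. 1)"
proof (intro set_eqI iffI)
  fix z assume "z \<in> centred_zonotope v"
  then obtain x where x: "z = (\<Sum>i\<in>UNIV. x i *\<^sub>R v i)" "\<forall>i. \<bar>x i\<bar> \<le> 1 / 2"
    by (auto simp: centred_zonotope_def)
  have "z = - (\<Sum>i\<in>UNIV. (1/2) *\<^sub>R v i) + (\<Sum>i\<in>UNIV. (x i + 1/2) *\<^sub>R v i)"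
    by (simp add: x scaleR_add_left sum.distrib)
  moreover have "0 \<le> x i + 1/2 \<and> x i + 1/2 \<le> 1" for i
    using x(2)[rule_format, of i] by linarith
  then have "(\<Sum>i\<in>UNIV. (x i + 1/2) *\<^sub>R v i) \<in> parallel_sum UNIV v (\<lambda>_. 1)"
    unfolding parallel_sum_def by (intro CollectI exI[of _ "\<lambda>i. x i + 1/2"]) auto
  ultimately show "z \<in> (+) (- (\<Sum>i\<in>UNIV. (1/2) *\<^sub>R v i)) ` parallel_sum UNIV v (\<lambda>_. 1)" by blast
next
  fix z assume "z \<in> (+) (- (\<Sum>i\<in>UNIV. (1/2) *\<^sub>R v i)) ` parallel_sum UNIV v (\<lambda>_. 1)"
  then obtain x where x: "z = - (\<Sum>i\<in>UNIV. (1/2) *\<^sub>R v i) + (\<Sum>i\<in>UNIV. x i *\<^sub>R v i)" "\<forall>i. 0 \<le> x i \<and> x i \<le> 1"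
    by (auto simp: parallel_sum_def)
  have "z = (\<Sum>i\<in>UNIV. (x i - 1/2) *\<^sub>R v i)"
    by (simp add: x scaleR_diff_left sum_subtractf)
  moreover have "\<bar>x i - 1/2\<bar> \<le> 1/2" for i using x(2)[rule_format, of i] by linarith
  ultimately show "z \<in> centred_zonotope v"
    unfolding centred_zonotope_def by (intro CollectI exI[of _ "\<lambda>i. x i - 1/2"]) auto
qed

lemma compact_centred_zonotope: "compact (centred_zonotope v)"
  unfolding centred_zonotope_translate by (intro compact_translation compact_parallel_sum) simp

lemma convex_centred_zonotope: "convex (centred_zonotope v)"
  unfolding centred_zonotope_translate by (intro convex_translation convex_parallel_sum)

lemma inner_lincomb: "a \<bullet> (\<Sum>i\<in>UNIV. x i *\<^sub>R v i) = (\<Sum>i\<in>UNIV. x i * (a \<bullet> v i))"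
  by (simp add: inner_sum_right)

lemma coeff_le_support: "\<bar>x\<bar> \<le> 1/2 \<Longrightarrow> x * y \<le> \<bar>y\<bar> / (2::real)"
proof -
  assume "\<bar>x\<bar> \<le> 1/2"
  then have "\<bar>x\<bar> * \<bar>y\<bar> \<le> 1/2 * \<bar>y\<bar>" by (rule mult_right_mono) simp
  then show ?thesis using abs_ge_self[of "x * y"] by (simp add: abs_mult)
qed

lemma zsupport_upper: "z \<in> centred_zonotope v \<Longrightarrow> a \<bullet> z \<le> zsupport v a"
  unfolding centred_zonotope_def zsupport_def
  by (auto simp: inner_lincomb sum_divide_distrib intro!: sum_mono coeff_le_support)

text \<open>As \<open>sgn 0 = 0\<close>, generators orthogonal to \<open>a\<close> get coefficient
  0, and the combination with these coefficients is the centre of the face.\<close>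

definition face_coeff :: "('i::finite \<Rightarrow> real^3) \<Rightarrow> real^3 \<Rightarrow> 'i \<Rightarrow> real" where
  "face_coeff v a i = sgn (a \<bullet> v i) / 2"

text \<open>\<open>zsupport v a - a \<bullet> z\<close> is a sum of nonnegative terms, one for each
  generator; it vanishes on the face, so every term does.\<close>

lemma zface_iff:
  "z \<in> zface v a \<longleftrightarrow> (\<exists>x. (\<forall>i. \<bar>x i\<bar> \<le> 1/2) \<and>
    (\<forall>i. i \<notin> orth_gens v a \<longrightarrow> x i = face_coeff v a i) \<and> z = (\<Sum>i\<in>UNIV. x i *\<^sub>R v i))" (is "_ \<longleftrightarrow> ?R")
proof
  assume z: "z \<in> zface v a"
  then obtain x where x: "\<forall>i. \<bar>x i\<bar> \<le> 1/2" "z = (\<Sum>i\<in>UNIV. x i *\<^sub>R v i)"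
    by (auto simp: zface_def centred_zonotope_def)
  have nn: "0 \<le> \<bar>a \<bullet> v i\<bar> / 2 - x i * (a \<bullet> v i)" for i using coeff_le_support x(1) by simp
  have "(\<Sum>i\<in>UNIV. \<bar>a \<bullet> v i\<bar> / 2 - x i * (a \<bullet> v i)) = 0"
    using z by (simp add: zface_def zsupport_def x(2) inner_lincomb sum_subtractf sum_divide_distrib)
  then have eq: "x i * (a \<bullet> v i) = \<bar>a \<bullet> v i\<bar> / 2" for i
    using sum_nonneg_eq_0_iff[of UNIV "\<lambda>i. \<bar>a \<bullet> v i\<bar> / 2 - x i * (a \<bullet> v i)"] nn by simp
  have "x i = face_coeff v a i" if "i \<notin> orth_gens v a" for i
  proof -
    have "a \<bullet> v i \<noteq> 0" using that by (simp add: orth_gens_def)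
    moreover have "x i * (a \<bullet> v i) = face_coeff v a i * (a \<bullet> v i)"
      using eq[of i] by (simp add: face_coeff_def abs_sgn)
    ultimately show ?thesis by simp
  qed
  then show ?R using x by blast
next
  assume ?R
  then obtain x where x: "\<forall>i. \<bar>x i\<bar> \<le> 1/2" "\<forall>i. i \<notin> orth_gens v a \<longrightarrow> x i = face_coeff v a i" "z = (\<Sum>i\<in>UNIV. x i *\<^sub>R v i)"
    by blast
  have term_eq: "x i * (a \<bullet> v i) = \<bar>a \<bullet> v i\<bar> / 2" for i
  proof (cases "i \<in> orth_gens v a")
    case False
    then show ?thesis using x(2) by (simp add: face_coeff_def abs_sgn)
  qed (simp add: orth_gens_def)
  then have "a \<bullet> z = zsupport v a" by (simp only: x(3) inner_lincomb zsupport_def sum_divide_distrib term_eq)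
  then show "z \<in> zface v a" using x by (auto simp: zface_def centred_zonotope_def)
qed

lemma zface_cong:
  assumes "\<And>i. sgn (a \<bullet> v i) = sgn (b \<bullet> v i)"
  shows "zface v a = zface v b"
proof -
  have "orth_gens v a = orth_gens v b" unfolding orth_gens_def using assms by (metis sgn_eq_0_iff)
  moreover have "face_coeff v a = face_coeff v b" by (intro ext) (simp add: face_coeff_def assms)
  ultimately show ?thesis by (intro set_eqI) (simp only: zface_iff)
qed

lemma zface_translate:
  obtains p where "zface v a = (+) p ` parallel_sum (orth_gens v a) v (\<lambda>_. 1)"
proof -
  let ?I = "orth_gens v a"
  define p where "p = (\<Sum>i\<in>UNIV. (if i \<in> ?I then - (1/2) else face_coeff v a i) *\<^sub>R v i)"
  have split: "p + (\<Sum>i\<in>?I. x i *\<^sub>R v i) = (\<Sum>i\<in>UNIV. (if i \<in> ?I then x i - 1/2 else face_coeff v a i) *\<^sub>R v i)" for x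
  proof -
    have "(\<Sum>i\<in>?I. x i *\<^sub>R v i) = (\<Sum>i\<in>UNIV. (if i \<in> ?I then x i else 0) *\<^sub>R v i)"
      by (rule sum.mono_neutral_cong_left) auto
    then have "p + (\<Sum>i\<in>?I. x i *\<^sub>R v i) = (\<Sum>i\<in>UNIV. (if i \<in> ?I then - (1/2) else face_coeff v a i) *\<^sub>R v i
        + (if i \<in> ?I then x i else 0) *\<^sub>R v i)"
      by (simp add: p_def sum.distrib)
    also have "\<dots> = (\<Sum>i\<in>UNIV. (if i \<in> ?I then x i - 1/2 else face_coeff v a i) *\<^sub>R v i)"
      by (rule sum.cong) (auto simp: scaleR_diff_left)
    finally show ?thesis .
  qed
  have fc: "\<bar>face_coeff v a i\<bar> \<le> 1/2" for i by (auto simp: face_coeff_def sgn_if)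
  have "zface v a = (+) p ` parallel_sum ?I v (\<lambda>_. 1)"
  proof (intro set_eqI iffI)
    fix z assume "z \<in> zface v a"
    then obtain x where x: "\<forall>i. \<bar>x i\<bar> \<le> 1/2" "\<forall>i. i \<notin> ?I \<longrightarrow> x i = face_coeff v a i" "z = (\<Sum>i\<in>UNIV. x i *\<^sub>R v i)"
      unfolding zface_iff by blast
    have "z = p + (\<Sum>i\<in>?I. (x i + 1/2) *\<^sub>R v i)"
      unfolding split x(3) using x(2) by (intro sum.cong) auto
    moreover have "0 \<le> x i + 1/2 \<and> x i + 1/2 \<le> 1" for i using x(1)[rule_format, of i] by linarith
    then have "(\<Sum>i\<in>?I. (x i + 1/2) *\<^sub>R v i) \<in> parallel_sum ?I v (\<lambda>_. 1)"
      unfolding parallel_sum_def by (intro CollectI exI[of _ "\<lambda>i. x i + 1/2"]) auto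
    ultimately show "z \<in> (+) p ` parallel_sum ?I v (\<lambda>_. 1)" by blast
  next
    fix z assume "z \<in> (+) p ` parallel_sum ?I v (\<lambda>_. 1)"
    then obtain x where x: "z = p + (\<Sum>i\<in>?I. x i *\<^sub>R v i)" "\<forall>i\<in>?I. 0 \<le> x i \<and> x i \<le> 1"
      by (auto simp: parallel_sum_def)
    let ?y = "\<lambda>i. if i \<in> ?I then x i - 1/2 else face_coeff v a i"
    have "\<bar>?y i\<bar> \<le> 1/2" for i
    proof (cases "i \<in> ?I")
      case True
      then have "0 \<le> x i" "x i \<le> 1" using x(2) by auto
      then have "\<bar>x i - 1/2\<bar> \<le> 1/2" by linarith
      then show ?thesis using True by simp
    qed (use fc in simp)
    moreover have "z = (\<Sum>i\<in>UNIV. ?y i *\<^sub>R v i)" unfolding x(1) by (rule split)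
    ultimately show "z \<in> zface v a" unfolding zface_iff by (intro exI[of _ ?y]) auto
  qed
  then show ?thesis by (rule that)
qed

lemma compact_zface: "compact (zface v a)"
proof -
  obtain p where "zface v a = (+) p ` parallel_sum (orth_gens v a) v (\<lambda>_. 1)" by (rule zface_translate)
  then show ?thesis by (simp add: compact_translation compact_parallel_sum)
qed

lemma hausdorff2_zface: "hausdorff2 (zface v a) = hausdorff2 (parallel_sum (orth_gens v a) v (\<lambda>_. 1))"
proof -
  obtain p where "zface v a = (+) p ` parallel_sum (orth_gens v a) v (\<lambda>_. 1)" by (rule zface_translate)
  then show ?thesis by (simp only: hausdorff2_translate)
qed

text \<open>A face depends only on the signs of the \<open>a \<bullet> v i\<close>. This turns a
  union over the uncountable unit sphere into a finite one, so that null faces can be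
  discarded.\<close>

lemma finite_zfaces: "finite (range (zface v))"
proof -
  let ?P = "PiE UNIV (\<lambda>_::'a. {-1, 0, 1 :: real})"
  have "\<exists>g. \<forall>a. zface v a = g (\<lambda>i. sgn (a \<bullet> v i))"
  proof (intro exI allI)
    fix a
    \<comment> \<open>One representative direction for each sign pattern.\<close>
    let ?b = "SOME b. (\<lambda>i. sgn (b \<bullet> v i)) = (\<lambda>i. sgn (a \<bullet> v i))"
    have "(\<lambda>i. sgn (?b \<bullet> v i)) = (\<lambda>i. sgn (a \<bullet> v i))" by (rule someI[of _ a]) simp
    then have "zface v ?b = zface v a" by (intro zface_cong) (auto dest: fun_cong)
    then show "zface v a = (\<lambda>s. zface v (SOME b. (\<lambda>i. sgn (b \<bullet> v i)) = s)) (\<lambda>i. sgn (a \<bullet> v i))" by simp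
  qed
  then obtain g where g: "\<And>a. zface v a = g (\<lambda>i. sgn (a \<bullet> v i))" by blast
  have "range (zface v) \<subseteq> g ` ?P" unfolding g by (auto simp: PiE_def sgn_if)
  moreover have "finite (g ` ?P)" by (intro finite_imageI finite_PiE) auto
  ultimately show ?thesis by (rule finite_subset)
qed

text \<open>A supporting plane passes through every boundary point. Conversely, a point attaining
  the support function in a unit direction cannot move further that way inside the body.\<close>

lemma frontier_centred_zonotope:
  "frontier (centred_zonotope v) = (\<Union>a\<in>sphere 0 1. zface v a)"
proof (intro equalityI subsetI)
  fix x assume x: "x \<in> frontier (centred_zonotope v)"
  have cl: "closed (centred_zonotope v)" by (rule compact_imp_closed[OF compact_centred_zonotope])
  then have xin: "x \<in> centred_zonotope v" and xni: "x \<notin> interior (centred_zonotope v)"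
    using x by (auto simp: frontier_def)
  obtain a where a: "a \<noteq> 0" "\<And>y. y \<in> centred_zonotope v \<Longrightarrow> a \<bullet> x \<le> a \<bullet> y"
  \<comment> \<open>A zonotope without interior lies in a hyperplane, on which the functional is
    constant.\<close>
  proof (cases "interior (centred_zonotope v) = {}")
    case True
    then obtain a b where "a \<noteq> 0" "centred_zonotope v \<subseteq> {x. a \<bullet> x = b}"
      using empty_interior_subset_hyperplane[OF convex_centred_zonotope] by blast
    then have "a \<bullet> y = b" if "y \<in> centred_zonotope v" for y using that by blast
    then show ?thesis using xin \<open>a \<noteq> 0\<close> by (intro that[of a]) simp_all
  next
    case False
    then have "x \<notin> rel_interior (centred_zonotope v)" using xni by (simp add: rel_interior_nonempty_interior)
    then show ?thesis using supporting_hyperplane_rel_boundary[OF convex_centred_zonotope xin] that by metis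
  qed
  \<comment> \<open>The functional \<open>a\<close> is minimal at \<open>x\<close>; the sign change
    makes it maximal, as in \<open>zface\<close>.\<close>
  define b where "b = - (a /\<^sub>R norm a)"
  have b: "norm b = 1" using a(1) by (simp add: b_def)
  have bx: "b \<bullet> y \<le> b \<bullet> x" if "y \<in> centred_zonotope v" for y
    using a(2)[OF that] a(1) by (simp add: b_def mult_left_mono)
  let ?y = "\<Sum>i\<in>UNIV. face_coeff v b i *\<^sub>R v i"
  have "?y \<in> zface v b" unfolding zface_iff
    by (intro exI[of _ "face_coeff v b"]) (auto simp: face_coeff_def sgn_if)
  then have "?y \<in> centred_zonotope v" "b \<bullet> ?y = zsupport v b" by (auto simp: zface_def)
  then have "b \<bullet> x = zsupport v b" using bx[of ?y] zsupport_upper[OF xin, of b] by linarith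
  then have "x \<in> zface v b" using xin by (simp add: zface_def)
  then show "x \<in> (\<Union>a\<in>sphere 0 1. zface v a)" using b by (auto intro!: bexI[of _ b])
next
  fix x assume "x \<in> (\<Union>a\<in>sphere 0 1. zface v a)"
  then obtain a where a: "norm a = 1" "x \<in> centred_zonotope v" "a \<bullet> x = zsupport v a"
    by (auto simp: zface_def)
  have "x \<notin> interior (centred_zonotope v)"
  proof
    assume "x \<in> interior (centred_zonotope v)"
    then obtain e where e: "e > 0" "cball x e \<subseteq> centred_zonotope v" by (auto simp: mem_interior_cball)
    have "x + e *\<^sub>R a \<in> centred_zonotope v" using e a(1) by (intro subsetD[OF e(2)]) (simp add: dist_norm)
    then have "a \<bullet> (x + e *\<^sub>R a) \<le> zsupport v a" by (rule zsupport_upper)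
    moreover have "a \<bullet> (x + e *\<^sub>R a) = zsupport v a + e"
      using a by (simp add: inner_add_right dot_square_norm)
    ultimately show False using e(1) by simp
  qed
  then show "x \<in> frontier (centred_zonotope v)"
    using a(2) closure_subset[of "centred_zonotope v"] by (auto simp: frontier_def)
qed

section \<open>Null faces, facets and their normals\<close>

lemma hausdorff2_subset_line:
  fixes m z :: "'a::real_normed_vector"
  assumes "S \<subseteq> (\<lambda>k. z + k *\<^sub>R m) ` {-R..R}" "0 \<le> R"
  shows "hausdorff2 S = 0"
proof -
  have "hausdorff2 {-R..R} = 0"
    using hausdorff2_segment[of "-R" R] assms(2) by (simp add: closed_segment_eq_real_ivl)
  moreover have "hausdorff2 ((\<lambda>k. z + k *\<^sub>R m) ` {-R..R}) \<le> ennreal ((norm m + 1)\<^sup>2) * hausdorff2 {-R..R}"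
  proof (rule hausdorff2_lipschitz_image_le)
    show "dist (z + x *\<^sub>R m) (z + y *\<^sub>R m) \<le> (norm m + 1) * dist x y" for x y
      by (simp add: dist_norm algebra_simps flip: scaleR_diff_left)
  qed (simp add: add_nonneg_pos)
  ultimately show ?thesis using hausdorff2_mono[OF assms(1)] by simp
qed

lemma cross_zero_multiple:
  assumes "u \<noteq> 0" "cross3 x u = 0"
  shows "x = ((x \<bullet> u) / (u \<bullet> u)) *\<^sub>R u"
proof -
  have "(u \<bullet> u) *\<^sub>R x = (x \<bullet> u) *\<^sub>R u"
    using Lagrange[of u x u] assms(2) by (simp add: inner_commute)
  then have "(1 / (u \<bullet> u)) *\<^sub>R ((u \<bullet> u) *\<^sub>R x) = (1 / (u \<bullet> u)) *\<^sub>R ((x \<bullet> u) *\<^sub>R u)" by simp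
  then show ?thesis using assms(1) by simp
qed

lemma perp_both_multiple:
  assumes "cross3 u w \<noteq> 0" "a \<bullet> u = 0" "a \<bullet> w = 0"
  shows "a = ((a \<bullet> cross3 u w) / (cross3 u w \<bullet> cross3 u w)) *\<^sub>R cross3 u w"
  by (rule cross_zero_multiple[OF assms(1)]) (simp add: Lagrange assms)

text \<open>With pairwise parallel generators the face is a point or a segment.\<close>

lemma hausdorff2_degenerate_face:
  assumes "\<And>i j. i \<in> orth_gens v a \<Longrightarrow> j \<in> orth_gens v a \<Longrightarrow> cross3 (v i) (v j) = 0"
  shows "hausdorff2 (zface v a) = 0"
proof -
  let ?I = "orth_gens v a"
  obtain u c where u: "\<And>i. i \<in> ?I \<Longrightarrow> v i = c i *\<^sub>R u"
  proof (cases "\<exists>j\<in>?I. v j \<noteq> 0")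
    case True
    then obtain j where j: "j \<in> ?I" "v j \<noteq> 0" by blast
    then show ?thesis using assms cross_zero_multiple[of "v j"]
      by (intro that[of "\<lambda>i. (v i \<bullet> v j) / (v j \<bullet> v j)" "v j"]) auto
  next
    case False
    then show ?thesis by (intro that[of "\<lambda>_. 0" 0]) auto
  qed
  define R where "R = (\<Sum>i\<in>?I. \<bar>c i\<bar>)"
  have "parallel_sum ?I v (\<lambda>_. 1) \<subseteq> (\<lambda>k. 0 + k *\<^sub>R u) ` {-R..R}"
  proof
    fix z assume "z \<in> parallel_sum ?I v (\<lambda>_. 1)"
    then obtain x where x: "z = (\<Sum>i\<in>?I. x i *\<^sub>R v i)" "\<forall>i\<in>?I. 0 \<le> x i \<and> x i \<le> 1"
      by (auto simp: parallel_sum_def)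
    have "z = (\<Sum>i\<in>?I. x i * c i) *\<^sub>R u" by (simp add: x(1) u scaleR_sum_left cong: sum.cong)
    moreover have "\<bar>\<Sum>i\<in>?I. x i * c i\<bar> \<le> R"
    proof -
      have "\<bar>\<Sum>i\<in>?I. x i * c i\<bar> \<le> (\<Sum>i\<in>?I. \<bar>x i * c i\<bar>)" by (rule sum_abs)
      also have "\<dots> \<le> (\<Sum>i\<in>?I. 1 * \<bar>c i\<bar>)"
        unfolding abs_mult using x(2) by (intro sum_mono mult_right_mono) auto
      finally show ?thesis by (simp add: R_def)
    qed
    ultimately show "z \<in> (\<lambda>k. 0 + k *\<^sub>R u) ` {-R..R}" by (auto simp: abs_le_iff)
  qed
  then show ?thesis unfolding hausdorff2_zface
    by (rule hausdorff2_subset_line) (simp add: R_def sum_nonneg)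
qed

text \<open>Two independent generators make the face two-dimensional, and unit length picks one
  vector on each normal ray.\<close>

definition facet_normals :: "('i::finite \<Rightarrow> real^3) \<Rightarrow> (real^3) set" where
  "facet_normals v = {a. norm a = 1 \<and> (\<exists>i\<in>orth_gens v a. \<exists>j\<in>orth_gens v a. cross3 (v i) (v j) \<noteq> 0)}"

lemma unit_normals:
  assumes "cross3 u w \<noteq> 0"
  shows "{a. norm a = 1 \<and> a \<bullet> u = 0 \<and> a \<bullet> w = 0} =
    {cross3 u w /\<^sub>R norm (cross3 u w), - (cross3 u w /\<^sub>R norm (cross3 u w))}"
proof (intro equalityI subsetI)
  fix a assume "a \<in> {a. norm a = 1 \<and> a \<bullet> u = 0 \<and> a \<bullet> w = 0}"
  then have a: "norm a = 1" "a \<bullet> u = 0" "a \<bullet> w = 0" by auto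
  obtain k where k: "a = k *\<^sub>R cross3 u w" using perp_both_multiple[OF assms a(2,3)] by blast
  then have "\<bar>k\<bar> * norm (cross3 u w) = 1" using a(1) by simp
  then have "\<bar>k\<bar> = inverse (norm (cross3 u w))" using assms by (simp add: field_simps)
  then have "k = inverse (norm (cross3 u w)) \<or> k = - inverse (norm (cross3 u w))" by linarith
  then show "a \<in> {cross3 u w /\<^sub>R norm (cross3 u w), - (cross3 u w /\<^sub>R norm (cross3 u w))}"
    using k by auto
qed (use assms in \<open>auto simp: dot_cross_self inner_commute[of _ u] inner_commute[of _ w]\<close>)

lemma finite_facet_normals: "finite (facet_normals v)"
proof -
  let ?N = "\<lambda>i j. {a. norm a = 1 \<and> a \<bullet> v i = 0 \<and> a \<bullet> v j = 0}"
  have "facet_normals v \<subseteq> (\<Union>(i, j)\<in>{(i, j). cross3 (v i) (v j) \<noteq> 0}. ?N i j)"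
    by (auto simp: facet_normals_def orth_gens_def)
  moreover have "finite (\<Union>(i, j)\<in>{(i, j). cross3 (v i) (v j) \<noteq> 0}. ?N i j)"
    by (rule finite_UN_I) (auto simp: unit_normals)
  ultimately show ?thesis by (rule finite_subset)
qed

lemma facet_plane:
  assumes "a \<in> facet_normals v"
  obtains u w where "cross3 u w \<noteq> 0" "\<And>i. i \<in> orth_gens v a \<Longrightarrow> v i \<bullet> cross3 u w = 0"
proof -
  obtain i j where ij: "a \<bullet> v i = 0" "a \<bullet> v j = 0" "cross3 (v i) (v j) \<noteq> 0" and a: "norm a = 1"
    using assms by (auto simp: facet_normals_def orth_gens_def)
  obtain k where k: "a = k *\<^sub>R cross3 (v i) (v j)" using perp_both_multiple[OF ij(3,1,2)] by blast
  then have "k \<noteq> 0" using a by auto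
  show ?thesis
  proof (rule that[OF ij(3)])
    fix l assume "l \<in> orth_gens v a"
    then have "k * (cross3 (v i) (v j) \<bullet> v l) = 0" by (simp add: orth_gens_def k)
    then show "v l \<bullet> cross3 (v i) (v j) = 0" using \<open>k \<noteq> 0\<close> by (simp add: inner_commute)
  qed
qed

lemma emeasure_zface_finite:
  assumes "a \<in> facet_normals v"
  shows "emeasure area_measure (zface v a) < top"
proof -
  obtain u w where "cross3 u w \<noteq> 0" "\<And>i. i \<in> orth_gens v a \<Longrightarrow> v i \<bullet> cross3 u w = 0"
    using facet_plane[OF assms] by metis
  then have "emeasure area_measure (parallel_sum (orth_gens v a) v (\<lambda>_. 1)) < top"
    by (intro planar_parallel_sum_finite) auto
  then show ?thesis
    by (simp add: emeasure_area_compact compact_zface hausdorff2_zface compact_parallel_sum)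
qed

lemma measure_zface:
  assumes "a \<in> facet_normals v"
  shows "measure area_measure (zface v a) =
    area_unit * (\<Sum>i\<in>orth_gens v a. \<Sum>j\<in>orth_gens v a. norm (cross3 (v i) (v j))) / 2"
proof -
  obtain u w where "cross3 u w \<noteq> 0" "\<And>i. i \<in> orth_gens v a \<Longrightarrow> v i \<bullet> cross3 u w = 0"
    using facet_plane[OF assms] by metis
  then have "measure area_measure (parallel_sum (orth_gens v a) v (\<lambda>_. 1)) =
    area_unit * (\<Sum>i\<in>orth_gens v a. \<Sum>j\<in>orth_gens v a. 1 * 1 * norm (cross3 (v i) (v j))) / 2"
    by (intro area_planar_parallel_sum) auto
  then show ?thesis
    by (simp add: measure_def emeasure_area_compact compact_zface hausdorff2_zface compact_parallel_sum)
qed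

text \<open>Different unit normals are either independent, and then the faces meet in a bounded
  piece of a line, or opposite. Opposite faces meet only if \<open>zsupport v a\<close> vanishes,
  which would put all generators into one plane.\<close>

lemma hausdorff2_zface_Int:
  assumes a: "norm a = 1" and b: "norm b = 1" and ab: "a \<noteq> b"
    and spanning: "\<And>a. (\<And>i. a \<bullet> v i = 0) \<Longrightarrow> a = 0"
  shows "hausdorff2 (zface v a \<inter> zface v b) = 0"
proof (cases "zface v a \<inter> zface v b = {}")
  case False
  then obtain z where z: "z \<in> zface v a" "z \<in> zface v b" by blast
  define m where "m = cross3 a b"
  have m: "m \<noteq> 0"
  proof
    assume "m = 0"
    then have "cross3 b a = 0" by (metis m_def cross_skew neg_equal_0_iff_equal)
    moreover have "a \<noteq> 0" using a by auto
    ultimately obtain k where k: "b = k *\<^sub>R a" using cross_zero_multiple by blast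
    then have "\<bar>k\<bar> = 1" using a b by simp
    then have "k = - 1" using k ab by (auto simp: abs_if split: if_splits)
    then have "b = - a" using k by simp
    then have "- (a \<bullet> z) = zsupport v b" "a \<bullet> z = zsupport v a" "zsupport v b = zsupport v a"
      using z by (auto simp: zface_def zsupport_def)
    then have "zsupport v a = 0" by simp
    then have "\<bar>a \<bullet> v i\<bar> = 0" for i
      using sum_nonneg_eq_0_iff[of UNIV "\<lambda>i. \<bar>a \<bullet> v i\<bar>"] by (simp add: zsupport_def)
    then show False using spanning[of a] a by auto
  qed
  obtain B where B: "\<And>x. x \<in> centred_zonotope v \<Longrightarrow> norm x \<le> B"
    using compact_imp_bounded[OF compact_centred_zonotope, of v] unfolding bounded_iff by blast
  define R where "R = 2 * B / norm m"
  have "norm z \<le> B" using B[of z] z by (simp add: zface_def)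
  then have "0 \<le> B" by (rule order_trans[OF norm_ge_zero])
  have "zface v a \<inter> zface v b \<subseteq> (\<lambda>k. z + k *\<^sub>R m) ` {-R..R}"
  proof
    fix x assume x: "x \<in> zface v a \<inter> zface v b"
    then have "(x - z) \<bullet> a = 0" "(x - z) \<bullet> b = 0"
      using z by (auto simp: zface_def inner_diff_left inner_diff_right inner_commute)
    then obtain k where k: "x - z = k *\<^sub>R m" using perp_both_multiple[of a b "x - z"] m unfolding m_def by blast
    have "\<bar>k\<bar> * norm m = norm (x - z)" by (simp add: k)
    also have "\<dots> \<le> norm x + norm z" by (rule norm_triangle_ineq4)
    also have "\<dots> \<le> 2 * B" using B[of x] B[of z] x z by (simp add: zface_def)
    finally have "\<bar>k\<bar> \<le> R" using m by (simp add: R_def field_simps)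
    then show "x \<in> (\<lambda>k. z + k *\<^sub>R m) ` {-R..R}"
      using k by (intro image_eqI[of _ _ k]) (auto simp: algebra_simps)
  qed
  then show ?thesis by (rule hausdorff2_subset_line) (simp add: R_def \<open>0 \<le> B\<close>)
qed simp

text \<open>A facet has half the sum over ordered pairs of its generators as area, and an
  independent pair occurs in two opposite facets, so the factors cancel. Spanning excludes flat
  zonotopes, whose two sides would be the same set.\<close>

theorem boundary_area_centred_zonotope:
  fixes v :: "'i::finite \<Rightarrow> real^3"
  assumes spanning: "\<And>a. (\<And>i. a \<bullet> v i = 0) \<Longrightarrow> a = 0"
  shows "boundary_area (centred_zonotope v) = area_unit * (\<Sum>i\<in>UNIV. \<Sum>j\<in>UNIV. norm (cross3 (v i) (v j)))"
proof -
  let ?N = "facet_normals v"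
  let ?t = "\<lambda>a i j. if a \<bullet> v i = 0 \<and> a \<bullet> v j = 0 then norm (cross3 (v i) (v j)) else 0"
  let ?F = "\<Union>a\<in>?N. zface v a"
  let ?E = "\<Union>a\<in>sphere 0 1 - ?N. zface v a"
  have fr: "frontier (centred_zonotope v) = ?F \<union> ?E"
    unfolding frontier_centred_zonotope by (auto simp: facet_normals_def)
  have Eset: "?E \<in> null_sets area_measure"
  proof -
    have "finite (zface v ` (sphere 0 1 - ?N))" by (rule finite_subset[OF _ finite_zfaces]) auto
    moreover have "S \<in> null_sets area_measure" if S: "S \<in> zface v ` (sphere 0 1 - ?N)" for S
    proof -
      obtain a where a: "S = zface v a" "norm a = 1" "a \<notin> ?N" using S by auto
      then have "hausdorff2 S = 0"
        by (auto intro!: hausdorff2_degenerate_face simp: facet_normals_def)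
      then show ?thesis using a(1) by (auto simp: null_sets_def emeasure_area_compact compact_zface borel_compact)
    qed
    ultimately have "(\<Union>S\<in>zface v ` (sphere 0 1 - ?N). S) \<in> null_sets area_measure"
      by (intro null_sets_UN' countable_finite)
    then show ?thesis by simp
  qed
  have Fset: "?F \<in> sets area_measure"
    using finite_facet_normals by (intro sets.finite_UN) (auto simp: borel_compact compact_zface)
  have "measure area_measure ?F = (\<Sum>a\<in>?N. measure area_measure (zface v a))"
  proof (rule measure_UNION_AE[OF finite_facet_normals])
    fix a assume "a \<in> ?N"
    then show "zface v a \<in> fmeasurable area_measure"
      by (intro fmeasurableI) (auto simp: borel_compact compact_zface emeasure_zface_finite)
  next
    show "pairwise (\<lambda>a b. AE x in area_measure. x \<notin> zface v a \<or> x \<notin> zface v b) ?N"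
    proof (rule pairwiseI)
      fix a b assume ab: "a \<in> ?N" "b \<in> ?N" "a \<noteq> b"
      have c: "compact (zface v a \<inter> zface v b)" by (intro compact_Int compact_zface)
      have "hausdorff2 (zface v a \<inter> zface v b) = 0"
        using ab spanning by (intro hausdorff2_zface_Int) (auto simp: facet_normals_def)
      then have "zface v a \<inter> zface v b \<in> null_sets area_measure"
        using c by (auto simp: null_sets_def emeasure_area_compact borel_compact)
      then have "AE x in area_measure. x \<notin> zface v a \<inter> zface v b" by (rule AE_not_in)
      then show "AE x in area_measure. x \<notin> zface v a \<or> x \<notin> zface v b" by simp
    qed
  qed
  also have "\<dots> = (\<Sum>a\<in>?N. area_unit / 2 * (\<Sum>i\<in>UNIV. \<Sum>j\<in>UNIV.
      ?t a i j))"
  proof (rule sum.cong[OF refl])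
    fix a assume a: "a \<in> ?N"
    have "(\<Sum>i\<in>orth_gens v a. \<Sum>j\<in>orth_gens v a. norm (cross3 (v i) (v j)))
      = (\<Sum>i\<in>UNIV. \<Sum>j\<in>UNIV. ?t a i j)"
      unfolding sum.cartesian_product
      by (rule sum.mono_neutral_cong_left) (auto simp: orth_gens_def split: if_splits)
    then show "measure area_measure (zface v a) = area_unit / 2 * (\<Sum>i\<in>UNIV. \<Sum>j\<in>UNIV.
      ?t a i j)"
      using measure_zface[OF a] by simp
  qed
  also have "\<dots> = area_unit / 2 * (\<Sum>i\<in>UNIV. \<Sum>j\<in>UNIV. \<Sum>a\<in>?N.
      ?t a i j)"
    unfolding sum_distrib_left[symmetric]
    by (subst sum.swap, rule arg_cong[where f = "\<lambda>x. _ * x"], rule sum.cong[OF refl], rule sum.swap)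
  \<comment> \<open>For a fixed independent pair the inner sum counts the two unit normals of the
    plane it spans.\<close>
  also have "\<dots> = area_unit / 2 * (\<Sum>i\<in>UNIV. \<Sum>j\<in>UNIV. 2 * norm (cross3 (v i) (v j)))"
  proof (intro arg_cong[where f = "\<lambda>x. _ * x"] sum.cong[OF refl])
    fix i j
    let ?A = "{a. norm a = 1 \<and> a \<bullet> v i = 0 \<and> a \<bullet> v j = 0}"
    show "(\<Sum>a\<in>?N. ?t a i j)
       = 2 * norm (cross3 (v i) (v j))"
    proof (cases "cross3 (v i) (v j) = 0")
      case True then show ?thesis by (simp add: if_distrib cong: if_cong)
    next
      case False
      have "(\<Sum>a\<in>?N. ?t a i j)
        = (\<Sum>a\<in>?A. norm (cross3 (v i) (v j)))"
        using finite_facet_normals[of v] False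
        by (intro sum.mono_neutral_cong_right) (auto simp: facet_normals_def orth_gens_def)
      also have "\<dots> = 2 * norm (cross3 (v i) (v j))"
      proof -
        let ?n = "cross3 (v i) (v j) /\<^sub>R norm (cross3 (v i) (v j))"
        have "?n \<noteq> - ?n"
        proof
          assume "?n = - ?n"
          then have "?n + ?n = 0" by (metis add.right_inverse)
          then have "2 *\<^sub>R ?n = 0" by (simp only: scaleR_2)
          then show False using False by simp
        qed
        then have "card ?A = 2" unfolding unit_normals[OF False] card_2_iff
          by (intro exI[of _ ?n] exI[of _ "- ?n"] conjI refl)
        then show ?thesis by simp
      qed
      finally show ?thesis .
    qed
  qed
  also have "\<dots> = area_unit * (\<Sum>i\<in>UNIV. \<Sum>j\<in>UNIV. norm (cross3 (v i) (v j)))"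
    by (simp add: sum_distrib_left[symmetric])
  finally have "measure area_measure ?F = area_unit * (\<Sum>i\<in>UNIV. \<Sum>j\<in>UNIV. norm (cross3 (v i) (v j)))" .
  moreover have "measure area_measure (?F \<union> ?E) = measure area_measure ?F"
    by (rule measure_Un_null_set[OF Fset Eset])
  moreover have "boundary_area (centred_zonotope v) = measure area_measure (frontier (centred_zonotope v))"
    unfolding boundary_area_def measure_def
    by (subst emeasure_hausdorff2_borel) (auto simp: borel_closed)
  ultimately show ?thesis using fr by simp
qed

theorem volume_centred_zonotope:
  fixes v :: "'i::finite \<Rightarrow> real^3"
  shows "measure lebesgue (centred_zonotope v)
    = (\<Sum>i\<in>UNIV. \<Sum>j\<in>UNIV. \<Sum>k\<in>UNIV. \<bar>triple_product (v i) (v j) (v k)\<bar>) / 6"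
proof -
  have "measure lebesgue (centred_zonotope v) = measure lebesgue (parallel_sum UNIV v (\<lambda>_. 1))"
    unfolding centred_zonotope_translate by (rule measure_translation)
  also have "\<dots> = measure lborel (parallel_sum UNIV v (\<lambda>_. 1))"
    by (intro measure_completion) (simp add: borel_compact compact_parallel_sum)
  also have "\<dots> = (\<Sum>i\<in>UNIV. \<Sum>j\<in>UNIV. \<Sum>k\<in>UNIV. 1 * 1 * 1 * \<bar>triple_product (v i) (v j) (v k)\<bar>) / 6"
    by (rule volume_parallel_sum) simp
  finally show ?thesis by simp
qed

subsection \<open>Second-order jets\<close>

text \<open>The first and second derivatives of \<open>f\<close> at the origin, the latter as a quadratic form,
  are only recorded on \<open>V\<close>, although \<open>f\<close> is differentiable in all directions.\<close>

definition jet_via :: "'a::real_normed_vector set \<Rightarrow> ('a \<Rightarrow> real) \<Rightarrow> real \<Rightarrow> ('a \<Rightarrow> real) \<Rightarrow> ('a \<Rightarrow> real)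
    \<Rightarrow> ('a \<Rightarrow> 'a \<Rightarrow>\<^sub>L real) \<Rightarrow> ('a \<Rightarrow> 'a \<Rightarrow>\<^sub>L real) \<Rightarrow> bool" where
  "jet_via V f c D Q f' H \<longleftrightarrow> f 0 = c \<and>
    (\<forall>\<^sub>F y in nhds 0. (f has_derivative blinfun_apply (f' y)) (at y)) \<and> (f' has_derivative H) (at 0) \<and>
    (\<forall>h\<in>V. blinfun_apply (f' 0) h = D h \<and> blinfun_apply (H h) h = Q h)"

definition jet :: "'a::real_normed_vector set \<Rightarrow> ('a \<Rightarrow> real) \<Rightarrow> real \<Rightarrow> ('a \<Rightarrow> real) \<Rightarrow> ('a \<Rightarrow> real) \<Rightarrow> bool" where
  "jet V f c D Q \<longleftrightarrow> (\<exists>f' H. jet_via V f c D Q f' H)"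

lemma jetI:
  assumes "f 0 = c" "\<forall>\<^sub>F y in nhds 0. (f has_derivative blinfun_apply (f' y)) (at y)"
    "(f' has_derivative H) (at 0)"
    "\<And>h. h \<in> V \<Longrightarrow> blinfun_apply (f' 0) h = D h" "\<And>h. h \<in> V \<Longrightarrow> blinfun_apply (H h) h = Q h"
  shows "jet V f c D Q"
  unfolding jet_def jet_via_def using assms by blast

lemma jet_viaD:
  assumes "jet_via V f c D Q f' H"
  shows "f 0 = c" "\<forall>\<^sub>F y in nhds 0. (f has_derivative blinfun_apply (f' y)) (at y)"
    "(f' has_derivative H) (at 0)" "(f has_derivative blinfun_apply (f' 0)) (at 0)"
    "\<And>h. h \<in> V \<Longrightarrow> blinfun_apply (f' 0) h = D h" "\<And>h. h \<in> V \<Longrightarrow> blinfun_apply (H h) h = Q h"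
  using assms eventually_nhds_x_imp_x unfolding jet_via_def by blast+

lemma jet_cong:
  assumes "jet V f c D Q" "c = c'" "\<And>h. h \<in> V \<Longrightarrow> D h = D' h" "\<And>h. h \<in> V \<Longrightarrow> Q h = Q' h"
  shows "jet V f c' D' Q'"
  using assms unfolding jet_def jet_via_def by simp

lemma jet_transform:
  assumes f: "jet V f c D Q" and fg: "\<forall>\<^sub>F x in nhds 0. f x = g x"
  shows "jet V g c D Q"
proof -
  obtain f' F where "jet_via V f c D Q f' F" using f unfolding jet_def by blast
  note f = jet_viaD[OF this]
  obtain S where S: "open S" "0 \<in> S" "\<And>x. x \<in> S \<Longrightarrow> f x = g x" using fg unfolding eventually_nhds by blast
  show ?thesis
  proof (rule jetI[OF _ _ f(3)])
    show "g 0 = c" using S f(1) by simp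
    show "\<forall>\<^sub>F y in nhds 0. (g has_derivative blinfun_apply (f' y)) (at y)"
      using f(2) eventually_nhds_in_open[OF S(1,2)]
      by eventually_elim (rule has_derivative_transform_within_open[OF _ S(1) _ S(3)])
  qed (use f in auto)
qed

lemma jet_const: "jet V (\<lambda>_. c) c (\<lambda>_. 0) (\<lambda>_. 0)"
  by (rule jetI[where f' = "\<lambda>_. 0" and H = "\<lambda>_. 0"]) (auto simp: zero_blinfun.rep_eq)

lemma jet_linear:
  assumes "bounded_linear f"
  shows "jet V f 0 f (\<lambda>_. 0)"
proof (rule jetI[where f' = "\<lambda>_. Blinfun f" and H = "\<lambda>_. 0"])
  show "f 0 = 0" by (rule linear_0[OF bounded_linear.linear[OF assms]])
qed (use assms in \<open>auto simp: bounded_linear_Blinfun_apply bounded_linear_imp_has_derivative zero_blinfun.rep_eq\<close>)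

lemma jet_add:
  assumes "jet V f a D Q" "jet V g b E R"
  shows "jet V (\<lambda>x. f x + g x) (a + b) (\<lambda>h. D h + E h) (\<lambda>h. Q h + R h)"
proof -
  obtain f' F where "jet_via V f a D Q f' F" using assms(1) unfolding jet_def by blast
  note f = jet_viaD[OF this]
  obtain g' G where "jet_via V g b E R g' G" using assms(2) unfolding jet_def by blast
  note g = jet_viaD[OF this]
  show ?thesis
  proof (rule jetI[where f' = "\<lambda>y. f' y + g' y"])
    show "\<forall>\<^sub>F y in nhds 0. ((\<lambda>x. f x + g x) has_derivative blinfun_apply (f' y + g' y)) (at y)"
      using f(2) g(2) by eventually_elim (auto simp: plus_blinfun.rep_eq intro!: has_derivative_add)
    show "((\<lambda>y. f' y + g' y) has_derivative (\<lambda>h. F h + G h)) (at 0)"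
      by (intro has_derivative_add f g)
  qed (auto simp: f g plus_blinfun.rep_eq)
qed

text \<open>The quadratic part is the full second derivative, without the Taylor factor 1/2; hence
  the coefficient 2 of the mixed term.\<close>

lemma jet_mult:
  assumes "jet V f a D Q" "jet V g b E R"
  shows "jet V (\<lambda>x. f x * g x) (a * b) (\<lambda>h. a * E h + b * D h) (\<lambda>h. a * R h + 2 * D h * E h + b * Q h)"
proof -
  obtain f' F where "jet_via V f a D Q f' F" using assms(1) unfolding jet_def by blast
  note f = jet_viaD[OF this]
  obtain g' G where "jet_via V g b E R g' G" using assms(2) unfolding jet_def by blast
  note g = jet_viaD[OF this]
  show ?thesis
  proof (rule jetI[where f' = "\<lambda>y. f y *\<^sub>R g' y + g y *\<^sub>R f' y"])
    show "\<forall>\<^sub>F y in nhds 0. ((\<lambda>x. f x * g x) has_derivative blinfun_apply (f y *\<^sub>R g' y + g y *\<^sub>R f' y)) (at y)"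
      using f(2) g(2)
    proof eventually_elim
      case (elim y)
      have "((\<lambda>x. f x * g x) has_derivative (\<lambda>h. f y * blinfun_apply (g' y) h + blinfun_apply (f' y) h * g y)) (at y)"
        by (intro has_derivative_mult elim)
      moreover have "(\<lambda>h. f y * blinfun_apply (g' y) h + blinfun_apply (f' y) h * g y)
        = blinfun_apply (f y *\<^sub>R g' y + g y *\<^sub>R f' y)"
        by (auto simp: plus_blinfun.rep_eq scaleR_blinfun.rep_eq)
      ultimately show ?case by simp
    qed
    show "((\<lambda>y. f y *\<^sub>R g' y + g y *\<^sub>R f' y) has_derivative
      (\<lambda>h. (f 0 *\<^sub>R G h + blinfun_apply (f' 0) h *\<^sub>R g' 0)
         + (g 0 *\<^sub>R F h + blinfun_apply (g' 0) h *\<^sub>R f' 0))) (at 0)"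
      by (intro has_derivative_add has_derivative_scaleR f g)
  qed (auto simp: f g plus_blinfun.rep_eq scaleR_blinfun.rep_eq algebra_simps)
qed

lemma jet_cmult:
  assumes "jet V f a D Q"
  shows "jet V (\<lambda>x. k * f x) (k * a) (\<lambda>h. k * D h) (\<lambda>h. k * Q h)"
  by (rule jet_cong[OF jet_mult[OF jet_const assms]]) auto

lemma jet_diff:
  assumes "jet V f a D Q" "jet V g b E R"
  shows "jet V (\<lambda>x. f x - g x) (a - b) (\<lambda>h. D h - E h) (\<lambda>h. Q h - R h)"
proof -
  have "jet V (\<lambda>x. f x + (- 1) * g x) (a + (- 1) * b) (\<lambda>h. D h + (- 1) * E h) (\<lambda>h. Q h + (- 1) * R h)"
    by (intro jet_add jet_cmult assms)
  then show ?thesis by simp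
qed

lemma jet_sum:
  assumes "finite I" "\<And>i. i \<in> I \<Longrightarrow> jet V (f i) (a i) (D i) (Q i)"
  shows "jet V (\<lambda>x. \<Sum>i\<in>I. f i x) (\<Sum>i\<in>I. a i) (\<lambda>h. \<Sum>i\<in>I. D i h) (\<lambda>h. \<Sum>i\<in>I. Q i h)"
  using assms by (induction I rule: finite_induct) (auto intro: jet_const jet_add)

lemma jet_compose_real:
  assumes f: "jet V f a D Q"
    and \<phi>: "\<forall>\<^sub>F y in nhds a. (\<phi> has_real_derivative \<phi>' y) (at y)" "(\<phi>' has_real_derivative d2) (at a)"
  shows "jet V (\<lambda>x. \<phi> (f x)) (\<phi> a) (\<lambda>h. \<phi>' a * D h) (\<lambda>h. \<phi>' a * Q h + d2 * (D h)\<^sup>2)"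
proof -
  obtain f' F where "jet_via V f a D Q f' F" using f unfolding jet_def by blast
  note f = jet_viaD[OF this]
  have "filterlim f (nhds a) (nhds 0)"
    using has_derivative_continuous[OF f(4)] f(1) by (metis isCont_def tendsto_at_iff_tendsto_nhds)
  then have ev: "\<forall>\<^sub>F x in nhds 0. (\<phi> has_real_derivative \<phi>' (f x)) (at (f x))"
    using \<phi>(1) by (rule eventually_compose_filterlim[rotated])
  show ?thesis
  proof (rule jetI[where f' = "\<lambda>y. \<phi>' (f y) *\<^sub>R f' y"])
    show "\<forall>\<^sub>F y in nhds 0. ((\<lambda>x. \<phi> (f x)) has_derivative blinfun_apply (\<phi>' (f y) *\<^sub>R f' y)) (at y)"
      using f(2) ev
    proof eventually_elim
      case (elim y)
      have "((\<lambda>x. \<phi> (f x)) has_derivative (\<lambda>h. blinfun_apply (f' y) h * \<phi>' (f y))) (at y)"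
        by (rule DERIV_compose_FDERIV[OF elim(2,1)])
      moreover have "(\<lambda>h. blinfun_apply (f' y) h * \<phi>' (f y)) = blinfun_apply (\<phi>' (f y) *\<^sub>R f' y)"
        by (auto simp: scaleR_blinfun.rep_eq)
      ultimately show ?case by simp
    qed
    have "((\<lambda>x. \<phi>' (f x)) has_derivative (\<lambda>h. blinfun_apply (f' 0) h * d2)) (at 0)"
      by (rule DERIV_compose_FDERIV) (use \<phi>(2) f in auto)
    then show "((\<lambda>y. \<phi>' (f y) *\<^sub>R f' y) has_derivative
      (\<lambda>h. \<phi>' (f 0) *\<^sub>R F h + (blinfun_apply (f' 0) h * d2) *\<^sub>R f' 0)) (at 0)"
      by (intro has_derivative_scaleR f)
  qed (auto simp: f plus_blinfun.rep_eq scaleR_blinfun.rep_eq power2_eq_square)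
qed

lemma jet_compose_linear:
  fixes L :: "'b::real_normed_vector \<Rightarrow> 'a::real_normed_vector"
  assumes f: "jet W f a D Q" and L: "bounded_linear L" "\<And>h. h \<in> V \<Longrightarrow> L h \<in> W"
  shows "jet V (\<lambda>x. f (L x)) a (\<lambda>h. D (L h)) (\<lambda>h. Q (L h))"
proof -
  obtain f' F where "jet_via W f a D Q f' F" using f unfolding jet_def by blast
  note f = jet_viaD[OF this]
  have L0: "L 0 = 0" using L(1) by (simp add: linear_0 bounded_linear.linear)
  have LB: "blinfun_apply (Blinfun L) = L" using L(1) by (rule bounded_linear_Blinfun_apply)
  have dL: "(L has_derivative L) (at x)" for x using L(1) by (rule bounded_linear_imp_has_derivative)
  have "filterlim L (nhds 0) (nhds 0)"
    using has_derivative_continuous[OF dL[of 0]] L0 by (metis isCont_def tendsto_at_iff_tendsto_nhds)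
  then have ev: "\<forall>\<^sub>F x in nhds 0. (f has_derivative blinfun_apply (f' (L x))) (at (L x))"
    using f(2) by (rule eventually_compose_filterlim[rotated])
  show ?thesis
  proof (rule jetI[where f' = "\<lambda>y. f' (L y) o\<^sub>L Blinfun L"])
    show "\<forall>\<^sub>F y in nhds 0. ((\<lambda>x. f (L x)) has_derivative blinfun_apply (f' (L y) o\<^sub>L Blinfun L)) (at y)"
      using ev
    proof eventually_elim
      case (elim y)
      have "((\<lambda>x. f (L x)) has_derivative (\<lambda>h. blinfun_apply (f' (L y)) (L h))) (at y)"
        by (rule has_derivative_compose[OF dL elim])
      moreover have "(\<lambda>h. blinfun_apply (f' (L y)) (L h)) = blinfun_apply (f' (L y) o\<^sub>L Blinfun L)"
        by (auto simp: LB)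
      ultimately show ?case by simp
    qed
    have "((\<lambda>x. f' (L x)) has_derivative (\<lambda>h. F (L h))) (at 0)"
      by (rule has_derivative_compose[OF dL]) (use f L0 in simp)
    then show "((\<lambda>y. f' (L y) o\<^sub>L Blinfun L) has_derivative (\<lambda>h. F (L h) o\<^sub>L Blinfun L)) (at 0)"
      by (rule bounded_linear.has_derivative[OF bounded_bilinear.bounded_linear_left[OF bounded_bilinear_blinfun_compose]])
  qed (use f L L0 LB in auto)
qed

text \<open>A derivative of quadratic size near 0 contributes nothing to second order; this disposes
  of the tail of the exponential series.\<close>

lemma jet_remainder:
  fixes f :: "'a::real_normed_vector \<Rightarrow> real"
  assumes r: "r > 0" and f0: "f 0 = 0"
    and f': "\<And>y. norm y < r \<Longrightarrow> (f has_derivative f' y) (at y)"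
    and bound: "\<And>y h. norm y < r \<Longrightarrow> \<bar>f' y h\<bar> \<le> C * (norm y)\<^sup>2 * norm h"
  shows "jet V f 0 (\<lambda>_. 0) (\<lambda>_. 0)"
proof (rule jetI[where f' = "\<lambda>y. Blinfun (f' y)" and H = "\<lambda>_. 0"])
  have bl: "blinfun_apply (Blinfun (f' y)) = f' y" if "norm y < r" for y
    using has_derivative_bounded_linear[OF f'[OF that]] by (rule bounded_linear_Blinfun_apply)
  have ev: "\<forall>\<^sub>F y in nhds 0. norm (y :: 'a) < r"
    using r eventually_nhds_metric[of "\<lambda>y. norm y < r" 0] by (auto simp: dist_norm)
  show "\<forall>\<^sub>F y in nhds 0. (f has_derivative blinfun_apply (Blinfun (f' y))) (at y)"
    using ev by eventually_elim (simp add: bl f')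
  have z: "f' 0 h = 0" for h using bound[of 0 h] r by simp
  then have B0: "Blinfun (f' 0) = 0" by (intro blinfun_eqI) (simp add: bl r zero_blinfun.rep_eq)
  show "blinfun_apply (Blinfun (f' 0)) h = 0" for h by (simp add: B0)
  have C: "0 \<le> \<bar>C\<bar>" by simp
  have nb: "norm (Blinfun (f' y)) \<le> \<bar>C\<bar> * (norm y)\<^sup>2" if "norm y < r" for y
  proof (rule norm_blinfun_bound)
    fix h
    have "\<bar>f' y h\<bar> \<le> C * (norm y)\<^sup>2 * norm h" by (rule bound[OF that])
    also have "\<dots> \<le> \<bar>C\<bar> * (norm y)\<^sup>2 * norm h" by (intro mult_right_mono) auto
    finally show "norm (blinfun_apply (Blinfun (f' y)) h) \<le> \<bar>C\<bar> * (norm y)\<^sup>2 * norm h" by (simp add: bl that)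
  qed simp
  have "((\<lambda>y. norm (Blinfun (f' y)) / norm y) \<longlongrightarrow> 0) (at 0)"
  proof (rule Lim_null_comparison)
    have "\<forall>\<^sub>F y in at 0. norm (y :: 'a) < r \<and> y \<noteq> 0"
      using ev by (auto simp: eventually_at_filter elim: eventually_mono)
    then show "\<forall>\<^sub>F y in at 0. norm (norm (Blinfun (f' y)) / norm y) \<le> \<bar>C\<bar> * norm y"
    proof eventually_elim
      case (elim y)
      then show ?case using nb[of y] by (simp add: field_simps power2_eq_square)
    qed
    have "((\<lambda>y::'a. \<bar>C\<bar> * norm y) \<longlongrightarrow> \<bar>C\<bar> * norm (0::'a)) (at 0)" by (intro tendsto_intros)
    then show "((\<lambda>y::'a. \<bar>C\<bar> * norm y) \<longlongrightarrow> 0) (at 0)" by simp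
  qed
  then show "((\<lambda>y. Blinfun (f' y)) has_derivative (\<lambda>_. 0)) (at 0)"
    by (simp add: has_derivative_iff_norm B0)
qed (use f0 in \<open>auto simp: zero_blinfun.rep_eq\<close>)

text \<open>Jets live in the ambient space, the Hessian on \<open>V\<close>. Derivatives restrict to
  \<open>V\<close>, and the two functions have to agree only at points of \<open>V\<close> near
  0.\<close>

lemma jet_has_hessian_on:
  assumes f: "jet V f c D Q" and S: "open S" "0 \<in> S" and fg: "\<And>x. x \<in> S \<Longrightarrow> x \<in> V \<Longrightarrow> f x = g x"
  shows "\<exists>H. has_hessian_on g H 0 V \<and> (\<forall>h\<in>V. blinfun_apply (blinfun_apply H h) h = Q h)"
proof -
  obtain f' F where "jet_via V f c D Q f' F" using f unfolding jet_def by blast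
  note f = jet_viaD[OF this]
  have F: "blinfun_apply (Blinfun F) = F"
    using has_derivative_bounded_linear[OF f(3)] by (rule bounded_linear_Blinfun_apply)
  have "\<forall>\<^sub>F y in nhds 0. y \<in> S" using S by (rule eventually_nhds_in_open)
  then have "\<forall>\<^sub>F y in nhds 0. y \<in> V \<longrightarrow> (g has_derivative blinfun_apply (f' y)) (at y within V)"
    using f(2)
  proof eventually_elim
    case (elim y)
    show ?case
    proof
      assume y: "y \<in> V"
      obtain d where d: "d > 0" "\<And>x. dist x y < d \<Longrightarrow> x \<in> S" using S(1) elim(1) unfolding open_dist by blast
      have "(f has_derivative blinfun_apply (f' y)) (at y within V)"
        by (rule has_derivative_at_withinI[OF elim(2)])
      then show "(g has_derivative blinfun_apply (f' y)) (at y within V)"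
        by (rule has_derivative_transform_within[OF _ d(1) y]) (use d fg in auto)
    qed
  qed
  moreover have "(f' has_derivative blinfun_apply (Blinfun F)) (at 0 within V)"
    unfolding F by (rule has_derivative_at_withinI[OF f(3)])
  ultimately show ?thesis using f(6) unfolding has_hessian_on_def
    by (intro exI[of _ "Blinfun F"]) (auto simp: F)
qed

subsection \<open>The matrix exponential to second order\<close>

lemma bounded_bilinear_matrix_mult: "bounded_bilinear ((**) :: real^'n^'n \<Rightarrow> real^'n^'n \<Rightarrow> real^'n^'n)"
  unfolding bilinear_conv_bounded_bilinear[symmetric] bilinear_def
  by (auto intro!: linearI simp: matrix_matrix_mult_def vec_eq_iff sum.distrib sum_distrib_left algebra_simps)

text \<open>The product rule with the order of factors kept, since \<open>A\<close> and
  \<open>H\<close> need not commute.\<close>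

primrec matrix_pow_deriv :: "real^'n^'n \<Rightarrow> real^'n^'n \<Rightarrow> nat \<Rightarrow> real^'n^'n" where
  "matrix_pow_deriv A H 0 = 0"
| "matrix_pow_deriv A H (Suc k) = H ** matrix_pow A k + A ** matrix_pow_deriv A H k"

lemma has_derivative_matrix_pow:
  "((\<lambda>A. matrix_pow A k) has_derivative (\<lambda>H. matrix_pow_deriv A H k)) (at A)"
proof (induction k)
  case (Suc k)
  have "((\<lambda>A. A ** matrix_pow A k) has_derivative (\<lambda>H. A ** matrix_pow_deriv A H k + H ** matrix_pow A k)) (at A)"
    by (rule bounded_bilinear.FDERIV[OF bounded_bilinear_matrix_mult has_derivative_ident Suc])
  then show ?case by (simp add: add.commute)
qed simp

text \<open>The derivative has \<open>k\<close> terms, one for each place of \<open>H\<close> in the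
  product. \<open>K\<close> bounds the bilinear matrix product and \<open>N\<close> is the norm of
  the unit matrix.\<close>

lemma matrix_pow_deriv_bound:
  obtains K N where "K \<ge> 0" "N \<ge> 0"
    "\<And>A H k. norm (matrix_pow_deriv (A :: real^'n^'n) H k) \<le> real k * N * K ^ k * norm A ^ (k - 1) * norm H"
proof -
  obtain K where K: "K \<ge> 0" "\<And>(A :: real^'n^'n) (B :: real^'n^'n). norm (A ** B) \<le> norm A * norm B * K"
  proof -
    have "\<exists>K\<ge>0. \<forall>(A :: real^'n^'n) (B :: real^'n^'n). norm (A ** B) \<le> norm A * norm B * K"
      by (rule bounded_bilinear.nonneg_bounded[OF bounded_bilinear_matrix_mult])
    then show ?thesis using that by blast
  qed
  define N where "N = norm (mat 1 :: real^'n^'n)"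
  have N: "N \<ge> 0" by (simp add: N_def)
  have p: "norm (matrix_pow (A :: real^'n^'n) k) \<le> N * K ^ k * norm A ^ k" for A k
  proof (induction k)
    case (Suc k)
    have "norm (matrix_pow A (Suc k)) \<le> norm A * norm (matrix_pow A k) * K" using K(2) by simp
    also have "\<dots> \<le> norm A * (N * K ^ k * norm A ^ k) * K"
      by (intro mult_right_mono mult_left_mono Suc K) auto
    finally show ?case by (simp add: mult_ac)
  qed (simp add: N_def)
  have d: "norm (matrix_pow_deriv (A :: real^'n^'n) H k) \<le> real k * N * K ^ k * norm A ^ (k - 1) * norm H" for A H k
  proof (induction k)
    case (Suc k)
    have "norm (matrix_pow_deriv A H (Suc k)) \<le> norm (H ** matrix_pow A k) + norm (A ** matrix_pow_deriv A H k)"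
      by (simp add: norm_triangle_ineq)
    also have "\<dots> \<le> norm H * norm (matrix_pow A k) * K + norm A * norm (matrix_pow_deriv A H k) * K"
      by (intro add_mono K)
    also have "\<dots> \<le> norm H * (N * K ^ k * norm A ^ k) * K
        + norm A * (real k * N * K ^ k * norm A ^ (k - 1) * norm H) * K"
      by (intro add_mono mult_right_mono mult_left_mono Suc p K) auto
    also have "norm A * (real k * N * K ^ k * norm A ^ (k - 1) * norm H) * K = real k * N * K ^ Suc k * norm A ^ k * norm H"
      by (cases k) (auto simp: mult_ac)
    also have "norm H * (N * K ^ k * norm A ^ k) * K + \<dots> = real (Suc k) * N * K ^ Suc k * norm A ^ (Suc k - 1) * norm H"
      by (simp add: algebra_simps)
    finally show ?case .
  qed simp
  show ?thesis by (rule that[OF K(1) N d])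
qed

text \<open>The series beyond its quadratic part is differentiated termwise: for
  \<open>norm A < 1\<close> each remaining derivative is bounded by a multiple of
  \<open>(norm A)\<^sup>2 * norm H\<close>, with summable constants.\<close>

lemma matrix_expo_remainder:
  obtains g g' C where
    "\<And>A :: real^'n^'n. norm A < 1 \<Longrightarrow> matrix_expo A = mat 1 + A + (1/2) *\<^sub>R (A ** A) + g A"
    "\<And>A :: real^'n^'n. norm A < 1 \<Longrightarrow> (g has_derivative g' A) (at A)"
    "\<And>(A :: real^'n^'n) (H :: real^'n^'n). norm A < 1 \<Longrightarrow> norm (g' A H) \<le> C * (norm A)\<^sup>2 * norm H"
proof -
  obtain K N where K: "K \<ge> 0" and N: "N \<ge> 0"
    and d: "\<And>A H k. norm (matrix_pow_deriv (A :: real^'n^'n) H k) \<le> real k * N * K ^ k * norm A ^ (k - 1) * norm H"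
    using matrix_pow_deriv_bound by blast
  define f where "f n A = (1 / fact (n + 3)) *\<^sub>R matrix_pow (A :: real^'n^'n) (n + 3)" for n A
  define f' where "f' n A H = (1 / fact (n + 3)) *\<^sub>R matrix_pow_deriv (A :: real^'n^'n) H (n + 3)" for n A H
  \<comment> \<open>The factor \<open>n + 3\<close> from differentiation is absorbed by
    \<open>2 ^ (n + 3)\<close>, which turns \<open>K\<close> into \<open>2 * K\<close> and leaves an
    exponential series.\<close>
  define M where "M n = N * (2 * K) ^ (n + 3) / fact (n + 3)" for n
  have M: "summable M"
  proof -
    have "summable (\<lambda>n. N * (inverse (fact n) * (2 * K) ^ n))" by (intro summable_mult summable_exp)
    then have "summable (\<lambda>n. N * (inverse (fact (n + 3)) * (2 * K) ^ (n + 3)))"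
      by (subst summable_iff_shift)
    then show ?thesis by (simp add: M_def[abs_def] divide_inverse mult_ac)
  qed
  have M0: "M n \<ge> 0" for n using K N by (simp add: M_def)
  have f'_bound: "norm (f' n A H) \<le> M n * (norm A)\<^sup>2 * norm H" if "norm A < 1" for n A H
  proof -
    have "norm (f' n A H) \<le> (1 / fact (n + 3)) * (real (n + 3) * N * K ^ (n + 3) * norm A ^ (n + 3 - 1) * norm H)"
      unfolding f'_def norm_scaleR by (intro mult_mono d) auto
    also have "\<dots> \<le> (1 / fact (n + 3)) * (2 ^ (n + 3) * N * K ^ (n + 3) * (norm A)\<^sup>2 * norm H)"
    proof (intro mult_left_mono mult_right_mono mult_mono)
      show "real (n + 3) \<le> 2 ^ (n + 3)" using of_nat_less_two_power[of "n + 3", where 'a = real] by linarith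
      show "norm A ^ (n + 3 - 1) \<le> (norm A)\<^sup>2" using that by (intro power_decreasing) auto
    qed (use K N in auto)
    also have "\<dots> = M n * (norm A)\<^sup>2 * norm H" by (simp add: M_def power_mult_distrib)
    finally show ?thesis .
  qed
  have f'_summable: "summable (\<lambda>n. f' n A H)" if "norm A < 1" for A H
  proof (rule summable_comparison_test)
    show "\<exists>N. \<forall>n\<ge>N. norm (f' n A H) \<le> M n * ((norm A)\<^sup>2 * norm H)" using f'_bound[OF that] by (auto simp: mult.assoc)
    show "summable (\<lambda>n. M n * ((norm A)\<^sup>2 * norm H))" by (rule summable_mult2[OF M])
  qed
  define g' where "g' A H = (\<Sum>n. f' n A H)" for A H
  have g'_bound: "norm (g' A H) \<le> suminf M * (norm A)\<^sup>2 * norm H" if "norm A < 1" for A H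
  proof -
    have "norm (g' A H) \<le> (\<Sum>n. M n * ((norm A)\<^sup>2 * norm H))"
      unfolding g'_def
      by (rule norm_suminf_le[OF _ summable_mult2[OF M]]) (use f'_bound[OF that] in \<open>simp add: mult.assoc\<close>)
    also have "\<dots> = suminf M * ((norm A)\<^sup>2 * norm H)" by (rule suminf_mult2[OF M, symmetric])
    finally show ?thesis by (simp add: mult.assoc)
  qed
  have tail: "\<forall>\<^sub>F n in sequentially. \<forall>A\<in>ball 0 1. \<forall>H. norm ((\<Sum>i<n. f' i A H) - g' A H) \<le> e * norm H"
    if e: "e > 0" for e
  proof -
    obtain n0 where n0: "\<And>n. n \<ge> n0 \<Longrightarrow> norm (\<Sum>i. M (i + n)) < e"
      using suminf_exist_split[OF e M] by blast
    have "norm ((\<Sum>i<n. f' i A H) - g' A H) \<le> e * norm H" if n: "n \<ge> n0" and A: "A \<in> ball 0 1" for n A H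
    proof -
      have nA: "norm A < 1" using A by simp
      have "g' A H = (\<Sum>i. f' (i + n) A H) + (\<Sum>i<n. f' i A H)"
        unfolding g'_def by (rule suminf_split_initial_segment[OF f'_summable[OF nA]])
      then have "norm ((\<Sum>i<n. f' i A H) - g' A H) = norm (\<Sum>i. f' (i + n) A H)" by (simp add: norm_minus_commute)
      also have "\<dots> \<le> (\<Sum>i. M (i + n) * norm H)"
      proof (rule norm_suminf_le)
        fix i
        have "norm (f' (i + n) A H) \<le> M (i + n) * (norm A)\<^sup>2 * norm H" by (rule f'_bound[OF nA])
        also have "\<dots> \<le> M (i + n) * 1 * norm H"
          using nA M0 by (intro mult_right_mono mult_left_mono power_le_one) auto
        finally show "norm (f' (i + n) A H) \<le> M (i + n) * norm H" by simp
        show "summable (\<lambda>i. M (i + n) * norm H)" using M by (intro summable_mult2) (simp add: summable_iff_shift)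
      qed
      also have "\<dots> = (\<Sum>i. M (i + n)) * norm H"
        using M by (intro suminf_mult2[symmetric]) (simp add: summable_iff_shift)
      also have "\<dots> \<le> e * norm H" using n0[OF n] by (intro mult_right_mono) auto
      finally show ?thesis .
    qed
    then show ?thesis unfolding eventually_sequentially by blast
  qed
  have "\<exists>g. \<forall>A\<in>ball 0 1. (\<lambda>n. f n A) sums g A \<and> (g has_derivative g' A) (at A within ball 0 1)"
  proof (rule has_derivative_series[OF convex_ball _ tail])
    fix n and A :: "real^'n^'n"
    show "(f n has_derivative f' n A) (at A within ball 0 1)"
      unfolding f_def f'_def
      by (rule has_derivative_scaleR_right[OF has_derivative_at_withinI[OF has_derivative_matrix_pow]])
    show "0 \<in> ball (0 :: real^'n^'n) 1" by simp
    have "matrix_pow (0 :: real^'n^'n) (Suc n) = 0" for n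
      by (simp add: bounded_bilinear.zero_left[OF bounded_bilinear_matrix_mult])
    then show "(\<lambda>n. f n 0) sums 0" by (simp add: f_def eval_nat_numeral)
  qed
  then obtain g where "\<forall>A\<in>ball 0 1. (\<lambda>n. f n A) sums g A \<and> (g has_derivative g' A) (at A within ball 0 1)"
    by blast
  then have g: "(\<lambda>n. f n A) sums g A" "(g has_derivative g' A) (at A within ball 0 1)" if "norm A < 1" for A
    using that by simp_all
  show ?thesis
  proof (rule that[of g g' "suminf M"])
    fix A :: "real^'n^'n" assume A: "norm A < 1"
    show "(g has_derivative g' A) (at A)"
      using g(2)[OF A] A by (simp add: at_within_open[OF _ open_ball])
    let ?t = "\<lambda>n. (1 / fact n) *\<^sub>R matrix_pow A n"
    have "(\<lambda>n. ?t (n + 3)) sums g A" using g(1)[OF A] by (simp add: f_def)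
    then have "?t sums (g A + (\<Sum>i<3. ?t i))" by (rule sums_iff_shift[THEN iffD1])
    then have "matrix_expo A = g A + (\<Sum>i<3. ?t i)" unfolding matrix_expo_def by (simp add: sums_iff)
    also have "(\<Sum>i<3. ?t i) = mat 1 + A + (1/2) *\<^sub>R (A ** A)"
      by (simp add: eval_nat_numeral)
    finally show "matrix_expo A = mat 1 + A + (1/2) *\<^sub>R (A ** A) + g A" by (simp add: add_ac)
  qed (use g'_bound in auto)
qed

lemma jet_matrix_expo_entry:
  fixes V :: "(real^'n^'n) set"
  shows "jet V (\<lambda>A. matrix_expo A $ i $ j) (if i = j then 1 else 0) (\<lambda>A. A $ i $ j) (\<lambda>A. (A ** A) $ i $ j)"
proof -
  obtain g g' C where g: "\<And>A :: real^'n^'n. norm A < 1 \<Longrightarrow> matrix_expo A = mat 1 + A + (1/2) *\<^sub>R (A ** A) + g A"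
    and g': "\<And>A :: real^'n^'n. norm A < 1 \<Longrightarrow> (g has_derivative g' A) (at A)"
    and C: "\<And>(A :: real^'n^'n) (H :: real^'n^'n). norm A < 1 \<Longrightarrow> norm (g' A H) \<le> C * (norm A)\<^sup>2 * norm H"
    using matrix_expo_remainder by blast
  have lin: "bounded_linear (\<lambda>A :: real^'n^'n. A $ k $ l)" for k l
    by (rule bounded_linear_compose[OF bounded_linear_vec_nth bounded_linear_vec_nth])
  have entry: "\<bar>A $ k $ l\<bar> \<le> norm A" for A :: "real^'n^'n" and k l
    using component_le_norm_cart[of "A $ k" l] Finite_Cartesian_Product.norm_nth_le[of A k] by linarith
  have pow_Suc0: "matrix_pow (0 :: real^'n^'n) (Suc n) = 0" for n by (simp add: bounded_bilinear.zero_left[OF bounded_bilinear_matrix_mult])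
  have expo0: "matrix_expo (0 :: real^'n^'n) = mat 1"
  proof -
    have "(\<Sum>k. (1 / fact k) *\<^sub>R matrix_pow (0 :: real^'n^'n) k) = (\<Sum>k\<in>{0}. (1 / fact k) *\<^sub>R matrix_pow (0 :: real^'n^'n) k)"
    proof (rule suminf_finite)
      fix k :: nat assume "k \<notin> {0}"
      then show "(1 / fact k) *\<^sub>R matrix_pow (0 :: real^'n^'n) k = 0" using pow_Suc0 by (cases k) auto
    qed simp
    then show ?thesis by (simp add: matrix_expo_def)
  qed
  have g0: "g 0 = 0" using g[of 0] expo0 by (simp add: bounded_bilinear.zero_left[OF bounded_bilinear_matrix_mult])
  have "jet V (\<lambda>A. g A $ i $ j) 0 (\<lambda>_. 0) (\<lambda>_. 0)"
  proof (rule jet_remainder[of 1])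
    fix A :: "real^'n^'n" assume A: "norm A < 1"
    show "((\<lambda>A. g A $ i $ j) has_derivative (\<lambda>H. g' A H $ i $ j)) (at A)"
      by (rule bounded_linear.has_derivative[OF lin g'[OF A]])
    show "\<bar>g' A h $ i $ j\<bar> \<le> C * (norm A)\<^sup>2 * norm h" for h
      using entry[of "g' A h" i j] C[OF A, of h] by linarith
  qed (use g0 in auto)
  moreover have "jet V (\<lambda>A. \<Sum>l\<in>UNIV. A $ i $ l * A $ l $ j) (\<Sum>l\<in>(UNIV::'n set). 0) (\<lambda>A. \<Sum>l\<in>(UNIV::'n set). 0)
      (\<lambda>A. \<Sum>l\<in>UNIV. 2 * (A $ i $ l * A $ l $ j))"
    by (rule jet_sum) (auto intro: jet_cong[OF jet_mult[OF jet_linear[OF lin] jet_linear[OF lin]]])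
  ultimately have J: "jet V (\<lambda>A. ((if i = j then 1 else 0) + A $ i $ j) + ((1/2) * (\<Sum>l\<in>UNIV. A $ i $ l * A $ l $ j) + g A $ i $ j))
     (((if i = j then 1 else 0) + 0) + ((1/2) * (\<Sum>l\<in>(UNIV::'n set). 0) + 0)) (\<lambda>A. (0 + A $ i $ j) + ((1/2) * (\<Sum>l\<in>(UNIV::'n set). 0) + 0))
     (\<lambda>A. (0 + 0) + ((1/2) * (\<Sum>l\<in>UNIV. 2 * (A $ i $ l * A $ l $ j)) + 0))"
    by (intro jet_add jet_cmult jet_const jet_linear lin)
  show ?thesis
  proof (rule jet_transform)
    show "jet V (\<lambda>A. ((if i = j then 1 else 0) + A $ i $ j) + ((1/2) * (\<Sum>l\<in>UNIV. A $ i $ l * A $ l $ j) + g A $ i $ j))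
      (if i = j then 1 else 0) (\<lambda>A. A $ i $ j) (\<lambda>A. (A ** A) $ i $ j)"
      by (rule jet_cong[OF J]) (simp_all add: matrix_matrix_mult_def sum_distrib_left[symmetric])
    show "\<forall>\<^sub>F A in nhds 0. ((if i = j then 1 else 0) + A $ i $ j) + ((1/2) * (\<Sum>l\<in>UNIV. A $ i $ l * A $ l $ j) + g A $ i $ j)
      = matrix_expo A $ i $ j"
    proof -
      have "\<forall>\<^sub>F A in nhds 0. norm (A :: real^'n^'n) < 1"
        using eventually_nhds_metric[of "\<lambda>y :: real^'n^'n. norm y < 1" 0] by (auto simp: dist_norm intro!: exI[of _ 1])
      then show ?thesis by eventually_elim (simp add: g mat_def matrix_matrix_mult_def)
    qed
  qed
qed

subsection \<open>The six edges\<close>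

definition "e12 = Abs_edge (1, 2)"
definition "e13 = Abs_edge (1, 3)"
definition "e14 = Abs_edge (1, 4)"
definition "e23 = Abs_edge (2, 3)"
definition "e24 = Abs_edge (2, 4)"
definition "e34 = Abs_edge (3, 4)"

lemmas edge_defs = e12_def e13_def e14_def e23_def e24_def e34_def

lemma Rep_edges: "Rep_edge e12 = (1, 2)" "Rep_edge e13 = (1, 3)" "Rep_edge e14 = (1, 4)"
  "Rep_edge e23 = (2, 3)" "Rep_edge e24 = (2, 4)" "Rep_edge e34 = (3, 4)"
  by (simp_all add: edge_defs Abs_edge_inverse)

lemma UNIV_edge: "(UNIV :: edge set) = {e12, e13, e14, e23, e24, e34}"
proof (intro equalityI subsetI)
  fix e :: edge
  obtain i j where ij: "Rep_edge e = (i, j)" by (cases "Rep_edge e")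
  then have "1 \<le> i" "i < j" "j \<le> 4" using Rep_edge[of e] by auto
  then have "i = 1 \<and> j = 2 \<or> i = 1 \<and> j = 3 \<or> i = 1 \<and> j = 4 \<or> i = 2 \<and> j = 3 \<or> i = 2 \<and> j = 4 \<or> i = 3 \<and> j = 4"
    by presburger
  moreover have "e = Abs_edge (i, j)" using Rep_edge_inverse[of e] ij by simp
  ultimately show "e \<in> {e12, e13, e14, e23, e24, e34}" unfolding edge_defs by (elim disjE) auto
qed simp

lemma edges_distinct: "distinct [e12, e13, e14, e23, e24, e34]"
proof -
  have "distinct (map Rep_edge [e12, e13, e14, e23, e24, e34])" by (simp add: Rep_edges)
  then show ?thesis by (rule distinct_map[THEN iffD1, THEN conjunct1])
qed

lemma CARD_edge: "CARD(edge) = 6"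
proof -
  have "card (set [e12, e13, e14, e23, e24, e34]) = 6" using distinct_card[OF edges_distinct] by simp
  then show ?thesis unfolding UNIV_edge by simp
qed

lemma sum_edge: "(\<Sum>e\<in>UNIV. f e) = f e12 + f e13 + f e14 + f e23 + f e24 + f e34"
  for f :: "edge \<Rightarrow> 'a::comm_monoid_add"
proof -
  have "(\<Sum>e\<in>UNIV. f e) = sum_list (map f [e12, e13, e14, e23, e24, e34])"
    using sum_list_distinct_conv_sum_set[OF edges_distinct, of f] by (simp add: UNIV_edge)
  then show ?thesis by (simp add: add.assoc)
qed

definition frame_scale :: real where
  "frame_scale = 2 powr (- 2 / 3)"

lemma frame_scale_pos: "frame_scale > 0"
  by (simp add: frame_scale_def)

text \<open>All scale factors reduce to this cube:
  \<open>(2 * frame_scale\<^sup>2) ^ 3 = 1/2\<close> for volumes,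
  \<open>4 * frame_scale ^ 4 = frame_scale\<close> for areas.\<close>

lemma frame_scale_cube: "frame_scale ^ 3 = 1 / 4"
proof -
  have "frame_scale ^ 3 = frame_scale powr 3" using powr_realpow[OF frame_scale_pos, of 3] by simp
  also have "\<dots> = 2 powr (- 2)" by (simp add: frame_scale_def powr_powr)
  also have "\<dots> = 1 / 4" by (simp add: powr_minus)
  finally show ?thesis .
qed

text \<open>The frame is a multiple of integer vectors, and the generators of the zonotopes are a
  multiple of the roots of type \<open>A\<^sub>3\<close>.\<close>

definition edge_root :: "edge \<Rightarrow> real^3" where
  "edge_root e = (1 / (2 * frame_scale\<^sup>2)) *\<^sub>R edge_cross e"

lemma edge_cross_eq: "edge_cross e = (2 * frame_scale\<^sup>2) *\<^sub>R edge_root e"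
  using frame_scale_pos by (simp add: edge_root_def)

lemma edge_roots:
  "edge_root e12 = vector [0, 1, - 1]" "edge_root e13 = vector [- 1, 0, 1]" "edge_root e14 = vector [1, - 1, 0]"
  "edge_root e23 = vector [1, 1, 0]" "edge_root e24 = vector [- 1, 0, - 1]" "edge_root e34 = vector [0, 1, 1]"
proof -
  have n: "tetra_normal i = frame_scale *\<^sub>R (if i = 1 then vector [1, 1, 1] else if i = 2 then vector [1, -1, -1]
      else if i = 3 then vector [-1, 1, -1] else vector [-1, -1, 1])" for i
    by (simp add: tetra_normal_def frame_scale_def)
  have c: "(1 / (2 * frame_scale\<^sup>2)) *\<^sub>R cross3 (frame_scale *\<^sub>R u) (frame_scale *\<^sub>R v) = (1/2) *\<^sub>R cross3 u v" for u v
    using frame_scale_pos by (simp add: cross_mult_left cross_mult_right power2_eq_square)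
  show "edge_root e12 = vector [0, 1, - 1]" "edge_root e13 = vector [- 1, 0, 1]" "edge_root e14 = vector [1, - 1, 0]"
    "edge_root e23 = vector [1, 1, 0]" "edge_root e24 = vector [- 1, 0, - 1]" "edge_root e34 = vector [0, 1, 1]"
    unfolding edge_root_def edge_cross_def Rep_edges prod.case n c
    by (simp_all add: cross3_def vec_eq_iff forall_3)
qed

subsection \<open>The isoperimetric quotient of the zonotopes\<close>

lemma zonotope_eq_centred: "zonotope \<beta> M = centred_zonotope (\<lambda>e. \<beta> $ e *\<^sub>R (M *v edge_cross e))"
proof -
  let ?w = "\<lambda>e. \<beta> $ e *\<^sub>R (M *v edge_cross e)"
  have seg: "closed_segment ((- (1/2) * \<beta> $ e) *\<^sub>R (M *v edge_cross e)) ((1/2 * \<beta> $ e) *\<^sub>R (M *v edge_cross e))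
     = {x *\<^sub>R ?w e | x. \<bar>x\<bar> \<le> 1/2}" (is "closed_segment (?a *\<^sub>R ?y) (?b *\<^sub>R ?y) = ?S") for e
  proof (intro set_eqI iffI)
    fix z assume "z \<in> closed_segment (?a *\<^sub>R ?y) (?b *\<^sub>R ?y)"
    then obtain u where u: "0 \<le> u" "u \<le> 1" "z = (1 - u) *\<^sub>R ?a *\<^sub>R ?y + u *\<^sub>R ?b *\<^sub>R ?y"
      unfolding in_segment by blast
    have "z = (u - 1/2) *\<^sub>R ?w e" unfolding u(3) scaleR_scaleR scaleR_add_left[symmetric]
      by (intro arg_cong[where f = "\<lambda>c. c *\<^sub>R _"]) (simp add: field_simps)
    moreover have "\<bar>u - 1/2\<bar> \<le> 1/2" using u by linarith
    ultimately show "z \<in> ?S" by blast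
  next
    fix z assume "z \<in> ?S"
    then obtain x where x: "z = x *\<^sub>R ?w e" "\<bar>x\<bar> \<le> 1/2" by blast
    have "z = (1 - (x + 1/2)) *\<^sub>R ?a *\<^sub>R ?y + (x + 1/2) *\<^sub>R ?b *\<^sub>R ?y"
      unfolding x(1) scaleR_scaleR scaleR_add_left[symmetric]
      by (intro arg_cong[where f = "\<lambda>c. c *\<^sub>R _"]) (simp add: field_simps)
    moreover have "0 \<le> x + 1/2" "x + 1/2 \<le> 1" using x(2) by linarith+
    ultimately show "z \<in> closed_segment (?a *\<^sub>R ?y) (?b *\<^sub>R ?y)" unfolding in_segment by blast
  qed
  have "zonotope \<beta> M = {sum s UNIV | s. \<forall>e\<in>UNIV. s e \<in> {x *\<^sub>R ?w e | x. \<bar>x\<bar> \<le> 1/2}}"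
    unfolding zonotope_def seg by (rule set_sum_alt) simp
  also have "\<dots> = centred_zonotope ?w"
  proof (intro set_eqI iffI)
    fix z assume "z \<in> {sum s UNIV | s. \<forall>e\<in>UNIV. s e \<in> {x *\<^sub>R ?w e | x. \<bar>x\<bar> \<le> 1/2}}"
    then obtain s where s: "z = sum s UNIV" "\<forall>e. \<exists>x. s e = x *\<^sub>R ?w e \<and> \<bar>x\<bar> \<le> 1/2" by blast
    from s(2) obtain x where "\<forall>e. s e = x e *\<^sub>R ?w e \<and> \<bar>x e\<bar> \<le> 1/2" by metis
    then show "z \<in> centred_zonotope ?w" unfolding centred_zonotope_def s(1)
      by (intro CollectI exI[of _ x] conjI sum.cong) auto
  next
    fix z assume "z \<in> centred_zonotope ?w"
    then obtain x where x: "z = (\<Sum>e\<in>UNIV. x e *\<^sub>R ?w e)" "\<forall>e. \<bar>x e\<bar> \<le> 1/2"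
      unfolding centred_zonotope_def by blast
    show "z \<in> {sum s UNIV | s. \<forall>e\<in>UNIV. s e \<in> {x *\<^sub>R ?w e | x. \<bar>x\<bar> \<le> 1/2}}"
      unfolding x(1) using x(2) by (intro CollectI exI[of _ "\<lambda>e. x e *\<^sub>R ?w e"] conjI refl) blast
  qed
  finally show ?thesis .
qed

text \<open>The cofactor matrix of \<open>M\<close> applied to \<open>w\<close>, written out; it
  acts on cross products when \<open>M\<close> acts on their factors.\<close>

definition cofactor_vec :: "real^3^3 \<Rightarrow> real^3 \<Rightarrow> real^3" where
  "cofactor_vec M w = vector
    [w $ 1 * (M $ 2 $ 2 * M $ 3 $ 3 - M $ 2 $ 3 * M $ 3 $ 2) + w $ 2 * (M $ 2 $ 3 * M $ 3 $ 1 - M $ 2 $ 1 * M $ 3 $ 3)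
       + w $ 3 * (M $ 2 $ 1 * M $ 3 $ 2 - M $ 2 $ 2 * M $ 3 $ 1),
     w $ 1 * (M $ 3 $ 2 * M $ 1 $ 3 - M $ 3 $ 3 * M $ 1 $ 2) + w $ 2 * (M $ 3 $ 3 * M $ 1 $ 1 - M $ 3 $ 1 * M $ 1 $ 3)
       + w $ 3 * (M $ 3 $ 1 * M $ 1 $ 2 - M $ 3 $ 2 * M $ 1 $ 1),
     w $ 1 * (M $ 1 $ 2 * M $ 2 $ 3 - M $ 1 $ 3 * M $ 2 $ 2) + w $ 2 * (M $ 1 $ 3 * M $ 2 $ 1 - M $ 1 $ 1 * M $ 2 $ 3)
       + w $ 3 * (M $ 1 $ 1 * M $ 2 $ 2 - M $ 1 $ 2 * M $ 2 $ 1)]"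

lemma cross3_matrix_vector: "cross3 (M *v u) (M *v v) = cofactor_vec M (cross3 u v)"
  unfolding vec_eq_iff forall_3 cofactor_vec_def
  by (simp add: cross3_def matrix_vector_mult_def sum_3 algebra_simps)

lemma triple_product_matrix_vector: "triple_product (M *v u) (M *v v) (M *v w) = det M * triple_product u v w"
  by (simp add: triple_product_def cross3_def matrix_vector_mult_def inner_vec_def sum_3 det_3 algebra_simps)

lemma cofactor_vec_scale: "cofactor_vec M (k *\<^sub>R w) = k *\<^sub>R cofactor_vec M w"
  unfolding vec_eq_iff forall_3 by (simp add: cofactor_vec_def algebra_simps)

definition area_sum :: "(edge \<Rightarrow> real) \<Rightarrow> real^3^3 \<Rightarrow> real" where
  "area_sum b M = (\<Sum>e\<in>UNIV. \<Sum>f\<in>UNIV. b e * b f * norm (cofactor_vec M (cross3 (edge_root e) (edge_root f))))"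

text \<open>The divisor 12 is the 6 orderings of a triple times 2, the absolute determinant of any
  independent triple of roots.\<close>

definition volume_sum :: "(edge \<Rightarrow> real) \<Rightarrow> real" where
  "volume_sum b = (\<Sum>e\<in>UNIV. \<Sum>f\<in>UNIV. \<Sum>g\<in>UNIV. b e * b f * b g *
     \<bar>triple_product (edge_root e) (edge_root f) (edge_root g)\<bar>) / 12"

lemma volume_zonotope:
  assumes b: "\<And>e. \<beta> $ e > 0" and M: "det M > 0"
  shows "measure lebesgue (zonotope \<beta> M) = det M * volume_sum (($) \<beta>)"
proof -
  have half: "(2 * frame_scale\<^sup>2) ^ 3 = 1/2"
  proof -
    have "(2 * frame_scale\<^sup>2) ^ 3 = 8 * (frame_scale ^ 3)\<^sup>2" by (simp add: power_mult_distrib power_mult[symmetric])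
    then show ?thesis by (simp add: frame_scale_cube power2_eq_square)
  qed
  have t: "triple_product (c1 *\<^sub>R (a *\<^sub>R u)) (c2 *\<^sub>R (a *\<^sub>R v)) (c3 *\<^sub>R (a *\<^sub>R w)) = (c1 * c2 * c3) * a ^ 3 * triple_product u v w"
    for c1 c2 c3 a u v w
    by (simp add: triple_product_def cross_mult_left cross_mult_right power3_eq_cube)
  have "\<bar>triple_product (\<beta> $ e *\<^sub>R (M *v edge_cross e)) (\<beta> $ f *\<^sub>R (M *v edge_cross f)) (\<beta> $ g *\<^sub>R (M *v edge_cross g))\<bar>
    = (det M / 2) * (\<beta> $ e * \<beta> $ f * \<beta> $ g * \<bar>triple_product (edge_root e) (edge_root f) (edge_root g)\<bar>)" for e f g
    unfolding edge_cross_eq matrix_vector_mult_scaleR t triple_product_matrix_vector half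
    using b[of e] b[of f] b[of g] M by (simp add: abs_mult)
  then show ?thesis
    unfolding zonotope_eq_centred volume_centred_zonotope volume_sum_def
    by (simp only: sum_distrib_left[symmetric])
qed

lemma boundary_area_zonotope:
  assumes b: "\<And>e. \<beta> $ e > 0" and M: "det M > 0"
  shows "boundary_area (zonotope \<beta> M) = area_unit * frame_scale * area_sum (($) \<beta>) M"
proof -
  let ?v = "\<lambda>e. \<beta> $ e *\<^sub>R (M *v edge_cross e)"
  have s: "2 * frame_scale\<^sup>2 * (2 * frame_scale\<^sup>2) = frame_scale"
  proof -
    have "2 * frame_scale\<^sup>2 * (2 * frame_scale\<^sup>2) = 4 * frame_scale ^ 3 * frame_scale"
      by (simp add: power2_eq_square power3_eq_cube)
    then show ?thesis by (simp add: frame_scale_cube)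
  qed
  have "boundary_area (centred_zonotope ?v) = area_unit * (\<Sum>e\<in>UNIV. \<Sum>f\<in>UNIV. norm (cross3 (?v e) (?v f)))"
  proof (rule boundary_area_centred_zonotope)
    fix a assume a: "\<And>e. a \<bullet> ?v e = 0"
    have orth: "a \<bullet> (M *v edge_root e) = 0" for e
      using a[of e] b[of e] frame_scale_pos by (simp add: edge_cross_eq matrix_vector_mult_scaleR)
    \<comment> \<open>The roots of 12, 13 and 23 have determinant 2, so their images under
      \<open>M\<close> span the space.\<close>
    have t: "triple_product (M *v edge_root e12) (M *v edge_root e13) (M *v edge_root e23) \<noteq> 0"
      using M unfolding triple_product_matrix_vector edge_roots
      by (simp add: triple_product_def cross3_def inner_vec_def sum_3)
    let ?n = "cross3 (M *v edge_root e13) (M *v edge_root e23)"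
    have n: "?n \<noteq> 0" using t by (auto simp: triple_product_def)
    obtain k where k: "a = k *\<^sub>R ?n" using perp_both_multiple[OF n orth orth] by blast
    have "k * triple_product (M *v edge_root e12) (M *v edge_root e13) (M *v edge_root e23) = 0"
      using orth[of e12] by (simp add: k triple_product_def inner_commute)
    then have "k = 0" using t by simp
    then show "a = 0" by (simp add: k)
  qed
  also have "(\<Sum>e\<in>UNIV. \<Sum>f\<in>UNIV. norm (cross3 (?v e) (?v f))) = frame_scale * area_sum (($) \<beta>) M"
  proof -
    have "norm (cross3 (?v e) (?v f)) = frame_scale * (\<beta> $ e * \<beta> $ f * norm (cofactor_vec M (cross3 (edge_root e) (edge_root f))))" for e f
    proof -
      have "cross3 (?v e) (?v f) = (\<beta> $ e * \<beta> $ f * (2 * frame_scale\<^sup>2 * (2 * frame_scale\<^sup>2)))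
           *\<^sub>R cofactor_vec M (cross3 (edge_root e) (edge_root f))"
        unfolding edge_cross_eq matrix_vector_mult_scaleR cross_mult_left cross_mult_right cross3_matrix_vector
        by (simp add: mult_ac)
      then show ?thesis unfolding s using b[of e] b[of f] frame_scale_pos by (simp add: abs_mult)
    qed
    then show ?thesis unfolding area_sum_def by (simp only: sum_distrib_left[symmetric])
  qed
  finally show ?thesis by (simp add: zonotope_eq_centred)
qed

lemma triple_product_vector:
  "triple_product (vector [a, b, c]) (vector [d, e, f]) (vector [g, h, i])
    = a * (e * i - f * h) + b * (f * g - d * i) + c * (d * h - e * g)"
  by (simp add: triple_product_def cross3_def inner_vec_def sum_3)

text \<open>The generators are cross products of four vectors with sum zero, so the three edges at a
  vertex give dependent roots; the other 16 of the 20 triples are independent. They are the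
  complements of the spanning trees of the complete graph on four vertices.\<close>

lemma volume_sum_eq:
  "volume_sum b = (let a = b e12; b' = b e13; c = b e14; d = b e23; e = b e24; f = b e34 in
    a*b'*d + a*b'*e + a*b'*f + a*c*d + a*c*e + a*c*f + a*d*f + a*e*f
    + b'*c*d + b'*c*e + b'*c*f + b'*d*e + b'*e*f + c*d*e + c*d*f + d*e*f)"
  unfolding volume_sum_def sum_edge edge_roots Let_def triple_product_vector
  by (simp add: algebra_simps)

subsection \<open>Jets on the slice\<close>

abbreviation (input) "slice \<equiv> W0 \<times> G0"

abbreviation (input) weight :: "(real^edge) \<times> (real^3^3) \<Rightarrow> edge \<Rightarrow> real" where
  "weight h e \<equiv> exp (fst h $ e)"

definition slice_matrix :: "(real^edge) \<times> (real^3^3) \<Rightarrow> real^3^3" where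
  "slice_matrix h = matrix_expo ((- (1/2)) *\<^sub>R snd h)"

lemma slice_last_weight:
  assumes "h \<in> slice"
  shows "fst h $ e34 = - fst h $ e12 - fst h $ e13 - fst h $ e14 - fst h $ e23 - fst h $ e24"
  using assms by (auto simp: W0_def sum_edge)

lemma slice_symmetric:
  assumes "h \<in> slice"
  shows "snd h $ 2 $ 1 = snd h $ 1 $ 2" "snd h $ 3 $ 1 = snd h $ 1 $ 3" "snd h $ 3 $ 2 = snd h $ 2 $ 3"
proof -
  have "transpose (snd h) = snd h" using assms by (auto simp: G0_def)
  then have "transpose (snd h) $ i $ j = snd h $ i $ j" for i j by (simp only:)
  then have "snd h $ j $ i = snd h $ i $ j" for i j by (simp add: transpose_def)
  then show "snd h $ 2 $ 1 = snd h $ 1 $ 2" "snd h $ 3 $ 1 = snd h $ 1 $ 3" "snd h $ 3 $ 2 = snd h $ 2 $ 3"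
    by blast+
qed

lemma slice_trace_zero:
  assumes "h \<in> slice"
  shows "snd h $ 3 $ 3 = - snd h $ 1 $ 1 - snd h $ 2 $ 2"
  using assms by (auto simp: G0_def trace_def sum_3)

lemma jet_weight: "jet V (\<lambda>h. weight h e) 1 (\<lambda>h. fst h $ e) (\<lambda>h. (fst h $ e)\<^sup>2)"
proof -
  have lin: "bounded_linear (\<lambda>h :: (real^edge) \<times> (real^3^3). fst h $ e)"
    by (rule bounded_linear_compose[OF bounded_linear_vec_nth bounded_linear_fst])
  have d: "(exp has_real_derivative exp y) (at y)" for y :: real by (rule DERIV_exp)
  show ?thesis
    by (rule jet_cong[OF jet_compose_real[OF jet_linear[OF lin], where \<phi> = exp and \<phi>' = exp, OF always_eventually d]])
      (use d in auto)
qed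

lemma jet_weight2:
  "jet V (\<lambda>h. weight h e * weight h f) 1 (\<lambda>h. fst h $ e + fst h $ f) (\<lambda>h. (fst h $ e + fst h $ f)\<^sup>2)"
  by (rule jet_cong[OF jet_mult[OF jet_weight jet_weight]]) (auto simp: power2_eq_square algebra_simps)

lemma jet_weight3:
  "jet V (\<lambda>h. weight h e * weight h f * weight h g) 1 (\<lambda>h. fst h $ e + fst h $ f + fst h $ g)
    (\<lambda>h. (fst h $ e + fst h $ f + fst h $ g)\<^sup>2)"
  by (rule jet_cong[OF jet_mult[OF jet_weight2 jet_weight]]) (auto simp: power2_eq_square algebra_simps)

lemma jet_slice_matrix:
  "jet V (\<lambda>h. slice_matrix h $ i $ j) (if i = j then 1 else 0) (\<lambda>h. - snd h $ i $ j / 2)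
    (\<lambda>h. (snd h ** snd h) $ i $ j / 4)"
proof -
  have lin: "bounded_linear (\<lambda>h :: (real^edge) \<times> (real^3^3). (- (1/2)) *\<^sub>R snd h)"
    by (rule bounded_linear_scaleR_right[THEN bounded_linear_compose, OF bounded_linear_snd])
  show ?thesis unfolding slice_matrix_def
    by (rule jet_cong[OF jet_compose_linear[OF jet_matrix_expo_entry[where V = UNIV] lin]])
      (auto simp: matrix_matrix_mult_def sum_divide_distrib)
qed

text \<open>The determinant of the exponential is the exponential of the trace, so it is 1 on the
  slice; its expansion to second order is checked directly from the entries.\<close>

lemma jet_det: "jet slice (\<lambda>h. det (slice_matrix h)) 1 (\<lambda>_. 0) (\<lambda>_. 0)"
  unfolding det_3
  by (rule jet_cong, (rule jet_add jet_diff jet_mult jet_slice_matrix)+)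
    (simp_all add: slice_symmetric slice_trace_zero matrix_matrix_mult_def sum_3 field_simps)

text \<open>For symmetric \<open>\<sigma>\<close> of trace zero the cofactor matrix of
  exp(-\<sigma>/2) is its inverse exp(\<sigma>/2), and this is the expansion of the latter.\<close>

lemma jet_cofactor_vec:
  "jet slice (\<lambda>h. cofactor_vec (slice_matrix h) w $ k) (w $ k) (\<lambda>h. (snd h *v w) $ k / 2)
    (\<lambda>h. (snd h *v (snd h *v w)) $ k / 4)"
  using exhaust_3[of k]
  by (elim disjE; simp only: cofactor_vec_def vector_3)
    (rule jet_cong, (rule jet_add jet_diff jet_cmult jet_mult jet_slice_matrix)+,
     simp_all add: slice_symmetric slice_trace_zero matrix_matrix_mult_def matrix_vector_mult_def sum_3 field_simps)+

section \<open>Area to second order\<close>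

lemma jet_sqrt:
  assumes f: "jet V f a D Q" and a: "a > 0"
  shows "jet V (\<lambda>x. sqrt (f x)) (sqrt a) (\<lambda>h. D h / (2 * sqrt a)) (\<lambda>h. Q h / (2 * sqrt a) - (D h)\<^sup>2 / (4 * a * sqrt a))"
proof -
  have "\<forall>\<^sub>F y in nhds a. y > 0" using eventually_nhds_in_open[of "{0<..}" a] a by simp
  then have 1: "\<forall>\<^sub>F y in nhds a. (sqrt has_real_derivative inverse (sqrt y) / 2) (at y)"
    by eventually_elim (rule DERIV_real_sqrt)
  have 2: "((\<lambda>y. inverse (sqrt y) / 2) has_real_derivative - 1 / (4 * a * sqrt a)) (at a)"
    using a by (auto intro!: derivative_eq_intros simp: field_simps power2_eq_square)
  show ?thesis
    by (rule jet_cong[OF jet_compose_real[OF f 1 2]]) (simp_all add: field_simps)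
qed

lemma jet_norm_cofactor_vec:
  "jet slice (\<lambda>h. norm (cofactor_vec (slice_matrix h) w)) (norm w) (\<lambda>h. (w \<bullet> (snd h *v w)) / (2 * norm w))
    (\<lambda>h. (norm (snd h *v w))\<^sup>2 / (2 * norm w) - (w \<bullet> (snd h *v w))\<^sup>2 / (4 * norm w ^ 3))"
\<comment> \<open>The square root cannot be expanded at 0, but for \<open>w = 0\<close> the function
  is constant.\<close>
proof (cases "w = 0")
  case True
  have "cofactor_vec M 0 = 0" for M using cofactor_vec_scale[of M 0 0] by simp
  then show ?thesis by (simp add: True jet_const)
next
  case False
  let ?y = "\<lambda>h k. cofactor_vec (slice_matrix h) w $ k"
  have n: "norm x = sqrt (x $ 1 * x $ 1 + x $ 2 * x $ 2 + x $ 3 * x $ 3)" for x :: "real^3"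
    by (simp add: norm_eq_sqrt_inner inner_vec_def sum_3)
  have w: "w $ 1 * w $ 1 + w $ 2 * w $ 2 + w $ 3 * w $ 3 = (norm w)\<^sup>2"
    by (simp add: power2_norm_eq_inner inner_vec_def sum_3)
  have J: "jet slice (\<lambda>h. ?y h 1 * ?y h 1 + ?y h 2 * ?y h 2 + ?y h 3 * ?y h 3) ((norm w)\<^sup>2)
    (\<lambda>h. w \<bullet> (snd h *v w)) (\<lambda>h. (norm (snd h *v w))\<^sup>2)"
    apply (rule jet_cong)
       apply (rule jet_add jet_mult jet_cofactor_vec)+
      apply (simp add: w)
     apply (simp add: inner_vec_def sum_3 field_simps)
    apply (simp add: slice_symmetric power2_norm_eq_inner inner_vec_def matrix_vector_mult_def sum_3 field_simps)
    done
  have "(norm w)\<^sup>2 > 0" using False by simp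
  from jet_sqrt[OF J this] show ?thesis
    unfolding n[of "cofactor_vec _ _"] by (simp add: power2_eq_square power3_eq_cube mult_ac)
qed

text \<open>The second derivative at \<open>t = 0\<close> of exp(t x) times the norm of exp(t
  \<sigma>/2) w: the contribution of one ordered pair of generators with cross product
  \<open>w\<close> and sum of log-weights \<open>x\<close>.\<close>

definition pair_form :: "real \<Rightarrow> real^3 \<Rightarrow> real^3^3 \<Rightarrow> real" where
  "pair_form x w \<sigma> = x\<^sup>2 * norm w + x * (w \<bullet> (\<sigma> *v w)) / norm w
     + (norm (\<sigma> *v w))\<^sup>2 / (2 * norm w) - (w \<bullet> (\<sigma> *v w))\<^sup>2 / (4 * norm w ^ 3)"

definition area_form :: "(real^edge) \<times> (real^3^3) \<Rightarrow> real" where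
  "area_form h = (\<Sum>e\<in>UNIV. \<Sum>f\<in>UNIV. pair_form (fst h $ e + fst h $ f) (cross3 (edge_root e) (edge_root f)) (snd h))"

lemma cross3_vector:
  "cross3 (vector [a, b, c]) (vector [d, e, f]) = vector [b * f - c * e, c * d - a * f, a * e - b * d]"
  by (simp add: cross3_def)

lemma norm_vector_3: "norm (vector [a, b, c] :: real^3) = sqrt (a\<^sup>2 + b\<^sup>2 + c\<^sup>2)"
  by (simp add: norm_eq_sqrt_inner inner_vec_def sum_3 power2_eq_square)

text \<open>The value counts ordered pairs: 24 from two edges at a common vertex, with cross product
  of length \<open>sqrt 3\<close>, and 6 from opposite edges, with length 2.\<close>

lemma jet_area_sum:
  "\<exists>D. jet slice (\<lambda>h. area_sum (weight h) (slice_matrix h)) (24 * sqrt 3 + 12) D area_form"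
proof -
  let ?w = "\<lambda>e f. cross3 (edge_root e) (edge_root f)"
  have J: "jet slice (\<lambda>h. weight h e * weight h f * norm (cofactor_vec (slice_matrix h) w)) (norm w)
      (\<lambda>h. (w \<bullet> (snd h *v w)) / (2 * norm w) + norm w * (fst h $ e + fst h $ f))
      (\<lambda>h. pair_form (fst h $ e + fst h $ f) w (snd h))" for e f w
    by (rule jet_cong[OF jet_mult[OF jet_weight2 jet_norm_cofactor_vec]]) (simp_all add: pair_form_def del: distrib_left_numeral)
  have "jet slice (\<lambda>h. area_sum (weight h) (slice_matrix h)) (\<Sum>e\<in>UNIV. \<Sum>f\<in>UNIV. norm (?w e f))
      (\<lambda>h. \<Sum>e\<in>UNIV. \<Sum>f\<in>UNIV. (?w e f \<bullet> (snd h *v ?w e f)) / (2 * norm (?w e f)) + norm (?w e f) * (fst h $ e + fst h $ f))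
      area_form"
    unfolding area_sum_def area_form_def by (intro jet_sum finite J)
  moreover have "(\<Sum>e\<in>UNIV. \<Sum>f\<in>UNIV. norm (?w e f)) = 24 * sqrt 3 + 12"
    unfolding sum_edge edge_roots cross3_vector norm_vector_3 by simp
  ultimately show ?thesis by metis
qed

section \<open>Volume to second order\<close>

definition volume_form :: "(real^edge) \<Rightarrow> real" where
  "volume_form l = (let a = l $ e12; b = l $ e13; c = l $ e14; d = l $ e23; e = l $ e24; f = l $ e34 in
    (a + b + d)\<^sup>2 + (a + b + e)\<^sup>2 + (a + b + f)\<^sup>2 + (a + c + d)\<^sup>2 + (a + c + e)\<^sup>2 + (a + c + f)\<^sup>2
    + (a + d + f)\<^sup>2 + (a + e + f)\<^sup>2 + (b + c + d)\<^sup>2 + (b + c + e)\<^sup>2 + (b + c + f)\<^sup>2 + (b + d + e)\<^sup>2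
    + (b + e + f)\<^sup>2 + (c + d + e)\<^sup>2 + (c + d + f)\<^sup>2 + (d + e + f)\<^sup>2)"

text \<open>Each edge occurs in 8 of the 16 triples, so the first derivative is 8 times the sum of
  the \<open>fst h $ e\<close>, which is 0 on the slice.\<close>

lemma jet_volume_sum:
  "jet slice (\<lambda>h. volume_sum (weight h)) 16 (\<lambda>_. 0) (\<lambda>h. volume_form (fst h))"
  unfolding volume_sum_eq Let_def
  by (rule jet_cong, (rule jet_add jet_weight3)+) (simp_all add: slice_last_weight volume_form_def Let_def algebra_simps)

lemma jet_volume:
  "jet slice (\<lambda>h. det (slice_matrix h) * volume_sum (weight h)) 16 (\<lambda>_. 0) (\<lambda>h. volume_form (fst h))"
  by (rule jet_cong[OF jet_mult[OF jet_det jet_volume_sum]]) auto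

lemma jet_powr:
  assumes f: "jet V f a (\<lambda>_. 0) Q" and a: "a > 0"
  shows "jet V (\<lambda>x. f x powr r) (a powr r) (\<lambda>_. 0) (\<lambda>h. r * a powr (r - 1) * Q h)"
proof -
  have "\<forall>\<^sub>F y in nhds a. y > 0" using eventually_nhds_in_open[of "{0<..}" a] a by simp
  then have 1: "\<forall>\<^sub>F y in nhds a. ((\<lambda>y. y powr r) has_real_derivative r * y powr (r - 1)) (at y)"
    by eventually_elim (rule has_real_derivative_powr)
  have 2: "((\<lambda>y. r * y powr (r - 1)) has_real_derivative r * ((r - 1) * a powr (r - 1 - 1))) (at a)"
    by (rule DERIV_cmult[OF has_real_derivative_powr[OF a]])
  show ?thesis
    by (rule jet_cong[OF jet_compose_real[OF f 1 2]]) simp_all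
qed

lemma jet_eventually_pos:
  fixes f :: "'a::real_normed_vector \<Rightarrow> real"
  assumes "jet V f c D Q" "c > 0"
  shows "\<forall>\<^sub>F x in nhds 0. f x > 0"
proof -
  obtain f' F where "jet_via V f c D Q f' F" using assms(1) unfolding jet_def by blast
  note f = jet_viaD[OF this]
  have "(f \<longlongrightarrow> f 0) (nhds 0)"
    using has_derivative_continuous[OF f(4)] by (metis isCont_def tendsto_at_iff_tendsto_nhds)
  then show ?thesis using assms(2) f(1) by (intro order_tendstoD(1)) auto
qed

text \<open>The volume at the origin is \<open>16\<close> and the area is \<open>24 * sqrt 3 + 12\<close> units; up to a positive factor,
  this is the second-order term of area over volume to the power \<open>2/3\<close>.\<close>

definition slice_form :: "(real^edge) \<times> (real^3^3) \<Rightarrow> real" where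
  "slice_form h = 16 * area_form h - (16 * sqrt 3 + 8) * volume_form (fst h)"

text \<open>A positive determinant holds near the origin on and off the slice; keeping it as a
  factor gives a formula whose jet can be taken in the ambient space.\<close>

lemma Psi_eq:
  assumes "det (slice_matrix h) > 0"
  shows "Psi h = area_unit * frame_scale *
     (area_sum (weight h) (slice_matrix h) * (det (slice_matrix h) * volume_sum (weight h)) powr (- 2/3))"
proof -
  obtain l s where h: "h = (l, s)" by (cases h)
  let ?\<beta> = "\<chi> e. exp (l $ e)"
  have b: "?\<beta> $ e > 0" for e by simp
  have bw: "(\<lambda>e. ?\<beta> $ e) = weight h" by (auto simp: h)
  have M: "matrix_expo ((- (1/2)) *\<^sub>R s) = slice_matrix h" by (simp add: slice_matrix_def h)
  have "Phi h = zonotope ?\<beta> (slice_matrix h)" by (simp add: Phi_def h slice_matrix_def)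
  then show ?thesis
    unfolding Psi_def isoperimetric_quotient_def
    using volume_zonotope[OF b assms] boundary_area_zonotope[OF b assms] bw
    by (simp add: powr_minus_divide)
qed

lemma Psi_hessian:
  "\<exists>H. has_hessian_on Psi H 0 slice \<and> (\<forall>h\<in>slice. blinfun_apply (blinfun_apply H h) h =
     area_unit * frame_scale * 16 powr (- 5/3) * slice_form h)"
proof -
  obtain D where A: "jet slice (\<lambda>h. area_sum (weight h) (slice_matrix h)) (24 * sqrt 3 + 12) D area_form"
    using jet_area_sum by blast
  \<comment> \<open>\<open>16 powr (- 5/3)\<close> becomes the common factor; \<open>2/3\<close> of
    the area \<open>24 * sqrt 3 + 12\<close> is then the factor \<open>16 * sqrt 3 + 8\<close> in
    \<open>slice_form\<close>.\<close>
  have p: "(16::real) powr (- 2/3) = 16 * 16 powr (- 5/3)"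
  proof -
    have "(16::real) powr (- 2/3) = 16 powr (1 + - 5/3)" by simp
    also have "\<dots> = 16 powr 1 * 16 powr (- 5/3)" by (rule powr_add)
    finally show ?thesis by simp
  qed
  have J: "jet slice (\<lambda>h. area_unit * frame_scale * (area_sum (weight h) (slice_matrix h)
        * (det (slice_matrix h) * volume_sum (weight h)) powr (- 2/3)))
      (area_unit * frame_scale * ((24 * sqrt 3 + 12) * 16 powr (- 2/3)))
      (\<lambda>h. area_unit * frame_scale * ((24 * sqrt 3 + 12) * 0 + 16 powr (- 2/3) * D h))
      (\<lambda>h. area_unit * frame_scale * 16 powr (- 5/3) * slice_form h)"
  proof (rule jet_cong[OF jet_cmult[OF jet_mult[OF A jet_powr[OF jet_volume]]]])
    fix h
    show "area_unit * frame_scale * ((24 * sqrt 3 + 12) * (- 2/3 * 16 powr (- 2/3 - 1) * volume_form (fst h))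
       + 2 * D h * 0 + 16 powr (- 2/3) * area_form h) = area_unit * frame_scale * 16 powr (- 5/3) * slice_form h"
      unfolding p slice_form_def by (simp add: algebra_simps)
  qed auto
  have "\<forall>\<^sub>F h in nhds 0. det (slice_matrix h) > 0" by (rule jet_eventually_pos[OF jet_det]) simp
  then obtain S where S: "open S" "0 \<in> S" "\<And>h. h \<in> S \<Longrightarrow> det (slice_matrix h) > 0"
    unfolding eventually_nhds by blast
  show ?thesis by (rule jet_has_hessian_on[OF J S(1,2)]) (simp add: Psi_eq S(3))
qed

subsection \<open>Positivity\<close>

text \<open>Multiplication by \<open>4 * a\<close> and completion of the square in
  \<open>x\<close>.\<close>

lemma binary_form_nonneg:
  fixes a b c x y :: real
  assumes "a > 0" "b\<^sup>2 < 4 * a * c"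
  shows "0 \<le> a * x\<^sup>2 + b * (x * y) + c * y\<^sup>2"
    and "x \<noteq> 0 \<or> y \<noteq> 0 \<Longrightarrow> 0 < a * x\<^sup>2 + b * (x * y) + c * y\<^sup>2"
proof -
  have eq: "4 * a * (a * x\<^sup>2 + b * (x * y) + c * y\<^sup>2) = (2 * a * x + b * y)\<^sup>2 + (4 * a * c - b\<^sup>2) * y\<^sup>2"
    by (simp add: power2_eq_square algebra_simps)
  have "0 \<le> 4 * a * (a * x\<^sup>2 + b * (x * y) + c * y\<^sup>2)" unfolding eq using assms by simp
  then show "0 \<le> a * x\<^sup>2 + b * (x * y) + c * y\<^sup>2" using assms(1) by (simp add: zero_le_mult_iff)
  show "0 < a * x\<^sup>2 + b * (x * y) + c * y\<^sup>2" if "x \<noteq> 0 \<or> y \<noteq> 0"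
  proof -
    have "0 < 4 * a * (a * x\<^sup>2 + b * (x * y) + c * y\<^sup>2)"
    proof (cases "y = 0")
      case True then show ?thesis unfolding eq using that assms by simp
    next
      case False then show ?thesis unfolding eq using assms by (intro add_nonneg_pos) auto
    qed
    then show ?thesis using assms(1) by (simp add: zero_less_mult_iff)
  qed
qed

lemma pair_form_vector:
  assumes N: "N = a\<^sup>2 + b\<^sup>2 + c\<^sup>2" "N > 0"
    and sym: "\<sigma> $ 2 $ 1 = \<sigma> $ 1 $ 2" "\<sigma> $ 3 $ 1 = \<sigma> $ 1 $ 3" "\<sigma> $ 3 $ 2 = \<sigma> $ 2 $ 3"
  shows "pair_form x (vector [a, b, c]) \<sigma> = sqrt N * (x\<^sup>2
    + x * (a\<^sup>2 * \<sigma>$1$1 + b\<^sup>2 * \<sigma>$2$2 + c\<^sup>2 * \<sigma>$3$3 + 2*a*b * \<sigma>$1$2 + 2*a*c * \<sigma>$1$3 + 2*b*c * \<sigma>$2$3) / N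
    + ((a * \<sigma>$1$1 + b * \<sigma>$1$2 + c * \<sigma>$1$3)\<^sup>2 + (a * \<sigma>$1$2 + b * \<sigma>$2$2 + c * \<sigma>$2$3)\<^sup>2
        + (a * \<sigma>$1$3 + b * \<sigma>$2$3 + c * \<sigma>$3$3)\<^sup>2) / (2 * N)
    - (a\<^sup>2 * \<sigma>$1$1 + b\<^sup>2 * \<sigma>$2$2 + c\<^sup>2 * \<sigma>$3$3 + 2*a*b * \<sigma>$1$2 + 2*a*c * \<sigma>$1$3 + 2*b*c * \<sigma>$2$3)\<^sup>2 / (4 * N\<^sup>2))"
proof -
  let ?w = "vector [a, b, c] :: real^3"
  let ?s = "a\<^sup>2 * \<sigma>$1$1 + b\<^sup>2 * \<sigma>$2$2 + c\<^sup>2 * \<sigma>$3$3 + 2*a*b * \<sigma>$1$2 + 2*a*c * \<sigma>$1$3 + 2*b*c * \<sigma>$2$3"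
  let ?q = "(a * \<sigma>$1$1 + b * \<sigma>$1$2 + c * \<sigma>$1$3)\<^sup>2 + (a * \<sigma>$1$2 + b * \<sigma>$2$2 + c * \<sigma>$2$3)\<^sup>2
        + (a * \<sigma>$1$3 + b * \<sigma>$2$3 + c * \<sigma>$3$3)\<^sup>2"
  have n: "norm ?w = sqrt N" by (simp add: norm_vector_3 N)
  have s: "?w \<bullet> (\<sigma> *v ?w) = ?s"
    by (simp add: inner_vec_def matrix_vector_mult_def sum_3 sym power2_eq_square algebra_simps)
  have q: "(norm (\<sigma> *v ?w))\<^sup>2 = ?q"
    unfolding power2_norm_eq_inner inner_vec_def sum_3
    by (simp add: matrix_vector_mult_def sum_3 sym power2_eq_square mult_ac)
  \<comment> \<open>With \<open>N\<close> written as a square the identity becomes rational in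
    \<open>r\<close>.\<close>
  define r where "r = sqrt N"
  have r: "r > 0" "N = r * r" using N(2) by (auto simp: r_def)
  show ?thesis unfolding pair_form_def n s q r_def[symmetric]
    using r(1) unfolding r(2) by (simp add: field_simps power2_eq_square power3_eq_cube)
qed

lemma pair_form_zero: "pair_form x (vector [0, 0, 0]) \<sigma> = 0"
proof -
  have "(vector [0, 0, 0] :: real^3) = 0" by (simp add: vec_eq_iff forall_3)
  then show ?thesis by (simp add: pair_form_def)
qed

text \<open>\<open>pair_form\<close> divided by \<open>sqrt 3\<close>, for a normal with entries 1
  or -1, whose squared length is 3.\<close>

definition hexagon_term :: "real \<Rightarrow> real \<Rightarrow> real \<Rightarrow> real \<Rightarrow> real^3^3 \<Rightarrow> real" where
  "hexagon_term x a b c \<sigma> = x\<^sup>2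
    + x * (\<sigma>$1$1 + \<sigma>$2$2 + \<sigma>$3$3 + 2*a*b * \<sigma>$1$2 + 2*a*c * \<sigma>$1$3 + 2*b*c * \<sigma>$2$3) / 3
    + ((a * \<sigma>$1$1 + b * \<sigma>$1$2 + c * \<sigma>$1$3)\<^sup>2 + (a * \<sigma>$1$2 + b * \<sigma>$2$2 + c * \<sigma>$2$3)\<^sup>2
        + (a * \<sigma>$1$3 + b * \<sigma>$2$3 + c * \<sigma>$3$3)\<^sup>2) / 6
    - (\<sigma>$1$1 + \<sigma>$2$2 + \<sigma>$3$3 + 2*a*b * \<sigma>$1$2 + 2*a*c * \<sigma>$1$3 + 2*b*c * \<sigma>$2$3)\<^sup>2 / 36"

text \<open>Opposite normals give the same term, so one representative of each of the four hexagon
  directions is kept.\<close>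

lemma hexagon_term_minus:
  "hexagon_term x (- 1) (- 1) (- 1) \<sigma> = hexagon_term x 1 1 1 \<sigma>"
  "hexagon_term x (- 1) 1 1 \<sigma> = hexagon_term x 1 (- 1) (- 1) \<sigma>"
  "hexagon_term x 1 (- 1) 1 \<sigma> = hexagon_term x (- 1) 1 (- 1) \<sigma>"
  "hexagon_term x 1 1 (- 1) \<sigma> = hexagon_term x (- 1) (- 1) 1 \<sigma>"
  unfolding hexagon_term_def by (simp_all add: power2_eq_square algebra_simps)

text \<open>The coefficients of this and the next form are collected from \<open>hexagons\<close>,
  multiplied by \<open>sqrt 3\<close>, and \<open>squares\<close> in
  \<open>slice_form_blocks\<close>.\<close>

definition diagonal_block :: "real \<Rightarrow> real \<Rightarrow> real" where
  "diagonal_block x y = (40 - 16 * sqrt 3) * x\<^sup>2 + 64 * (x * y) + (16 + 64 * sqrt 3) * y\<^sup>2"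

definition offdiagonal_block :: "real \<Rightarrow> real \<Rightarrow> real" where
  "offdiagonal_block x y = (32 * sqrt 3 - 16) * x\<^sup>2 + 256/3 * sqrt 3 * (x * y) + (64 + 256/3 * sqrt 3) * y\<^sup>2"

text \<open>The roots of two opposite edges are orthogonal to the same coordinate axis: 12 and 34
  belong to axis 1, 13 and 24 to axis 2, 14 and 23 to axis 3. The sum goes with the diagonal entry
  at that axis, the difference with the off-diagonal entry of the other two.\<close>

lemma slice_form_blocks:
  assumes h: "h \<in> slice"
  defines "l \<equiv> fst h" and "\<sigma> \<equiv> snd h"
  shows "slice_form h =
      diagonal_block (l$e12 + l$e34) (\<sigma>$1$1) + diagonal_block (l$e13 + l$e24) (\<sigma>$2$2)
    + diagonal_block (l$e14 + l$e23) (\<sigma>$3$3) + offdiagonal_block (l$e12 - l$e34) (\<sigma>$2$3)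
    + offdiagonal_block (l$e13 - l$e24) (\<sigma>$1$3) + offdiagonal_block (l$e14 - l$e23) (\<sigma>$1$2)"
proof -
  have sym: "\<sigma> $ 2 $ 1 = \<sigma> $ 1 $ 2" "\<sigma> $ 3 $ 1 = \<sigma> $ 1 $ 3" "\<sigma> $ 3 $ 2 = \<sigma> $ 2 $ 3"
    unfolding \<sigma>_def by (rule slice_symmetric[OF h])+
  have hex: "pair_form x (vector [a, b, c]) \<sigma> = sqrt 3 * hexagon_term x a b c \<sigma>"
    if "a\<^sup>2 = 1" "b\<^sup>2 = 1" "c\<^sup>2 = 1" for x a b c
    using pair_form_vector[OF refl _ sym, of a b c x] that by (simp add: hexagon_term_def)
  have sq1: "pair_form x (vector [a, 0, 0]) \<sigma> = 2 * (x\<^sup>2 + x * \<sigma>$1$1 + ((\<sigma>$1$1)\<^sup>2 + (\<sigma>$1$2)\<^sup>2 + (\<sigma>$1$3)\<^sup>2) / 2 - (\<sigma>$1$1)\<^sup>2 / 4)"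
    if "a\<^sup>2 = 4" for x a
    using pair_form_vector[OF refl _ sym, of a 0 0 x] that by (simp add: power_mult_distrib)
  have sq2: "pair_form x (vector [0, a, 0]) \<sigma> = 2 * (x\<^sup>2 + x * \<sigma>$2$2 + ((\<sigma>$1$2)\<^sup>2 + (\<sigma>$2$2)\<^sup>2 + (\<sigma>$2$3)\<^sup>2) / 2 - (\<sigma>$2$2)\<^sup>2 / 4)"
    if "a\<^sup>2 = 4" for x a
    using pair_form_vector[OF refl _ sym, of 0 a 0 x] that by (simp add: power_mult_distrib)
  have sq3: "pair_form x (vector [0, 0, a]) \<sigma> = 2 * (x\<^sup>2 + x * \<sigma>$3$3 + ((\<sigma>$1$3)\<^sup>2 + (\<sigma>$2$3)\<^sup>2 + (\<sigma>$3$3)\<^sup>2) / 2 - (\<sigma>$3$3)\<^sup>2 / 4)"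
    if "a\<^sup>2 = 4" for x a
    using pair_form_vector[OF refl _ sym, of 0 0 a x] that by (simp add: power_mult_distrib)
  obtain a b c d e f where l: "l$e12 = a" "l$e13 = b" "l$e14 = c" "l$e23 = d" "l$e24 = e" "l$e34 = f" by blast
  obtain p q r s t u where s: "\<sigma>$1$1 = p" "\<sigma>$2$2 = q" "\<sigma>$3$3 = r" "\<sigma>$1$2 = s" "\<sigma>$1$3 = t" "\<sigma>$2$3 = u" by blast
  have z: "f = - a - b - c - d - e" "r = - p - q"
    using slice_last_weight[OF h] slice_trace_zero[OF h] l s unfolding l_def \<sigma>_def by linarith+
  \<comment> \<open>\<open>HS\<close> runs over the 12 unordered pairs of edges at a common vertex
    and \<open>SQ\<close> over the 3 opposite pairs, both stripped of the lengths
    \<open>sqrt 3\<close> and 2 of the cross products.\<close>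
  define HS where "HS = hexagon_term (a + b) 1 1 1 \<sigma> + hexagon_term (a + c) 1 1 1 \<sigma> + hexagon_term (b + c) 1 1 1 \<sigma>
      + hexagon_term (a + d) 1 (-1) (-1) \<sigma> + hexagon_term (a + e) 1 (-1) (-1) \<sigma> + hexagon_term (d + e) 1 (-1) (-1) \<sigma>
      + hexagon_term (b + d) (-1) 1 (-1) \<sigma> + hexagon_term (b + f) (-1) 1 (-1) \<sigma> + hexagon_term (d + f) (-1) 1 (-1) \<sigma>
      + hexagon_term (c + e) (-1) (-1) 1 \<sigma> + hexagon_term (c + f) (-1) (-1) 1 \<sigma> + hexagon_term (e + f) (-1) (-1) 1 \<sigma>"
  define SQ where "SQ = ((a + f)\<^sup>2 + (a + f) * p + (p\<^sup>2 + s\<^sup>2 + t\<^sup>2) / 2 - p\<^sup>2 / 4)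
     + ((b + e)\<^sup>2 + (b + e) * q + (s\<^sup>2 + q\<^sup>2 + u\<^sup>2) / 2 - q\<^sup>2 / 4)
     + ((c + d)\<^sup>2 + (c + d) * r + (t\<^sup>2 + u\<^sup>2 + r\<^sup>2) / 2 - r\<^sup>2 / 4)"
  have area: "area_form h = 2 * sqrt 3 * HS + 4 * SQ"
    unfolding area_form_def sum_edge edge_roots cross3_vector l_def[symmetric] \<sigma>_def[symmetric] l
    by (simp add: hex sq1 sq2 sq3 pair_form_zero s hexagon_term_minus)
      (simp add: HS_def SQ_def algebra_simps add_divide_distrib)
  \<comment> \<open>The volume term is shared out, 16 to the \<open>sqrt 3\<close> part and 8 to the
    rational part, so that two polynomial identities with rational coefficients remain.\<close>
  have hexagons: "32 * HS - 16 * volume_form l =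
     - 16 * ((a + f)\<^sup>2 + (b + e)\<^sup>2 + (c + d)\<^sup>2) + 64 * (p\<^sup>2 + q\<^sup>2 + r\<^sup>2)
     + 32 * ((a - f)\<^sup>2 + (b - e)\<^sup>2 + (c - d)\<^sup>2) + 256/3 * ((a - f) * u + (b - e) * t + (c - d) * s)
     + 256/3 * (u\<^sup>2 + t\<^sup>2 + s\<^sup>2)"
    unfolding HS_def volume_form_def Let_def l hexagon_term_def s z
    by (simp add: power2_eq_square field_simps)
  have squares: "64 * SQ - 8 * volume_form l =
     40 * ((a + f)\<^sup>2 + (b + e)\<^sup>2 + (c + d)\<^sup>2) + 64 * ((a + f) * p + (b + e) * q + (c + d) * r)
     + 16 * (p\<^sup>2 + q\<^sup>2 + r\<^sup>2) - 16 * ((a - f)\<^sup>2 + (b - e)\<^sup>2 + (c - d)\<^sup>2) + 64 * (u\<^sup>2 + t\<^sup>2 + s\<^sup>2)"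
    unfolding SQ_def volume_form_def Let_def l z
    by (simp add: power2_eq_square field_simps)
  have "slice_form h = sqrt 3 * (32 * HS - 16 * volume_form l) + (64 * SQ - 8 * volume_form l)"
    unfolding slice_form_def area l_def[symmetric] by (simp add: algebra_simps)
  then show ?thesis unfolding hexagons squares l s diagonal_block_def offdiagonal_block_def
    by (simp add: algebra_simps add_divide_distrib diff_divide_distrib)
qed

lemma blocks_nonneg:
  shows diagonal_block_nonneg: "0 \<le> diagonal_block x y"
    and diagonal_block_pos: "x \<noteq> 0 \<or> y \<noteq> 0 \<Longrightarrow> 0 < diagonal_block x y"
    and offdiagonal_block_nonneg: "0 \<le> offdiagonal_block x y"
    and offdiagonal_block_pos: "x \<noteq> 0 \<or> y \<noteq> 0 \<Longrightarrow> 0 < offdiagonal_block x y"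
proof -
  define r where "r = sqrt 3"
  have rr: "r * r = 3" by (simp add: r_def)
  \<comment> \<open>After \<open>r * r = 3\<close> both discriminant conditions are linear in
    \<open>r\<close> and follow from the lower bound; the upper bound gives
    \<open>40 - 16 * r > 0\<close>.\<close>
  have r: "1.7 < r" "r < 1.74"
    unfolding r_def by (rule real_less_rsqrt real_less_lsqrt; simp add: power2_eq_square)+
  have a: "40 - 16 * r > 0" "(64::real)\<^sup>2 < 4 * (40 - 16 * r) * (16 + 64 * r)"
  proof -
    have "4 * (40 - 16 * r) * (16 + 64 * r) = 2560 + 9216 * r - 4096 * (r * r)" by (simp add: algebra_simps)
    then show "(64::real)\<^sup>2 < 4 * (40 - 16 * r) * (16 + 64 * r)" using r by (simp add: rr)
  qed (use r in simp)
  have b: "32 * r - 16 > 0" "(256/3 * r)\<^sup>2 < 4 * (32 * r - 16) * (64 + 256/3 * r)"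
  proof -
    have "(256/3 * r)\<^sup>2 = 65536 / 9 * (r * r)" by (simp add: power2_eq_square)
    moreover have "4 * (32 * r - 16) * (64 + 256/3 * r) = 32768/3 * (r * r) + 8192/3 * r - 4096" by (simp add: algebra_simps)
    ultimately show "(256/3 * r)\<^sup>2 < 4 * (32 * r - 16) * (64 + 256/3 * r)" using r by (simp add: rr)
  qed (use r in simp)
  show "0 \<le> diagonal_block x y" "x \<noteq> 0 \<or> y \<noteq> 0 \<Longrightarrow> 0 < diagonal_block x y"
    unfolding diagonal_block_def r_def[symmetric] by (rule binary_form_nonneg[OF a]; assumption)+
  show "0 \<le> offdiagonal_block x y" "x \<noteq> 0 \<or> y \<noteq> 0 \<Longrightarrow> 0 < offdiagonal_block x y"
    unfolding offdiagonal_block_def r_def[symmetric] by (rule binary_form_nonneg[OF b]; assumption)+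
qed

lemma slice_form_pos:
  assumes h: "h \<in> slice" and ne: "h \<noteq> 0"
  shows "slice_form h > 0"
proof (rule ccontr)
  define l where "l = fst h"
  define \<sigma> where "\<sigma> = snd h"
  note A = diagonal_block_nonneg and B = offdiagonal_block_nonneg
  assume "\<not> slice_form h > 0"
  \<comment> \<open>Six nonnegative blocks whose sum is not positive must all vanish.\<close>
  then have "diagonal_block (l$e12 + l$e34) (\<sigma>$1$1) \<le> 0" "diagonal_block (l$e13 + l$e24) (\<sigma>$2$2) \<le> 0"
    "diagonal_block (l$e14 + l$e23) (\<sigma>$3$3) \<le> 0" "offdiagonal_block (l$e12 - l$e34) (\<sigma>$2$3) \<le> 0"
    "offdiagonal_block (l$e13 - l$e24) (\<sigma>$1$3) \<le> 0" "offdiagonal_block (l$e14 - l$e23) (\<sigma>$1$2) \<le> 0"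
    using A[of "l$e12 + l$e34" "\<sigma>$1$1"] A[of "l$e13 + l$e24" "\<sigma>$2$2"] A[of "l$e14 + l$e23" "\<sigma>$3$3"]
      B[of "l$e12 - l$e34" "\<sigma>$2$3"] B[of "l$e13 - l$e24" "\<sigma>$1$3"] B[of "l$e14 - l$e23" "\<sigma>$1$2"]
    unfolding slice_form_blocks[OF h] l_def \<sigma>_def by linarith+
  then have z: "l$e12 + l$e34 = 0 \<and> \<sigma>$1$1 = 0" "l$e13 + l$e24 = 0 \<and> \<sigma>$2$2 = 0" "l$e14 + l$e23 = 0 \<and> \<sigma>$3$3 = 0"
    "l$e12 - l$e34 = 0 \<and> \<sigma>$2$3 = 0" "l$e13 - l$e24 = 0 \<and> \<sigma>$1$3 = 0" "l$e14 - l$e23 = 0 \<and> \<sigma>$1$2 = 0"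
    using diagonal_block_pos offdiagonal_block_pos by (meson not_le)+
  then have le: "l$e12 = 0" "l$e13 = 0" "l$e14 = 0" "l$e23 = 0" "l$e24 = 0" "l$e34 = 0"
    by linarith+
  have "l = 0"
  proof (unfold vec_eq_iff, rule allI)
    fix e show "l $ e = 0 $ e" using le UNIV_edge by (metis UNIV_I empty_iff insert_iff zero_index)
  qed
  moreover have "\<sigma> = 0"
    using z slice_symmetric[OF h] by (simp add: vec_eq_iff forall_3 \<sigma>_def)
  ultimately show False using ne by (simp add: l_def \<sigma>_def prod_eq_iff)
qed

subsection \<open>The dimension of the slice\<close>

lemma dim_W0: "dim W0 = 5"
proof -
  let ?a = "(\<chi> e. 1) :: real^edge"
  have "W0 = {x. ?a \<bullet> x = 0}" by (auto simp: W0_def inner_vec_def)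
  moreover have "?a \<noteq> 0" by (simp add: vec_eq_iff)
  then have "dim {x. ?a \<bullet> x = 0} = DIM(real^edge) - 1" by (rule dim_hyperplane)
  ultimately show ?thesis by (simp add: CARD_edge)
qed

lemma dim_G0: "dim G0 = 5"
proof -
  define f :: "real \<times> real \<times> real \<times> real \<times> real \<Rightarrow> real^3^3" where
    "f = (\<lambda>(p, q, s, t, u). vector [vector [p, s, t], vector [s, q, u], vector [t, u, - p - q]])"
  have lin: "linear f"
    by (rule linearI) (auto simp: f_def vec_eq_iff forall_3 algebra_simps split: prod.splits)
  have inj: "inj f"
    by (auto simp: inj_def f_def vec_eq_iff forall_3)
  have "range f = G0"
  proof (intro equalityI subsetI)
    fix A assume "A \<in> range f"
    then show "A \<in> G0"
      by (auto simp: f_def G0_def transpose_def vec_eq_iff forall_3 trace_def sum_3)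
  next
    fix A assume A: "A \<in> G0"
    \<comment> \<open>Pairing the matrix with zero weights makes the slice lemmas applicable to
      it.\<close>
    then have h: "(0, A) \<in> slice" by (simp add: W0_def)
    have "A = f (A$1$1, A$2$2, A$1$2, A$1$3, A$2$3)"
      using slice_symmetric[OF h] slice_trace_zero[OF h] by (simp add: f_def vec_eq_iff forall_3)
    then show "A \<in> range f" by blast
  qed
  moreover have "dim (range f) = dim (UNIV :: (real \<times> real \<times> real \<times> real \<times> real) set)"
    by (rule dim_image_eq[OF lin]) (use inj in simp)
  ultimately show ?thesis by simp
qed

lemma dim_slice: "dim slice = 10"
proof -
  have "subspace W0" by (auto simp: subspace_def W0_def sum.distrib sum_distrib_left[symmetric])
  moreover have "subspace G0"
    by (auto simp: subspace_def G0_def transpose_def vec_eq_iff trace_def sum.distrib sum_distrib_left[symmetric])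
  ultimately show ?thesis by (simp add: dim_Times dim_W0 dim_G0)
qed

theorem mainTheorem2:
  shows "dim (W0 \<times> G0) = 10 \<and>
    (\<exists>H. has_hessian_on Psi H 0 (W0 \<times> G0) \<and>
      (\<forall>h \<in> W0 \<times> G0. h \<noteq> 0 \<longrightarrow> blinfun_apply (blinfun_apply H h) h > 0))"
proof -
  obtain H where H: "has_hessian_on Psi H 0 slice"
    "\<forall>h\<in>slice. blinfun_apply (blinfun_apply H h) h = area_unit * frame_scale * 16 powr (- 5/3) * slice_form h"
    using Psi_hessian by blast
  have "blinfun_apply (blinfun_apply H h) h > 0" if "h \<in> slice" "h \<noteq> 0" for h
  proof -
    have "blinfun_apply (blinfun_apply H h) h = area_unit * frame_scale * 16 powr (- 5/3) * slice_form h"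
      using H(2) that(1) by blast
    also have "\<dots> > 0" using slice_form_pos[OF that] area_unit_pos frame_scale_pos by simp
    finally show ?thesis .
  qed
  then show ?thesis using H(1) dim_slice by blast
qed

end
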